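(* Let $\beta\in(0,2]$ and $L>0$ be known, let $K$ satisfy the kernel assumptions, let $\alpha\in(0,1)$, run FOMT with $C_n(\alpha)=-2\log(\alpha/2)h_n^{-1}$, and let $\Delta_{\beta,n}=(\log n/n)^{(\beta-\lceil\beta\rceil+1)/(2\beta+1)}$. Then there exist constants $0<c<C<\infty$ depending on $\beta$ such that: (i) $\liminf_{n\to\infty}\inf_{f\in\mathcal F_\beta(C\Delta_{\beta,n})}\mathbb P_f(\Phi=1)\ge1-\alpha$; (ii) for every sequence of tests $\Psi=\Psi_n(Y_1,\dots,Y_n)\in\{0,1\}$ with $\limsup_{n\to\infty}\sup_{f\in H}\mathbb P_f(\Psi=1)\le\alpha$, one has $\limsup_{n\to\infty}\inf_{f\in\mathcal F_\beta(c\Delta_{\beta,n})}\mathbb P_f(\Psi=1)\le\alpha$.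
   Context: Model: for each $n\in\mathbb N$ one observes $Y_i=f(x_i)+\varepsilon_i$, $i\in[n]:=\{1,\dots,n\}$, with $x_i=i/n$, $\varepsilon_i$ i.i.d. $\mathcal N(0,\sigma^2)$ with known $\sigma>0$, and $f:[0,1]\to\mathbb R$ unknown; $\mathbb P_f$ is the law when the regression function is $f$. For $\beta>0,L>0$, $\Sigma(\beta,L)$ is the set of functions $f:[0,1]\to\mathbb R$ with $|f^{(\lceil\beta\rceil-1)}(x)-f^{(\lceil\beta\rceil-1)}(y)|\le L|x-y|^{\beta+1-\lceil\beta\rceil}$ for all $x,y$. $\mathcal M$ is the set of nondecreasing functions on $[0,1]$ and $H=\Sigma(\beta,L)\cap\mathcal M$. For $\delta>0$: if $\beta\in(0,1]$, $\mathcal F_\beta(\delta)=\{f\in\Sigma(\beta,L):\max_{0\le a<b\le1}(f(a)-f(b))\ge\delta\}$; if $\beta\in(1,2]$, $\mathcal F_\beta(\delta)=\{f\in\Sigma(\beta,L):\min_{x\in[0,1]}f'(x)\le-\delta\}$. Kernel assumptions: $K$ nonnegative, $\int K=1$, supported in $[-1,1]$; constants $K_{\min},K_{\max},\Delta>0$ with $K_{\min}\mathbf 1_{\{|u|\le\Delta\}}\le K(u)\le K_{\max}$; $K$ Lipschitz with constant $L_K$; $K$ symmetric. $\mu_2=\int K^2$. LPE of order $k=\lceil\beta\rceil-1$, bandwidth $h$: $U(u)=(1,u,\dots,u^k/k!)^\top$, $\mathcal B_{nx}=\frac1{nh}\sum_iU(\tfrac{x_i-x}h)U(\tfrac{x_i-x}h)^\top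 K(\tfrac{x_i-x}h)$, $\hat f_n(x)=\sum_iW_{ni}(x)Y_i$, $W_{ni}(x)=\frac1{nh}U(0)^\top\mathcal B_{nx}^{-1}U(\tfrac{x_i-x}h)K(\tfrac{x_i-x}h)$. $\lambda_0>0$: smallest eigenvalue of $\mathcal B_{nx}$ is $\ge\lambda_0$ for all $x$ and large $n$ (paper: $\lambda_0=1/2$ for $\beta\le1$, $0.0228$ for $\beta\in(1,2]$). Constants: $C_*=8K_{\max}/\lambda_0$, $q_1=C_*L/(\lceil\beta\rceil-1)!$, $q_2=16\sigma^2\lceil\beta\rceil\mu_2/\lambda_0^2$, $C_h=(q_2/(4q_1^2\beta))^{1/(2\beta+1)}$, $h_n=C_h(\log n/n)^{1/(2\beta+1)}$; $L_1=\sqrt e(K_{\max}+L_K)$, $L_2=2\lceil\beta\rceil K_{\max}+\lceil\beta\rceil L_K$, $\widetilde C_*=L_1/(8L_2)+\sqrt eK_{\max}/\lambda_0$, $W=\max(4C_*^2,4\widetilde C_*^2)$. FOMT: $N_{\max}=\frac{40}{\log2}C_n(\alpha)(\log n)^2$; for $i<j$, $T_{i,j}=\hat f_n(x_i)-\hat f_n(x_j)$ (bandwidth $h_n$), $C_{n,\alpha,i,j}=\sigma\sqrt{-2\log(\alpha/N_{\max})W}\,n^{-1/2}h_n^{-3/2}(\tfrac{8L_2}{\lambda_0}|x_i-x_j|\wedge h_n)$, $D_{n,\beta,i,j}=0$ if $x_i,x_j\in[h_n,1-h_n]$ and $(\tfrac{16K_{\max}}{\lambda_0}\vee2)Lh_n^\beta$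 otherwise, $\Phi_{i,j}=\mathbf 1\{T_{i,j}\ge C_{n,\alpha,i,j}+D_{n,\beta,i,j}\}$. $\Phi$: repeat $C_n(\alpha)$ times: draw $I\sim\mathrm{Unif}([n])$; if $I\le n-1$, repeat $\lceil20\log n\rceil$ times: for $k=0,\dots,\lceil\log_2(n-I)\rceil$ draw $J_k\sim\mathrm{Unif}\{1,\dots,\min(2^k,n-I)\}$, if $\Phi_{I,I+J_k}=1$ output $\Phi=1$ and stop; if $I\ge2$, repeat $\lceil20\log n\rceil$ times: for $k=0,\dots,\lceil\log_2(I-1)\rceil$ draw $J'_k\sim\mathrm{Unif}\{1,\dots,\min(2^k,I-1)\}$, if $\Phi_{I-J'_k,I}=1$ output $\Phi=1$ and stop. Otherwise output $\Phi=0$. All draws independent of each other and of the data. *)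

theory Defs
  imports "HOL-Probability.Probability"
    "Jordan_Normal_Form.Matrix" "Jordan_Normal_Form.Char_Poly"
    "Jordan_Normal_Form.Gauss_Jordan_Elimination"
begin

definition kord :: "real \<Rightarrow> nat" where
  "kord \<beta> = nat \<lceil>\<beta>\<rceil> - 1"

text \<open>Hoelder class Sigma(beta,L) of functions on [0,1]: f has derivatives
  f^(0)=f, ..., f^(k) on [0,1] (one-sided at the endpoints), k = ceiling(beta)-1,
  and f^(k) is Hoelder with exponent beta+1-ceiling(beta) and constant L.
  Functions are of type real => real; only their values on [0,1] matter.\<close>
definition holder_class :: "real \<Rightarrow> real \<Rightarrow> (real \<Rightarrow> real) set" where
  "holder_class \<beta> L = {f. \<exists>D :: nat \<Rightarrow> real \<Rightarrow> real.
      (\<forall>x\<in>{0..1}. D 0 x = f x) \<and>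
      (\<forall>j<kord \<beta>. \<forall>x\<in>{0..1}. (D j has_real_derivative D (Suc j) x) (at x within {0..1})) \<and>
      (\<forall>x\<in>{0..1}. \<forall>y\<in>{0..1}.
          \<bar>D (kord \<beta>) x - D (kord \<beta>) y\<bar> \<le> L * \<bar>x - y\<bar> powr (\<beta> + 1 - real_of_int \<lceil>\<beta>\<rceil>))}"

definition null_class :: "real \<Rightarrow> real \<Rightarrow> (real \<Rightarrow> real) set" where
  "null_class \<beta> L = holder_class \<beta> L \<inter> {f. mono_on {0..1} f}"

text \<open>Alternatives F_beta(delta) (only used for beta in (0,2]).\<close>
definition alt_class :: "real \<Rightarrow> real \<Rightarrow> real \<Rightarrow> (real \<Rightarrow> real) set" where
  "alt_class \<beta> L \<delta> =
     (if \<beta> \<le> 1 then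
        {f \<in> holder_class \<beta> L. \<exists>a b. 0 \<le> a \<and> a < b \<and> b \<le> 1 \<and> f a - f b \<ge> \<delta>}
      else
        {f \<in> holder_class \<beta> L. \<exists>x\<in>{0..1}. \<exists>d.
            (f has_real_derivative d) (at x within {0..1}) \<and> d \<le> - \<delta>})"

definition data_law :: "real \<Rightarrow> (real \<Rightarrow> real) \<Rightarrow> nat \<Rightarrow> (nat \<Rightarrow> real) measure" where
  "data_law \<sigma> f n = PiM {1..n} (\<lambda>i. density lborel (normal_density (f (real i / real n)) \<sigma>))"

definition Uvec :: "nat \<Rightarrow> real \<Rightarrow> real vec" where
  "Uvec k u = vec (k + 1) (\<lambda>j. u ^ j / fact j)"

definition Bmat :: "nat \<Rightarrow> (real \<Rightarrow> real) \<Rightarrow> nat \<Rightarrow> real \<Rightarrow> real \<Rightarrow> real mat" where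
  "Bmat k K n h x = mat (k + 1) (k + 1) (\<lambda>(j, l).
      (1 / (real n * h)) * (\<Sum>i = 1..n.
         (let u = (real i / real n - x) / h in Uvec k u $ j * Uvec k u $ l * K u)))"

definition lpe_weight :: "nat \<Rightarrow> (real \<Rightarrow> real) \<Rightarrow> nat \<Rightarrow> real \<Rightarrow> real \<Rightarrow> nat \<Rightarrow> real" where
  "lpe_weight k K n h x i =
     (let u = (real i / real n - x) / h in
      case mat_inverse (Bmat k K n h x) of
        Some Binv \<Rightarrow> (1 / (real n * h)) * scalar_prod (Uvec k 0) (Binv *\<^sub>v Uvec k u) * K u
      | None \<Rightarrow> 0)"

definition lpe :: "nat \<Rightarrow> (real \<Rightarrow> real) \<Rightarrow> nat \<Rightarrow> real \<Rightarrow> (nat \<Rightarrow> real) \<Rightarrow> real \<Rightarrow> real" where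
  "lpe k K n h Y x = (\<Sum>i = 1..n. lpe_weight k K n h x i * Y i)"

definition mu2 :: "(real \<Rightarrow> real) \<Rightarrow> real" where
  "mu2 K = (LINT u|lborel. (K u)\<^sup>2)"

definition Cstar :: "real \<Rightarrow> real \<Rightarrow> real" where
  "Cstar Kmax lam0 = 8 * Kmax / lam0"

definition q1 :: "real \<Rightarrow> real \<Rightarrow> real \<Rightarrow> real \<Rightarrow> real" where
  "q1 \<beta> L Kmax lam0 = Cstar Kmax lam0 * L / fact (kord \<beta>)"

definition q2 :: "real \<Rightarrow> real \<Rightarrow> (real \<Rightarrow> real) \<Rightarrow> real \<Rightarrow> real" where
  "q2 \<beta> \<sigma> K lam0 = 16 * \<sigma>\<^sup>2 * real_of_int \<lceil>\<beta>\<rceil> * mu2 K / lam0\<^sup>2"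

definition Ch :: "real \<Rightarrow> real \<Rightarrow> real \<Rightarrow> (real \<Rightarrow> real) \<Rightarrow> real \<Rightarrow> real \<Rightarrow> real" where
  "Ch \<beta> L \<sigma> K Kmax lam0 =
     (q2 \<beta> \<sigma> K lam0 / (4 * (q1 \<beta> L Kmax lam0)\<^sup>2 * \<beta>)) powr (1 / (2 * \<beta> + 1))"

definition hn :: "real \<Rightarrow> real \<Rightarrow> real \<Rightarrow> (real \<Rightarrow> real) \<Rightarrow> real \<Rightarrow> real \<Rightarrow> nat \<Rightarrow> real" where
  "hn \<beta> L \<sigma> K Kmax lam0 n = Ch \<beta> L \<sigma> K Kmax lam0 * (ln (real n) / real n) powr (1 / (2 * \<beta> + 1))"

definition L1c :: "real \<Rightarrow> real \<Rightarrow> real" where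
  "L1c Kmax LK = sqrt (exp 1) * (Kmax + LK)"

definition L2c :: "real \<Rightarrow> real \<Rightarrow> real \<Rightarrow> real" where
  "L2c \<beta> Kmax LK = 2 * real_of_int \<lceil>\<beta>\<rceil> * Kmax + real_of_int \<lceil>\<beta>\<rceil> * LK"

definition Ctilde :: "real \<Rightarrow> real \<Rightarrow> real \<Rightarrow> real \<Rightarrow> real" where
  "Ctilde \<beta> Kmax LK lam0 = L1c Kmax LK / (8 * L2c \<beta> Kmax LK) + sqrt (exp 1) * Kmax / lam0"

definition Wc :: "real \<Rightarrow> real \<Rightarrow> real \<Rightarrow> real \<Rightarrow> real" where
  "Wc \<beta> Kmax LK lam0 = max (4 * (Cstar Kmax lam0)\<^sup>2) (4 * (Ctilde \<beta> Kmax LK lam0)\<^sup>2)"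

definition Delta_rate :: "real \<Rightarrow> nat \<Rightarrow> real" where
  "Delta_rate \<beta> n = (ln (real n) / real n) powr ((\<beta> - real_of_int \<lceil>\<beta>\<rceil> + 1) / (2 * \<beta> + 1))"

fun repeat_pmf :: "nat \<Rightarrow> bool pmf \<Rightarrow> bool pmf" where
  "repeat_pmf 0 p = return_pmf False"
| "repeat_pmf (Suc m) p = bind_pmf p (\<lambda>b. if b then return_pmf True else repeat_pmf m p)"

fun scan_pmf :: "(nat \<Rightarrow> nat set) \<Rightarrow> (nat \<Rightarrow> bool) \<Rightarrow> nat list \<Rightarrow> bool pmf" where
  "scan_pmf S t [] = return_pmf False"
| "scan_pmf S t (k # ks) =
     bind_pmf (pmf_of_set (S k)) (\<lambda>J. if t J then return_pmf True else scan_pmf S t ks)"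

definition Cn :: "real \<Rightarrow> real \<Rightarrow> real \<Rightarrow> (real \<Rightarrow> real) \<Rightarrow> real \<Rightarrow> real \<Rightarrow> real \<Rightarrow> nat \<Rightarrow> real" where
  "Cn \<beta> L \<sigma> K Kmax lam0 \<alpha> n = - 2 * ln (\<alpha> / 2) / hn \<beta> L \<sigma> K Kmax lam0 n"

definition Nmax :: "real \<Rightarrow> real \<Rightarrow> real \<Rightarrow> (real \<Rightarrow> real) \<Rightarrow> real \<Rightarrow> real \<Rightarrow> real \<Rightarrow> nat \<Rightarrow> real" where
  "Nmax \<beta> L \<sigma> K Kmax lam0 \<alpha> n = 40 / ln 2 * Cn \<beta> L \<sigma> K Kmax lam0 \<alpha> n * (ln (real n))\<^sup>2"

definition local_test ::
  "real \<Rightarrow> real \<Rightarrow> real \<Rightarrow> (real \<Rightarrow> real) \<Rightarrow> real \<Rightarrow> real \<Rightarrow> real \<Rightarrow> real \<Rightarrow> nat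
    \<Rightarrow> (nat \<Rightarrow> real) \<Rightarrow> nat \<Rightarrow> nat \<Rightarrow> bool" where
  "local_test \<beta> L \<sigma> K Kmax LK lam0 \<alpha> n Y i j =
     (let h = hn \<beta> L \<sigma> K Kmax lam0 n;
          xi = real i / real n; xj = real j / real n;
          T = lpe (kord \<beta>) K n h Y xi - lpe (kord \<beta>) K n h Y xj;
          Cthr = \<sigma> * sqrt (- 2 * ln (\<alpha> / Nmax \<beta> L \<sigma> K Kmax lam0 \<alpha> n) * Wc \<beta> Kmax LK lam0)
                 * real n powr (- 1 / 2) * h powr (- 3 / 2)
                 * min (8 * L2c \<beta> Kmax LK / lam0 * \<bar>xi - xj\<bar>) h;
          D = (if xi \<in> {h..1 - h} \<and> xj \<in> {h..1 - h} then 0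
               else max (16 * Kmax / lam0) 2 * L * h powr \<beta>)
      in T \<ge> Cthr + D)"

text \<open>The randomized FOMT test: for data Y, the distribution of Phi over the
  auxiliary draws (which are independent of each other and of the data).
  The number of outer repetitions C_n(alpha) is rounded up to an integer.\<close>
definition fomt ::
  "real \<Rightarrow> real \<Rightarrow> real \<Rightarrow> (real \<Rightarrow> real) \<Rightarrow> real \<Rightarrow> real \<Rightarrow> real \<Rightarrow> real \<Rightarrow> nat
    \<Rightarrow> (nat \<Rightarrow> real) \<Rightarrow> bool pmf" where
  "fomt \<beta> L \<sigma> K Kmax LK lam0 \<alpha> n Y =
     (let \<Phi> = local_test \<beta> L \<sigma> K Kmax LK lam0 \<alpha> n Y;
          R = nat \<lceil>20 * ln (real n)\<rceil>;
          right = (\<lambda>I. scan_pmf (\<lambda>k. {1..min (2 ^ k) (n - I)}) (\<lambda>J. \<Phi> I (I + J))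
                          [0..<nat \<lceil>log 2 (real (n - I))\<rceil> + 1]);
          left = (\<lambda>I. scan_pmf (\<lambda>k. {1..min (2 ^ k) (I - 1)}) (\<lambda>J. \<Phi> (I - J) I)
                          [0..<nat \<lceil>log 2 (real (I - 1))\<rceil> + 1]);
          outer = bind_pmf (pmf_of_set {1..n}) (\<lambda>I.
                    bind_pmf (if I \<le> n - 1 then repeat_pmf R (right I) else return_pmf False)
                      (\<lambda>b. if b then return_pmf True
                           else if 2 \<le> I then repeat_pmf R (left I) else return_pmf False))
      in repeat_pmf (nat \<lceil>Cn \<beta> L \<sigma> K Kmax lam0 \<alpha> n\<rceil>) outer)"

definition fomt_power ::
  "real \<Rightarrow> real \<Rightarrow> real \<Rightarrow> (real \<Rightarrow> real) \<Rightarrow> real \<Rightarrow> real \<Rightarrow> real \<Rightarrow> real \<Rightarrow> nat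
    \<Rightarrow> (real \<Rightarrow> real) \<Rightarrow> real" where
  "fomt_power \<beta> L \<sigma> K Kmax LK lam0 \<alpha> n f =
     (\<integral>Y. pmf (fomt \<beta> L \<sigma> K Kmax LK lam0 \<alpha> n Y) True \<partial>data_law \<sigma> f n)"

definition rej_prob :: "real \<Rightarrow> ((nat \<Rightarrow> real) \<Rightarrow> bool) \<Rightarrow> nat \<Rightarrow> (real \<Rightarrow> real) \<Rightarrow> real" where
  "rej_prob \<sigma> \<Psi> n f = measure (data_law \<sigma> f n) {Y \<in> space (data_law \<sigma> f n). \<Psi> Y}"

end

(*
  Part (i).  On an event of probability at least 1 - alpha/2 all local polynomial estimates at the
  design points are accurate up to a multiple of h_n^beta (Gaussian tails and a union bound), hence
  every pair of design points whose drop is a large multiple of h_n^beta is rejected by its local test.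
  If f drops by a large multiple of h_n^beta between a and b, then the majority of the points between
  a and b lies that far below f near a or that far above f near b; so every index in a block of length
  about 2 n h_n near a (or near b) has a constant fraction of violated partners at some dyadic scale of
  the right (or left) scan.  If f' is very negative at a point, the same holds inside a window of width
  8 h_n.  One round of the outer loop thus succeeds with probability at least h_n, and
  (1 - h_n)^(C_n(alpha)) <= (alpha/2)^2.

  Part (ii).  The zero function is compared with the uniform mixture of about 1/(2r) disjointly
  supported bumps of width r = (log n / n)^(1/(2 beta + 1)) and height c r^beta.  The likelihood ratios
  are uncorrelated and have second moment at most n^(1/12) for small c, so the chi-square distance is
  at most of order r n^(1/12), which tends to 0.
*)
theory Submission
  imports Defs "HOL-Real_Asymp.Real_Asymp"
begin

text \<open>In part (i) the unit is h_n^beta: by the choice of h_n the quantity log n / (n h_n) is a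
  constant times h_n^(2 beta), so noise, bias and local thresholds all have this order, and a slope
  of order -h_n^(beta-1) kept over a length h_n gives a drop of the same order. For beta <= 1 the
  obstacle is that a and b may be far apart with f arbitrary in between, so it cannot be said
  beforehand which indices are useful; comparing the intermediate values with the level (f(a) +
  f(b)) / 2 decides between the two ends. A success chance of 1/8 per scan is enough, since about 20
  log n repetitions amplify it. Half of alpha pays for the noise event and half for the auxiliary
  draws. The eigenvalue hypothesis enters through 1x1 and 2x2 matrices only, as the order is at most
  1 for beta <= 2; the weights are bounded from the explicit smaller eigenvalue. In part (ii) the
  exponent 1/12 only has to stay below 1/5, the least value of 1 / (2 beta + 1) for beta <=
  2.\<close>

section \<open>Gaussian observations\<close>

text \<open>Completing the square in the exponent. This one identity yields both the moment
  generating function and, with \<open>a = m / \<sigma>\<^sup>2\<close>, the change of mean by a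
  density.\<close>

lemma exp_mult_normal_density:
  assumes "0 < \<sigma>"
  shows "exp (a * y) * normal_density m \<sigma> y
       = exp (a * m + a\<^sup>2 * \<sigma>\<^sup>2 / 2) * normal_density (m + a * \<sigma>\<^sup>2) \<sigma> y"
proof -
  have "a * y + - (y - m)\<^sup>2 / (2 * \<sigma>\<^sup>2)
      = (a * m + a\<^sup>2 * \<sigma>\<^sup>2 / 2) + - (y - (m + a * \<sigma>\<^sup>2))\<^sup>2 / (2 * \<sigma>\<^sup>2)"
    using assms by (simp add: divide_simps) (simp add: power2_eq_square algebra_simps)
  then show ?thesis
    unfolding normal_density_def by (simp add: exp_add[symmetric])
qed

abbreviation gauss :: "real \<Rightarrow> real \<Rightarrow> real measure" where
  "gauss \<sigma> m \<equiv> density lborel (normal_density m \<sigma>)"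

lemma gauss_exp_integral:
  assumes "0 < \<sigma>"
  shows "integrable (gauss \<sigma> m) (\<lambda>y. exp (a * y))"
    and "(\<integral>y. exp (a * y) \<partial>gauss \<sigma> m) = exp (a * m + a\<^sup>2 * \<sigma>\<^sup>2 / 2)"
proof -
  have eq: "(\<lambda>y. normal_density m \<sigma> y * exp (a * y))
      = (\<lambda>y. exp (a * m + a\<^sup>2 * \<sigma>\<^sup>2 / 2) * normal_density (m + a * \<sigma>\<^sup>2) \<sigma> y)"
    using exp_mult_normal_density[OF assms, of a _ m] by (subst (1 2) mult.commute) (simp add: fun_eq_iff)
  show "integrable (gauss \<sigma> m) (\<lambda>y. exp (a * y))"
    by (subst integrable_density) (simp_all add: eq assms)
  show "(\<integral>y. exp (a * y) \<partial>gauss \<sigma> m) = exp (a * m + a\<^sup>2 * \<sigma>\<^sup>2 / 2)"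
    by (subst integral_density) (simp_all add: eq assms)
qed

lemma sets_data_law: "sets (data_law \<sigma> f n) = sets (PiM {1..n} (\<lambda>_. borel))"
  unfolding data_law_def by (rule sets_PiM_cong) auto

lemma space_data_law: "space (data_law \<sigma> f n) = space (PiM {1..n} (\<lambda>_. borel))"
  by (rule sets_eq_imp_space_eq[OF sets_data_law])

lemma measurable_data_law: "measurable (data_law \<sigma> f n) N = measurable (PiM {1..n} (\<lambda>_. borel)) N"
  by (rule measurable_cong_sets[OF sets_data_law refl])

lemma prob_space_data_law: "0 < \<sigma> \<Longrightarrow> prob_space (data_law \<sigma> f n)"
  unfolding data_law_def by (intro prob_space_PiM prob_space_normal_density)

lemma product_sigma_finite_gauss:
  "0 < \<sigma> \<Longrightarrow> product_sigma_finite (\<lambda>i::nat. gauss \<sigma> (g i))"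
  unfolding product_sigma_finite_def
  by (auto intro!: prob_space_imp_sigma_finite prob_space_normal_density)

lemma data_law_exp_integral:
  assumes "0 < \<sigma>"
  shows "integrable (data_law \<sigma> f n) (\<lambda>Y. exp (\<Sum>i=1..n. a i * Y i))"
    and "(\<integral>Y. exp (\<Sum>i=1..n. a i * Y i) \<partial>data_law \<sigma> f n)
       = exp (\<Sum>i=1..n. a i * f (real i / real n) + (a i)\<^sup>2 * \<sigma>\<^sup>2 / 2)"
proof -
  interpret product_sigma_finite "\<lambda>i. gauss \<sigma> (f (real i / real n))"
    by (rule product_sigma_finite_gauss[OF assms])
  show "integrable (data_law \<sigma> f n) (\<lambda>Y. exp (\<Sum>i=1..n. a i * Y i))"
    unfolding data_law_def exp_sum[OF finite_atLeastAtMost]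
    by (intro product_integrable_prod gauss_exp_integral assms) auto
  show "(\<integral>Y. exp (\<Sum>i=1..n. a i * Y i) \<partial>data_law \<sigma> f n)
       = exp (\<Sum>i=1..n. a i * f (real i / real n) + (a i)\<^sup>2 * \<sigma>\<^sup>2 / 2)"
    unfolding data_law_def exp_sum[OF finite_atLeastAtMost]
    by (subst product_integral_prod) (auto simp: gauss_exp_integral assms)
qed

section \<open>Likelihood ratios against the pure noise law, whose regression function is 0\<close>

definition lik_ratio :: "real \<Rightarrow> (real \<Rightarrow> real) \<Rightarrow> nat \<Rightarrow> (nat \<Rightarrow> real) \<Rightarrow> real" where
  "lik_ratio \<sigma> f n Y =
     exp (\<Sum>i=1..n. f (real i / real n) / \<sigma>\<^sup>2 * Y i - (f (real i / real n))\<^sup>2 / (2 * \<sigma>\<^sup>2))"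

lemma measurable_component_borel [measurable]:
  "i \<in> {1..n} \<Longrightarrow> (\<lambda>Y. Y i) \<in> borel_measurable (PiM {1..n} (\<lambda>_. borel :: real measure))"
  by (rule measurable_component_singleton)

lemma borel_measurable_lik_ratio:
  "lik_ratio \<sigma> f n \<in> borel_measurable (PiM {1..n} (\<lambda>_. borel))"
  unfolding lik_ratio_def by measurable

lemma gauss_shift:
  assumes "0 < \<sigma>"
  shows "gauss \<sigma> m = density (gauss \<sigma> 0) (\<lambda>y. ennreal (exp (m / \<sigma>\<^sup>2 * y - m\<^sup>2 / (2 * \<sigma>\<^sup>2))))"
proof -
  have "normal_density 0 \<sigma> y * exp (m / \<sigma>\<^sup>2 * y - m\<^sup>2 / (2 * \<sigma>\<^sup>2)) = normal_density m \<sigma> y" for y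
  proof -
    have "(m / \<sigma>\<^sup>2)\<^sup>2 * \<sigma>\<^sup>2 / 2 = m\<^sup>2 / (2 * \<sigma>\<^sup>2)" "m / \<sigma>\<^sup>2 * \<sigma>\<^sup>2 = m"
      using assms by (auto simp: power2_eq_square field_simps)
    with exp_mult_normal_density[OF assms, of "m / \<sigma>\<^sup>2" y 0] show ?thesis
      by (simp add: exp_diff mult.commute)
  qed
  then show ?thesis
    by (subst density_density_eq) (auto simp: ennreal_mult[symmetric])
qed

lemma data_law_eq_density:
  assumes "0 < \<sigma>"
  shows "data_law \<sigma> f n = density (data_law \<sigma> (\<lambda>_. 0) n) (\<lambda>Y. ennreal (lik_ratio \<sigma> f n Y))"
proof -
  interpret F: product_sigma_finite "\<lambda>i::nat. gauss \<sigma> (f (real i / real n))"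
    by (rule product_sigma_finite_gauss[OF assms])
  interpret Z: product_sigma_finite "\<lambda>i::nat. gauss \<sigma> 0"
    by (rule product_sigma_finite_gauss[OF assms])
  let ?P = "PiM {1..n} (\<lambda>i. gauss \<sigma> 0)"
  let ?g = "\<lambda>i y. exp (f (real i / real n) / \<sigma>\<^sup>2 * y - (f (real i / real n))\<^sup>2 / (2 * \<sigma>\<^sup>2))"
  have P: "?P = data_law \<sigma> (\<lambda>_. 0) n" by (simp add: data_law_def)
  have setsP: "sets ?P = sets (PiM {1..n} (\<lambda>_. borel))" unfolding P by (rule sets_data_law)
  have mlr: "(\<lambda>Y. ennreal (lik_ratio \<sigma> f n Y)) \<in> borel_measurable ?P"
    using borel_measurable_lik_ratio measurable_cong_sets[OF setsP refl] by auto
  have "density ?P (\<lambda>Y. ennreal (lik_ratio \<sigma> f n Y))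
      = PiM {1..n} (\<lambda>i. gauss \<sigma> (f (real i / real n)))"
  proof (rule F.PiM_eqI)
  fix A assume A: "\<And>i. i \<in> {1..n} \<Longrightarrow> A i \<in> sets (gauss \<sigma> (f (real i / real n)))"
  have PA: "Pi\<^sub>E {1..n} A \<in> sets ?P"
    using A by (intro sets_PiM_I_finite) auto
  have "emeasure (density ?P (\<lambda>Y. ennreal (lik_ratio \<sigma> f n Y))) (Pi\<^sub>E {1..n} A)
      = (\<integral>\<^sup>+Y. ennreal (lik_ratio \<sigma> f n Y) * indicator (Pi\<^sub>E {1..n} A) Y \<partial>?P)"
    using mlr PA by (rule emeasure_density)
  also have "\<dots> = (\<integral>\<^sup>+Y. (\<Prod>i\<in>{1..n}. ennreal (?g i (Y i)) * indicator (A i) (Y i)) \<partial>?P)"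
  proof (rule nn_integral_cong)
    fix Y assume "Y \<in> space ?P"
    \<comment> \<open>On the product space extensionality of \<open>Y\<close> is automatic, so
      membership in the box is a condition on the coordinates only.\<close>
    then have "indicator (Pi\<^sub>E {1..n} A) Y = (\<Prod>i\<in>{1..n}. indicator (A i) (Y i) :: ennreal)"
      by (auto simp: space_PiM indicator_def PiE_iff extensional_def)
    then show "ennreal (lik_ratio \<sigma> f n Y) * indicator (Pi\<^sub>E {1..n} A) Y
        = (\<Prod>i\<in>{1..n}. ennreal (?g i (Y i)) * indicator (A i) (Y i))"
      unfolding lik_ratio_def exp_sum[OF finite_atLeastAtMost] prod.distrib
      by (simp add: prod_ennreal)
  qed
  also have "\<dots> = (\<Prod>i\<in>{1..n}. \<integral>\<^sup>+y. ennreal (?g i y) * indicator (A i) y \<partial>gauss \<sigma> 0)"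
    using A by (intro Z.product_nn_integral_prod) auto
  also have "\<dots> = (\<Prod>i\<in>{1..n}. emeasure (gauss \<sigma> (f (real i / real n))) (A i))"
  proof (intro prod.cong refl)
    fix i assume "i \<in> {1..n}"
    then show "(\<integral>\<^sup>+y. ennreal (?g i y) * indicator (A i) y \<partial>gauss \<sigma> 0)
        = emeasure (gauss \<sigma> (f (real i / real n))) (A i)"
      using A[of i]
      by (subst (2) gauss_shift[OF assms], subst emeasure_density) auto
  qed
  finally show "emeasure (density ?P (\<lambda>Y. ennreal (lik_ratio \<sigma> f n Y))) (Pi\<^sub>E {1..n} A)
      = (\<Prod>i\<in>{1..n}. emeasure (gauss \<sigma> (f (real i / real n))) (A i))" .
  qed (auto intro!: sets_PiM_cong)
  then show ?thesis by (simp add: data_law_def)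
qed

text \<open>After completing the square only the cross terms survive: the mixed moment is the
  exponential of the inner product of f and g on the grid, over sigma^2. Disjoint supports therefore
  give zero covariance, and \<open>g = 0\<close> gives total mass 1.\<close>

lemma lik_ratio_mult_integral:
  fixes n :: nat
  assumes "0 < \<sigma>"
  defines "P \<equiv> data_law \<sigma> (\<lambda>_. 0) n"
  shows "integrable P (\<lambda>Y. lik_ratio \<sigma> f n Y * lik_ratio \<sigma> g n Y)"
    and "(\<integral>Y. lik_ratio \<sigma> f n Y * lik_ratio \<sigma> g n Y \<partial>P)
       = exp (\<Sum>i=1..n. f (real i / real n) * g (real i / real n) / \<sigma>\<^sup>2)"
proof -
  let ?f = "\<lambda>i. f (real i / real n)" and ?g = "\<lambda>i. g (real i / real n)"
  let ?c = "exp (- (\<Sum>i=1..n. ((?f i)\<^sup>2 + (?g i)\<^sup>2) / (2 * \<sigma>\<^sup>2)))"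
  have eq: "lik_ratio \<sigma> f n Y * lik_ratio \<sigma> g n Y
      = ?c * exp (\<Sum>i=1..n. ((?f i + ?g i) / \<sigma>\<^sup>2) * Y i)" for Y
    unfolding lik_ratio_def
    by (simp add: exp_add[symmetric] sum.distrib[symmetric] sum_negf[symmetric]
        add_divide_distrib algebra_simps)
  show "integrable P (\<lambda>Y. lik_ratio \<sigma> f n Y * lik_ratio \<sigma> g n Y)"
    unfolding eq P_def by (intro integrable_mult_right data_law_exp_integral assms)
  have "((?f i + ?g i) / \<sigma>\<^sup>2)\<^sup>2 * \<sigma>\<^sup>2 / 2 - ((?f i)\<^sup>2 + (?g i)\<^sup>2) / (2 * \<sigma>\<^sup>2) = ?f i * ?g i / \<sigma>\<^sup>2" for i
    using assms(1) by (simp add: divide_simps) (simp add: power2_eq_square algebra_simps)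
  then have "(\<Sum>i=1..n. ?f i * ?g i / \<sigma>\<^sup>2)
     = (\<Sum>i=1..n. ((?f i + ?g i) / \<sigma>\<^sup>2)\<^sup>2 * \<sigma>\<^sup>2 / 2 - ((?f i)\<^sup>2 + (?g i)\<^sup>2) / (2 * \<sigma>\<^sup>2))"
    by simp
  then have s: "- (\<Sum>i=1..n. ((?f i)\<^sup>2 + (?g i)\<^sup>2) / (2 * \<sigma>\<^sup>2)) + (\<Sum>i=1..n. ((?f i + ?g i) / \<sigma>\<^sup>2)\<^sup>2 * \<sigma>\<^sup>2 / 2)
     = (\<Sum>i=1..n. ?f i * ?g i / \<sigma>\<^sup>2)"
    by (simp only: sum_subtractf)
  show "(\<integral>Y. lik_ratio \<sigma> f n Y * lik_ratio \<sigma> g n Y \<partial>P)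
       = exp (\<Sum>i=1..n. ?f i * ?g i / \<sigma>\<^sup>2)"
    unfolding eq P_def integral_mult_right_zero data_law_exp_integral[OF assms(1)]
    using s by (simp add: exp_add[symmetric])
qed

lemma lik_ratio_integral:
  assumes "0 < \<sigma>"
  shows "integrable (data_law \<sigma> (\<lambda>_. 0) n) (lik_ratio \<sigma> f n)"
    and "(\<integral>Y. lik_ratio \<sigma> f n Y \<partial>data_law \<sigma> (\<lambda>_. 0) n) = 1"
  using lik_ratio_mult_integral[OF assms, of n f "\<lambda>_. 0"] by (simp_all add: lik_ratio_def[abs_def])

text \<open>Chernoff bound. \<open>v\<close> is only an upper bound of the sum of squares, so one
  variance bound serves all design points.\<close>

lemma gaussian_noise_tail:
  fixes w :: "nat \<Rightarrow> real"
  assumes "0 < \<sigma>" and v: "(\<Sum>i=1..n. (w i)\<^sup>2) \<le> v" and "0 < v" and "0 < t"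
  shows "measure (data_law \<sigma> f n)
           {Y \<in> space (data_law \<sigma> f n). t \<le> (\<Sum>i=1..n. w i * (Y i - f (real i / real n)))}
         \<le> exp (- t\<^sup>2 / (2 * \<sigma>\<^sup>2 * v))"
proof -
  interpret prob_space "data_law \<sigma> f n" by (rule prob_space_data_law) fact
  \<comment> \<open>Minimiser of s^2 sigma^2 v / 2 - s t, the exponent of the Chernoff
    bound.\<close>
  define s where "s = t / (\<sigma>\<^sup>2 * v)"
  have s: "0 < s" using assms by (simp add: s_def)
  let ?X = "\<lambda>Y. \<Sum>i=1..n. w i * (Y i - f (real i / real n))"
  let ?c = "exp (- (\<Sum>i=1..n. s * w i * f (real i / real n)))"
  have eq: "exp (s * ?X Y) = ?c * exp (\<Sum>i=1..n. (s * w i) * Y i)" for Y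
    by (simp add: exp_add[symmetric] sum_distrib_left sum_subtractf[symmetric] algebra_simps)
  have int: "integrable (data_law \<sigma> f n) (\<lambda>Y. exp (s * ?X Y))"
    unfolding eq by (intro integrable_mult_right data_law_exp_integral assms)
  have "(\<integral>Y. exp (s * ?X Y) \<partial>data_law \<sigma> f n) = exp (s\<^sup>2 * \<sigma>\<^sup>2 / 2 * (\<Sum>i=1..n. (w i)\<^sup>2))"
    unfolding eq integral_mult_right_zero data_law_exp_integral[OF assms(1)]
    by (simp add: exp_add[symmetric] sum.distrib sum_distrib_left algebra_simps)
  also have "\<dots> \<le> exp (s\<^sup>2 * \<sigma>\<^sup>2 / 2 * v)"
    using v by (auto intro!: mult_left_mono)
  finally have I: "(\<integral>Y. exp (s * ?X Y) \<partial>data_law \<sigma> f n) \<le> exp (s\<^sup>2 * \<sigma>\<^sup>2 / 2 * v)" .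
  have "{Y \<in> space (data_law \<sigma> f n). t \<le> ?X Y}
      = {Y \<in> space (data_law \<sigma> f n). exp (s * t) \<le> exp (s * ?X Y)}"
    using s by auto
  then have "prob {Y \<in> space (data_law \<sigma> f n). t \<le> ?X Y}
      \<le> (\<integral>Y. exp (s * ?X Y) \<partial>data_law \<sigma> f n) / exp (s * t)"
    using integral_Markov_inequality_measure[OF int, of "space (data_law \<sigma> f n)" "exp (s * t)"] by auto
  also have "\<dots> \<le> exp (s\<^sup>2 * \<sigma>\<^sup>2 / 2 * v) / exp (s * t)"
    using I by (intro divide_right_mono) auto
  also have "\<dots> = exp (- t\<^sup>2 / (2 * \<sigma>\<^sup>2 * v))"
    using assms by (simp add: exp_diff[symmetric] s_def divide_simps) (simp add: power2_eq_square eval_nat_numeral algebra_simps)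
  finally show ?thesis .
qed

section \<open>The randomized scan\<close>

lemma pmf_bind_bool:
  "pmf (bind_pmf p (\<lambda>b. if b then return_pmf True else q)) True
     = pmf p True + (1 - pmf p True) * pmf q True"
proof -
  have F: "pmf p False = 1 - pmf p True" by (rule pmf_False_conv_True)
  show ?thesis
    unfolding pmf_bind
    by (subst integral_measure_pmf_real[where A = UNIV])
       (auto simp: UNIV_bool F mult.commute)
qed

lemma pmf_repeat_True: "pmf (repeat_pmf m p) True = 1 - (1 - pmf p True) ^ m"
proof (induction m)
  case (Suc m)
  have "pmf (repeat_pmf (Suc m) p) True
      = pmf p True + (1 - pmf p True) * (1 - (1 - pmf p True) ^ m)"
    unfolding repeat_pmf.simps pmf_bind_bool Suc.IH ..
  then show ?case by (simp add: algebra_simps)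
qed simp

lemma scan_pmf_Cons_True:
  assumes "finite (S k)" "S k \<noteq> {}"
  shows "pmf (scan_pmf S t (k # ks)) True
    = real (card {J \<in> S k. t J}) / card (S k)
      + (1 - real (card {J \<in> S k. t J}) / card (S k)) * pmf (scan_pmf S t ks) True"
proof -
  let ?s = "pmf (scan_pmf S t ks) True" and ?T = "{J \<in> S k. t J}" and ?F = "{J \<in> S k. \<not> t J}"
  have c: "card (S k) = card ?T + card ?F"
    using assms by (subst card_Un_disjoint[symmetric]) (auto intro: arg_cong[where f = card])
  have S: "S k = ?T \<union> ?F" by auto
  have "(\<Sum>J\<in>S k. pmf (if t J then return_pmf True else scan_pmf S t ks) True)
      = (\<Sum>J\<in>?T. pmf (if t J then return_pmf True else scan_pmf S t ks) True)
        + (\<Sum>J\<in>?F. pmf (if t J then return_pmf True else scan_pmf S t ks) True)"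
    using assms by (subst S, subst sum.union_disjoint) auto
  also have "\<dots> = card ?T + card ?F * ?s" by simp
  finally have "pmf (scan_pmf S t (k # ks)) True = (card ?T + card ?F * ?s) / card (S k)"
    using assms by (simp add: pmf_bind_pmf_of_set)
  moreover have "real (card (S k)) > 0" using assms by (simp add: card_gt_0_iff)
  moreover have "real (card ?F) = real (card (S k)) - real (card ?T)" using c by simp
  ultimately show ?thesis
    by (simp del: scan_pmf.simps add: field_simps)
qed

text \<open>The scan stops at the first success, so it succeeds at least as often as any single one
  of its draws: \<open>r + (1 - r) * s\<close> dominates both \<open>r\<close> and
  \<open>s\<close>.\<close>

lemma scan_pmf_ge:
  assumes "\<And>k. k \<in> set ks \<Longrightarrow> finite (S k) \<and> S k \<noteq> {}" and "k \<in> set ks"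
  shows "real (card {J \<in> S k. t J}) / card (S k) \<le> pmf (scan_pmf S t ks) True"
  using assms
proof (induction ks)
  case (Cons l ks)
  let ?r = "real (card {J \<in> S l. t J}) / card (S l)" and ?s = "pmf (scan_pmf S t ks) True"
  have fin: "finite (S l)" "S l \<noteq> {}" using Cons.prems(1)[of l] by auto
  have "card {J \<in> S l. t J} \<le> card (S l)" using fin by (intro card_mono) auto
  then have r: "0 \<le> ?r" "?r \<le> 1" by (auto simp: divide_le_eq_1)
  have s: "0 \<le> ?s" "?s \<le> 1" by (simp_all add: pmf_le_1)
  have eq: "pmf (scan_pmf S t (l # ks)) True = ?r + (1 - ?r) * ?s"
    by (rule scan_pmf_Cons_True) (use fin in auto)
  have "?r \<le> ?r + (1 - ?r) * ?s" "?s \<le> ?r + (1 - ?r) * ?s"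
    using mult_nonneg_nonneg[of "1 - ?r" ?s] mult_nonneg_nonneg[of ?r "1 - ?s"] r s
    unfolding right_diff_distrib left_diff_distrib by linarith+
  then show ?case
    unfolding eq using Cons by (cases "k = l") (auto intro: order_trans)
qed simp

text \<open>Some scanned scale \<open>2 ^ k\<close> lies in \<open>[d, 2 d)\<close>.\<close>
lemma dyadic_scan_ge:
  fixes d m :: nat
  assumes "1 \<le> d" "d \<le> m"
  shows "real (card {J \<in> {1..d}. t J}) / (2 * real d)
    \<le> pmf (scan_pmf (\<lambda>k. {1..min (2 ^ k) m}) t [0..<nat \<lceil>log 2 (real m)\<rceil> + 1]) True"
proof -
  define k where "k = nat \<lceil>log 2 (real d)\<rceil>"
  have ld: "0 \<le> log 2 (real d)" using assms by simp
  have le: "\<lceil>log 2 (real d)\<rceil> \<le> \<lceil>log 2 (real m)\<rceil>"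
    using assms by (intro ceiling_mono) simp
  then have "k \<in> set [0..<nat \<lceil>log 2 (real m)\<rceil> + 1]"
    unfolding k_def set_upt atLeastLessThan_iff using nat_mono[OF le] by linarith
  from scan_pmf_ge[OF _ this, of "\<lambda>k. {1..min (2 ^ k) m}" t]
  have ge: "real (card {J \<in> {1..min (2 ^ k) m}. t J}) / card {1..min (2 ^ k) m}
    \<le> pmf (scan_pmf (\<lambda>k. {1..min (2 ^ k) m}) t [0..<nat \<lceil>log 2 (real m)\<rceil> + 1]) True"
    using assms by (auto simp: Suc_le_eq)
  have k1: "log 2 (real d) \<le> real k" "real k < log 2 (real d) + 1"
    using ld unfolding k_def by linarith+
  have "2 powr (log 2 (real d)) \<le> 2 powr real k" using k1 by (intro powr_mono) auto
  then have "real d \<le> real (2 ^ k)" using assms by (simp add: powr_realpow)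
  then have dk: "d \<le> 2 ^ k" by (simp only: of_nat_le_iff)
  have "2 powr real k < 2 powr (log 2 (real d) + 1)" using k1 by (intro powr_less_mono) auto
  then have "real (2 ^ k) < real (2 * d)" using assms by (simp add: powr_add powr_realpow)
  then have kd: "2 ^ k < 2 * d" by (simp only: of_nat_less_iff)
  have "real (card {J \<in> {1..d}. t J}) / (2 * real d)
      \<le> real (card {J \<in> {1..min (2 ^ k) m}. t J}) / card {1..min (2 ^ k) m}"
  proof (rule frac_le)
    have "{J \<in> {1..d}. t J} \<subseteq> {J \<in> {1..min (2 ^ k) m}. t J}" using dk assms by auto
    then show "real (card {J \<in> {1..d}. t J}) \<le> real (card {J \<in> {1..min (2 ^ k) m}. t J})"
      by (auto intro!: card_mono)
    \<comment> \<open>The drawn range is less than twice as long as \<open>{1..d}\<close>; this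
      costs the factor 2 in the denominator.\<close>
    have "card {1..min (2 ^ k) m} \<le> 2 * d" using kd by (simp add: min_le_iff_disj)
    then show "real (card {1..min (2 ^ k) m}) \<le> 2 * real d" by linarith
  qed (use assms in \<open>auto simp: min_def\<close>)
  with ge show ?thesis by linarith
qed

text \<open>Measurability in the data matters because \<open>fomt_power\<close> is a Bochner
  integral, which is 0 by default for a non-measurable integrand.\<close>

lemma pmf_scan_measurable:
  assumes "\<And>k. k \<in> set ks \<Longrightarrow> finite (S k) \<and> S k \<noteq> {}"
    and "\<And>k J. k \<in> set ks \<Longrightarrow> J \<in> S k \<Longrightarrow> Measurable.pred M (\<lambda>Y. t Y J)"
  shows "(\<lambda>Y. pmf (scan_pmf S (t Y) ks) True) \<in> borel_measurable M"
  using assms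
proof (induction ks)
  case (Cons k ks)
  have IH: "(\<lambda>Y. pmf (scan_pmf S (t Y) ks) True) \<in> borel_measurable M"
    using Cons.prems by (intro Cons.IH) auto
  have fin: "finite (S k)" "S k \<noteq> {}" using Cons.prems(1)[of k] by auto
  have "(\<lambda>Y. pmf (if t Y J then return_pmf True else scan_pmf S (t Y) ks) True) \<in> borel_measurable M"
    if "J \<in> S k" for J
  proof -
    have [measurable]: "Measurable.pred M (\<lambda>Y. t Y J)" using Cons.prems(2) that by auto
    have "(\<lambda>Y. if t Y J then 1 else pmf (scan_pmf S (t Y) ks) True) \<in> borel_measurable M"
      using IH by measurable
    then show ?thesis by (rule measurable_cong[THEN iffD1, rotated]) auto
  qed
  then have "(\<lambda>Y. (\<Sum>J\<in>S k. pmf (if t Y J then return_pmf True else scan_pmf S (t Y) ks) True)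
     / real (card (S k))) \<in> borel_measurable M"
    by (intro borel_measurable_divide borel_measurable_sum) auto
  then show ?case using fin by (simp add: pmf_bind_pmf_of_set)
qed simp

section \<open>One round of the outer loop\<close>

definition fomt_right :: "nat \<Rightarrow> (nat \<Rightarrow> nat \<Rightarrow> bool) \<Rightarrow> nat \<Rightarrow> bool pmf" where
  "fomt_right n \<Phi> I = scan_pmf (\<lambda>k. {1..min (2 ^ k) (n - I)}) (\<lambda>J. \<Phi> I (I + J))
                          [0..<nat \<lceil>log 2 (real (n - I))\<rceil> + 1]"

definition fomt_left :: "(nat \<Rightarrow> nat \<Rightarrow> bool) \<Rightarrow> nat \<Rightarrow> bool pmf" where
  "fomt_left \<Phi> I = scan_pmf (\<lambda>k. {1..min (2 ^ k) (I - 1)}) (\<lambda>J. \<Phi> (I - J) I)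
                          [0..<nat \<lceil>log 2 (real (I - 1))\<rceil> + 1]"

definition fomt_inner :: "nat \<Rightarrow> nat \<Rightarrow> (nat \<Rightarrow> nat \<Rightarrow> bool) \<Rightarrow> nat \<Rightarrow> bool pmf" where
  "fomt_inner n R \<Phi> I =
     bind_pmf (if I \<le> n - 1 then repeat_pmf R (fomt_right n \<Phi> I) else return_pmf False)
       (\<lambda>b. if b then return_pmf True
            else if 2 \<le> I then repeat_pmf R (fomt_left \<Phi> I) else return_pmf False)"

lemma fomt_eq:
  "fomt \<beta> L \<sigma> K Kmax LK lam0 \<alpha> n Y =
     repeat_pmf (nat \<lceil>Cn \<beta> L \<sigma> K Kmax lam0 \<alpha> n\<rceil>)
       (bind_pmf (pmf_of_set {1..n})
          (fomt_inner n (nat \<lceil>20 * ln (real n)\<rceil>) (local_test \<beta> L \<sigma> K Kmax LK lam0 \<alpha> n Y)))"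
  unfolding fomt_def fomt_inner_def fomt_right_def fomt_left_def Let_def by simp

lemma pmf_fomt_inner:
  "pmf (fomt_inner n R \<Phi> I) True =
     (let a = (if I \<le> n - 1 then 1 - (1 - pmf (fomt_right n \<Phi> I) True) ^ R else 0);
          b = (if 2 \<le> I then 1 - (1 - pmf (fomt_left \<Phi> I) True) ^ R else 0)
      in a + (1 - a) * b)"
  unfolding fomt_inner_def pmf_bind_bool Let_def by (simp add: pmf_repeat_True)

text \<open>One scan with success probability at least q is enough, because the other one can only
  add rejections.\<close>

lemma pmf_fomt_inner_ge:
  assumes "(I \<le> n - 1 \<and> q \<le> pmf (fomt_right n \<Phi> I) True)
         \<or> (2 \<le> I \<and> q \<le> pmf (fomt_left \<Phi> I) True)"
  shows "1 - (1 - q) ^ R \<le> pmf (fomt_inner n R \<Phi> I) True"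
proof -
  define a where "a = (if I \<le> n - 1 then 1 - (1 - pmf (fomt_right n \<Phi> I) True) ^ R else 0)"
  define b where "b = (if 2 \<le> I then 1 - (1 - pmf (fomt_left \<Phi> I) True) ^ R else 0)"
  have "0 \<le> a" "a \<le> 1" "0 \<le> b" "b \<le> 1"
    by (auto simp: a_def b_def pmf_le_1 power_le_one)
  then have ab: "a \<le> a + (1 - a) * b" "b \<le> a + (1 - a) * b"
    using mult_nonneg_nonneg[of "1 - a" b] mult_nonneg_nonneg[of a "1 - b"]
    by (auto simp: algebra_simps)
  have pw: "(1 - s) ^ R \<le> (1 - q) ^ R" if "q \<le> s" "s \<le> 1" for s :: real
    using that by (intro power_mono) auto
  have "1 - (1 - q) ^ R \<le> a \<or> 1 - (1 - q) ^ R \<le> b"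
    using assms pw[of "pmf (fomt_right n \<Phi> I) True"] pw[of "pmf (fomt_left \<Phi> I) True"]
    by (auto simp: a_def b_def pmf_le_1)
  moreover have "pmf (fomt_inner n R \<Phi> I) True = a + (1 - a) * b"
    unfolding pmf_fomt_inner Let_def a_def b_def ..
  ultimately show ?thesis using ab by linarith
qed

lemma pmf_fomt_outer_ge:
  assumes "1 \<le> n" "A \<subseteq> {1..n}" "0 \<le> q" "q \<le> 1"
    and "\<And>I. I \<in> A \<Longrightarrow> (I \<le> n - 1 \<and> q \<le> pmf (fomt_right n \<Phi> I) True)
                        \<or> (2 \<le> I \<and> q \<le> pmf (fomt_left \<Phi> I) True)"
  shows "real (card A) / n * (1 - (1 - q) ^ R)
    \<le> pmf (bind_pmf (pmf_of_set {1..n}) (fomt_inner n R \<Phi>)) True"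
proof -
  have "real (card A) * (1 - (1 - q) ^ R) = (\<Sum>I\<in>A. 1 - (1 - q) ^ R)" by simp
  also have "\<dots> \<le> (\<Sum>I\<in>A. pmf (fomt_inner n R \<Phi> I) True)"
    by (intro sum_mono pmf_fomt_inner_ge assms)
  also have "\<dots> \<le> (\<Sum>I\<in>{1..n}. pmf (fomt_inner n R \<Phi> I) True)"
    using assms by (intro sum_mono2) auto
  finally show ?thesis
    using assms by (subst pmf_bind_pmf_of_set) (auto simp: divide_right_mono)
qed

lemma pmf_fomt_measurable:
  assumes n: "1 \<le> n"
    and meas: "\<And>i j. 1 \<le> i \<Longrightarrow> i < j \<Longrightarrow> j \<le> n \<Longrightarrow> Measurable.pred M (\<lambda>Y. \<Phi> Y i j)"
  shows "(\<lambda>Y. pmf (repeat_pmf N (bind_pmf (pmf_of_set {1..n}) (fomt_inner n R (\<Phi> Y)))) True)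
    \<in> borel_measurable M"
proof -
  have "(\<lambda>Y. pmf (fomt_inner n R (\<Phi> Y) I) True) \<in> borel_measurable M" if I: "I \<in> {1..n}" for I
  proof -
    have r: "(\<lambda>Y. pmf (fomt_right n (\<Phi> Y) I) True) \<in> borel_measurable M" if "I \<le> n - 1"
      unfolding fomt_right_def using n I that
      by (intro pmf_scan_measurable[where t = "\<lambda>Y J. \<Phi> Y I (I + J)"]) (auto simp: Suc_le_eq intro!: meas)
    have l: "(\<lambda>Y. pmf (fomt_left (\<Phi> Y) I) True) \<in> borel_measurable M" if "2 \<le> I"
      unfolding fomt_left_def using n I that
      by (intro pmf_scan_measurable[where t = "\<lambda>Y J. \<Phi> Y (I - J) I"]) (auto simp: Suc_le_eq intro!: meas)
    show ?thesis
      unfolding pmf_fomt_inner Let_def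
      using r l by (cases "I \<le> n - 1"; cases "2 \<le> I") (auto intro!: borel_measurable_add borel_measurable_diff borel_measurable_times borel_measurable_power)
  qed
  then show ?thesis
    unfolding pmf_repeat_True using n
    by (subst pmf_bind_pmf_of_set) (auto intro!: borel_measurable_diff borel_measurable_power borel_measurable_divide borel_measurable_sum)
qed

section \<open>Local polynomial estimators and Hoelder classes\<close>

text \<open>A singular matrix has eigenvalue 0, against the positive lower bound. Invertibility
  excludes the branch of \<open>lpe_weight\<close> that returns the default weight 0.\<close>

lemma mat_inverse_Some_of_eigenvalues_pos:
  fixes B :: "real mat"
  assumes B: "B \<in> carrier_mat m m" and "0 < lam" and ev: "\<And>e. eigenvalue B e \<Longrightarrow> lam \<le> e"
  obtains C where "mat_inverse B = Some C" "C * B = 1\<^sub>m m" "C \<in> carrier_mat m m"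
proof -
  have "det B \<noteq> 0"
  proof
    assume "det B = 0"
    then obtain v where v: "v \<in> carrier_vec m" "v \<noteq> 0\<^sub>v m" "B *\<^sub>v v = 0\<^sub>v m"
      using det_0_iff_vec_prod_zero[OF B] by auto
    then have "eigenvalue B 0"
      using B unfolding eigenvalue_def eigenvector_def by (intro exI[of _ v]) auto
    with ev \<open>0 < lam\<close> show False by fastforce
  qed
  then have "B \<in> Units (ring_mat TYPE(real) m ())"
    using det_non_zero_imp_unit[OF B] by auto
  then obtain C where "mat_inverse B = Some C"
    using mat_inverse(1)[OF B, of "()"] by (cases "mat_inverse B") auto
  with mat_inverse(2)[OF B this] that show thesis by auto
qed

text \<open>The smaller root \<open>e\<close> of the characteristic polynomial is exhibited together
  with an eigenvector, so \<open>lam \<le> e\<close>; and B - e I is positive semidefinite, having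
  nonnegative diagonal and determinant 0.\<close>

lemma quadratic_form_ge:
  fixes B :: "real mat"
  assumes B: "B \<in> carrier_mat 2 2" and ev: "\<And>e. eigenvalue B e \<Longrightarrow> lam \<le> e"
    and ent: "B $$ (0,0) = a" "B $$ (0,1) = b" "B $$ (1,0) = b" "B $$ (1,1) = c"
  shows "lam * (x\<^sup>2 + y\<^sup>2) \<le> a * x\<^sup>2 + 2 * b * x * y + c * y\<^sup>2"
proof -
  define r where "r = sqrt ((a - c)\<^sup>2 + 4 * b\<^sup>2)"
  define e where "e = ((a + c) - r) / 2"
  have r2: "r\<^sup>2 = (a - c)\<^sup>2 + 4 * b\<^sup>2" unfolding r_def by simp
  have "\<bar>a - c\<bar> \<le> r" unfolding r_def by (rule real_le_rsqrt) simp
  then have p: "0 \<le> a - e" and q: "0 \<le> c - e" by (auto simp: e_def)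
  have pq: "(a - e) * (c - e) = b\<^sup>2"
  proof -
    have "(a - e) * (c - e) = (r\<^sup>2 - (a - c)\<^sup>2) / 4"
      by (simp add: e_def power2_eq_square field_simps)
    then show ?thesis by (simp add: r2)
  qed
  \<comment> \<open>The vector (b, e - a) solves the first row of (B - e I) v = 0. It vanishes
    exactly when b = 0 and e = a, and then the first unit vector is an eigenvector.\<close>
  define v where "v = (if b = 0 \<and> e = a then vec 2 (\<lambda>i. if i = 0 then 1 else 0)
                       else vec 2 (\<lambda>i. if i = 0 then b else e - a))"
  have "eigenvector B v e"
    unfolding eigenvector_def
  proof (intro conjI)
    show "v \<in> carrier_vec (dim_row B)" using B by (auto simp: v_def)
    have "v $ 0 \<noteq> 0 \<or> v $ 1 \<noteq> 0" by (auto simp: v_def)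
    then show "v \<noteq> 0\<^sub>v (dim_row B)" using B by auto
    show "B *\<^sub>v v = e \<cdot>\<^sub>v v"
    proof (rule eq_vecI)
      fix i assume "i < dim_vec (e \<cdot>\<^sub>v v)"
      then have i: "i = 0 \<or> i = 1" by (auto simp: v_def split: if_splits)
      have "b * b = (a - e) * (c - e)" using pq by (simp add: power2_eq_square)
      then have bb: "b * b + c * (e - a) = e * (e - a)" by (simp add: algebra_simps)
      show "(B *\<^sub>v v) $ i = (e \<cdot>\<^sub>v v) $ i"
        using i B ent bb
        by (auto simp: v_def scalar_prod_def numeral_2_eq_2 algebra_simps)
    qed (use B in \<open>auto simp: v_def\<close>)
  qed
  then have "lam \<le> e" using ev unfolding eigenvalue_def by auto
  then have "lam * (x\<^sup>2 + y\<^sup>2) \<le> e * (x\<^sup>2 + y\<^sup>2)" by (intro mult_right_mono) auto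
  also have "\<dots> \<le> a * x\<^sup>2 + 2 * b * x * y + c * y\<^sup>2"
  proof (cases "a - e = 0")
    case True
    with pq have b: "b = 0" by simp
    then show ?thesis using q True mult_nonneg_nonneg[of "c - e" "y\<^sup>2"] by (simp add: algebra_simps)
  next
    case False
    then have p0: "0 < a - e" using p by simp
    \<comment> \<open>Multiplication by the positive number a - e turns the form into a perfect
      square.\<close>
    have "(a - e) * ((a - e) * x\<^sup>2 + 2 * b * x * y + (c - e) * y\<^sup>2)
        = ((a - e) * x)\<^sup>2 + 2 * ((a - e) * x) * (b * y) + ((a - e) * (c - e)) * y\<^sup>2"
      by (simp add: power2_eq_square algebra_simps)
    also have "\<dots> = ((a - e) * x + b * y)\<^sup>2"
      unfolding pq by (simp add: power2_sum power_mult_distrib)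
    finally have "0 \<le> (a - e) * ((a - e) * x\<^sup>2 + 2 * b * x * y + (c - e) * y\<^sup>2)" by simp
    then have "0 \<le> (a - e) * x\<^sup>2 + 2 * b * x * y + (c - e) * y\<^sup>2"
      using p0 by (simp add: zero_le_mult_iff)
    then show ?thesis by (simp add: algebra_simps)
  qed
  finally show ?thesis .
qed

text \<open>U(0) is the first unit vector, so only the first row (w0, w1) of the inverse enters.
  That this row times B is the first unit row says precisely that the weights reproduce constants
  and, for order 1, linear functions.\<close>

lemma lpe_weight_form:
  fixes K :: "real \<Rightarrow> real" and n :: nat and h x lam :: real
  assumes k: "k \<le> 1" and lam: "0 < lam"
    and ev: "\<And>e. eigenvalue (Bmat k K n h x) e \<Longrightarrow> lam \<le> e"
  defines "W \<equiv> lpe_weight k K n h x" and "u \<equiv> \<lambda>i. (real i / real n - x) / h"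
  obtains w0 w1 where "\<bar>w0\<bar> \<le> 1 / lam" "\<bar>w1\<bar> \<le> 1 / lam"
    "\<forall>i. W i = (w0 + w1 * u i) * K (u i) / (real n * h)"
    "(\<Sum>i=1..n. W i) = 1" "k = 1 \<longrightarrow> (\<Sum>i=1..n. W i * u i) = 0"
proof -
  define s where "s = (\<lambda>p. 1 / (real n * h) * (\<Sum>i=1..n. u i ^ p * K (u i)))"
  let ?B = "Bmat k K n h x"
  have B: "?B \<in> carrier_mat (k + 1) (k + 1)" by (simp add: Bmat_def)
  obtain C where C: "mat_inverse ?B = Some C" "C * ?B = 1\<^sub>m (k + 1)" "C \<in> carrier_mat (k + 1) (k + 1)"
    using mat_inverse_Some_of_eigenvalues_pos[OF B lam ev] by blast
  have W: "W i = 1 / (real n * h) * scalar_prod (Uvec k 0) (C *\<^sub>v Uvec k (u i)) * K (u i)" for i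
    by (simp add: W_def lpe_weight_def C(1) Let_def u_def)
  show thesis
  proof (cases "k = 0")
    case True
    have ent: "?B $$ (0,0) = s 0"
      by (simp add: Bmat_def s_def u_def Let_def Uvec_def True)
    have "eigenvector ?B (vec 1 (\<lambda>_. 1)) (s 0)"
      unfolding eigenvector_def
      using ent B True by (auto intro!: eq_vecI simp: scalar_prod_def dest!: arg_cong[where f = "\<lambda>v. vec_index v 0"])
    then have s0: "lam \<le> s 0" using ev unfolding eigenvalue_def by auto
    have "(C * ?B) $$ (0,0) = C $$ (0,0) * s 0"
      using B C(3) True ent by (simp add: scalar_prod_def)
    then have c: "C $$ (0,0) * s 0 = 1" using C(2) True by simp
    have W0: "W i = (C $$ (0,0) + 0 * u i) * K (u i) / (real n * h)" for i
      unfolding W using C True by (simp add: scalar_prod_def Uvec_def)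
    show thesis
    proof (rule that[OF _ _ allI[OF W0]])
      have "C $$ (0,0) = 1 / s 0" using c s0 lam by (simp add: field_simps)
      then show "\<bar>C $$ (0,0)\<bar> \<le> 1 / lam" using s0 lam by (simp add: frac_le)
      show "\<bar>0::real\<bar> \<le> 1 / lam" using lam by simp
      have "(\<Sum>i=1..n. W i) = C $$ (0,0) * s 0"
        unfolding W0 s_def by (simp add: sum_distrib_left sum_divide_distrib field_simps)
      then show "(\<Sum>i=1..n. W i) = 1" using c by simp
      show "k = 1 \<longrightarrow> (\<Sum>i=1..n. W i * u i) = 0" using True by simp
    qed
  next
    case False
    with k have k1: "k = 1" by simp
    have B2: "?B \<in> carrier_mat 2 2" using B k1 by (simp add: numeral_2_eq_2)
    have ent: "?B $$ (0,0) = s 0" "?B $$ (0,1) = s 1" "?B $$ (1,0) = s 1" "?B $$ (1,1) = s 2"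
      by (simp_all add: Bmat_def s_def u_def Let_def Uvec_def k1 power2_eq_square)
    let ?a = "C $$ (0,0)" and ?b = "C $$ (0,1)"
    have "(C * ?B) $$ (0,0) = ?a * s 0 + ?b * s 1" "(C * ?B) $$ (0,1) = ?a * s 1 + ?b * s 2"
      using B C(3) k1 ent by (simp_all add: scalar_prod_def numeral_2_eq_2)
    then have c: "?a * s 0 + ?b * s 1 = 1" "?a * s 1 + ?b * s 2 = 0" using C(2) k1 by simp_all
    have W0: "W i = (?a + ?b * u i) * K (u i) / (real n * h)" for i
      unfolding W using C k1 by (simp add: scalar_prod_def Uvec_def numeral_2_eq_2)
    \<comment> \<open>For the first row w of the inverse the form w B w^T equals w0; hence lam |w|^2
      <= w0, which bounds both entries by 1 / lam.\<close>
    have "lam * (?a\<^sup>2 + ?b\<^sup>2) \<le> s 0 * ?a\<^sup>2 + 2 * s 1 * ?a * ?b + s 2 * ?b\<^sup>2"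
      by (rule quadratic_form_ge[OF B2 ev ent])
    also have "\<dots> = ?a * (?a * s 0 + ?b * s 1) + ?b * (?a * s 1 + ?b * s 2)"
      by (simp add: power2_eq_square algebra_simps)
    finally have q: "lam * ?a\<^sup>2 + lam * ?b\<^sup>2 \<le> ?a" unfolding c by (simp add: algebra_simps)
    have nn: "0 \<le> lam * ?a\<^sup>2" "0 \<le> lam * ?b\<^sup>2" using lam by simp_all
    have a0: "0 \<le> ?a" using q nn by linarith
    have "?a * (lam * ?a) \<le> ?a * 1" using q nn(2) by (simp add: power2_eq_square algebra_simps)
    then have a1: "lam * ?a \<le> 1"
      using a0 by (cases "?a = 0") (auto simp: mult_le_cancel_left)
    have "lam * ?b\<^sup>2 \<le> ?a" using q nn by linarith
    then have "lam * (lam * ?b\<^sup>2) \<le> lam * ?a" using lam by (intro mult_left_mono) auto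
    then have "(lam * ?b)\<^sup>2 \<le> lam * ?a" by (simp add: power2_eq_square mult_ac)
    then have "(lam * ?b)\<^sup>2 \<le> 1" using a1 by linarith
    then have b1: "\<bar>lam * ?b\<bar> \<le> 1" by (simp add: abs_square_le_1)
    show thesis
    proof (rule that[OF _ _ allI[OF W0]])
      show "\<bar>?a\<bar> \<le> 1 / lam" using a0 a1 lam by (simp add: field_simps)
      show "\<bar>?b\<bar> \<le> 1 / lam" using b1 lam by (simp add: abs_mult field_simps)
      have "(\<Sum>i=1..n. W i) = ?a * s 0 + ?b * s 1"
        unfolding W0 s_def
        by (simp add: sum_distrib_left sum.distrib[symmetric] add_divide_distrib ring_distribs mult_ac)
      then show "(\<Sum>i=1..n. W i) = 1" using c by simp
      have "(\<Sum>i=1..n. W i * u i) = ?a * s 1 + ?b * s 2"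
        unfolding W0 s_def
        by (simp add: sum_distrib_left sum.distrib[symmetric] add_divide_distrib ring_distribs mult_ac power2_eq_square)
      then show "k = 1 \<longrightarrow> (\<Sum>i=1..n. W i * u i) = 0" using c by simp
    qed
  qed
qed

lemma card_grid_window_le:
  fixes x h :: real
  assumes "1 \<le> n" "0 \<le> h"
  shows "real (card {i \<in> {1..n}. \<bar>real i / real n - x\<bar> \<le> h}) \<le> 2 * (real n * h) + 1"
proof -
  let ?S = "{i \<in> {1..n}. \<bar>real i / real n - x\<bar> \<le> h}"
  let ?T = "{\<lceil>real n * x - real n * h\<rceil>..\<lfloor>real n * x + real n * h\<rfloor>}"
  have "int ` ?S \<subseteq> ?T"
  proof safe
    fix i assume "i \<in> {1..n}" "\<bar>real i / real n - x\<bar> \<le> h"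
    then have "\<bar>real i - real n * x\<bar> \<le> real n * h"
      using assms mult_left_mono[of "\<bar>real i / real n - x\<bar>" h "real n"]
      by (simp add: abs_mult_pos' right_diff_distrib)
    then show "int i \<in> ?T" by (auto simp: ceiling_le_iff le_floor_iff)
  qed
  then have "card (int ` ?S) \<le> card ?T" by (intro card_mono) auto
  then have "real (card ?S) \<le> real (card ?T)" by (simp add: card_image)
  also have "\<dots> \<le> 2 * (real n * h) + 1"
  proof (cases "\<lceil>real n * x - real n * h\<rceil> \<le> \<lfloor>real n * x + real n * h\<rfloor> + 1")
    case True
    then have "real (card ?T) = of_int (\<lfloor>real n * x + real n * h\<rfloor> + 1 - \<lceil>real n * x - real n * h\<rceil>)"
      by simp
    then show ?thesis by linarith
  qed (use assms in auto)
  finally show ?thesis .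
qed

section \<open>Weights, variance and bias of the estimator at a fixed sample size\<close>

locale lpe_setup =
  fixes K :: "real \<Rightarrow> real" and Kmax lam :: real and k n :: nat and h :: real
  assumes K_nonneg: "\<And>u. 0 \<le> K u" and K_le: "\<And>u. K u \<le> Kmax"
    and K_supp: "\<And>u. 1 < \<bar>u\<bar> \<Longrightarrow> K u = 0"
    and lam_pos: "0 < lam" and k_le: "k \<le> 1"
    and h_pos: "0 < h" and nh: "1 \<le> real n * h"
    and ev: "\<And>x e. x \<in> {0..1} \<Longrightarrow> eigenvalue (Bmat k K n h x) e \<Longrightarrow> lam \<le> e"
begin

lemma n_pos: "1 \<le> n"
  using nh by (cases n) auto

lemma Kmax_nonneg: "0 \<le> Kmax"
  using K_nonneg[of 0] K_le[of 0] by linarith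

lemma weight_outside: "h < \<bar>real i / real n - x\<bar> \<Longrightarrow> lpe_weight k K n h x i = 0"
proof -
  assume "h < \<bar>real i / real n - x\<bar>"
  then have "K ((real i / real n - x) / h) = 0"
    using h_pos by (intro K_supp) (simp add: field_simps)
  then show ?thesis by (simp add: lpe_weight_def Let_def split: option.split)
qed

lemma abs_weight_le:
  assumes "x \<in> {0..1}"
  shows "\<bar>lpe_weight k K n h x i\<bar> \<le> 2 * Kmax / lam / (real n * h)"
proof -
  obtain w0 w1 where w: "\<bar>w0\<bar> \<le> 1 / lam" "\<bar>w1\<bar> \<le> 1 / lam"
    "\<forall>i. lpe_weight k K n h x i
       = (w0 + w1 * ((real i / real n - x) / h)) * K ((real i / real n - x) / h) / (real n * h)"
    "(\<Sum>i=1..n. lpe_weight k K n h x i) = 1"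
    "k = 1 \<longrightarrow> (\<Sum>i=1..n. lpe_weight k K n h x i * ((real i / real n - x) / h)) = 0"
    by (rule lpe_weight_form[OF k_le lam_pos ev[OF assms]])
  define u where "u = (real i / real n - x) / h"
  have "\<bar>(w0 + w1 * u) * K u\<bar> \<le> 2 / lam * Kmax"
  proof (cases "\<bar>u\<bar> \<le> 1")
    case True
    have "\<bar>w1 * u\<bar> \<le> 1 / lam * 1"
      unfolding abs_mult using w(2) True lam_pos by (intro mult_mono) auto
    with w(1) have "\<bar>w0 + w1 * u\<bar> \<le> 2 / lam" by linarith
    then show ?thesis
      unfolding abs_mult using K_nonneg[of u] K_le[of u] lam_pos by (intro mult_mono) auto
  next
    case False
    then show ?thesis using K_supp[of u] Kmax_nonneg lam_pos by simp
  qed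
  then have "\<bar>(w0 + w1 * u) * K u\<bar> / (real n * h) \<le> 2 / lam * Kmax / (real n * h)"
    using nh by (intro divide_right_mono) auto
  then show ?thesis
    using h_pos unfolding w(3)[rule_format] u_def[symmetric] by simp
qed

lemma card_window_le:
  "real (card {i \<in> {1..n}. \<bar>real i / real n - x\<bar> \<le> h}) \<le> 3 * (real n * h)"
  using card_grid_window_le[OF n_pos, of h x] h_pos nh by simp

lemma sum_window_le:
  fixes g :: "nat \<Rightarrow> real"
  assumes "\<And>i. i \<in> {1..n} \<Longrightarrow> h < \<bar>real i / real n - x\<bar> \<Longrightarrow> g i = 0"
    and "\<And>i. i \<in> {1..n} \<Longrightarrow> \<bar>real i / real n - x\<bar> \<le> h \<Longrightarrow> g i \<le> c" and "0 \<le> c"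
  shows "(\<Sum>i=1..n. g i) \<le> 3 * (real n * h) * c"
proof -
  let ?S = "{i \<in> {1..n}. \<bar>real i / real n - x\<bar> \<le> h}"
  have "(\<Sum>i=1..n. g i) = (\<Sum>i\<in>?S. g i)"
  proof (rule sum.mono_neutral_right)
    show "\<forall>i\<in>{1..n} - ?S. g i = 0" using assms(1) by (metis (no_types, lifting) DiffD1 DiffD2 mem_Collect_eq not_le)
  qed auto
  also have "\<dots> \<le> real (card ?S) * c"
    using assms(2) by (intro sum_bounded_above) auto
  also have "\<dots> \<le> 3 * (real n * h) * c"
    using card_window_le assms(3) by (intro mult_right_mono)
  finally show ?thesis .
qed

text \<open>At most 3 n h design points lie in the window, each with a squared weight of order 1 /
  (n h)^2.\<close>

lemma sum_weight_sq_le: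
  assumes "x \<in> {0..1}"
  shows "(\<Sum>i=1..n. (lpe_weight k K n h x i)\<^sup>2) \<le> 12 * Kmax\<^sup>2 / lam\<^sup>2 / (real n * h)"
proof -
  have "(\<Sum>i=1..n. (lpe_weight k K n h x i)\<^sup>2) \<le> 3 * (real n * h) * (2 * Kmax / lam / (real n * h))\<^sup>2"
  proof (rule sum_window_le[where x = x])
    have "0 \<le> 2 * Kmax / lam / (real n * h)" using Kmax_nonneg lam_pos nh by simp
    then show "(lpe_weight k K n h x i)\<^sup>2 \<le> (2 * Kmax / lam / (real n * h))\<^sup>2" for i
      using abs_weight_le[OF assms, of i] by (subst abs_le_square_iff[symmetric]) linarith
  qed (use weight_outside in auto)
  also have "\<dots> = 12 * Kmax\<^sup>2 / lam\<^sup>2 / (real n * h)"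
    using nh lam_pos by (simp add: field_simps power2_eq_square)
  finally show ?thesis .
qed

text \<open>By the reproduction property the Taylor polynomial contributes no error and only the
  remainder on the window is left; at order 0 only constants are reproduced, hence the condition on
  \<open>g\<close>. The 6 is the 3 of the window count times the 2 of the weight bound.\<close>

lemma lpe_bias:
  assumes x: "x \<in> {0..1}" and "0 \<le> L" "0 < \<beta>"
    and g: "k = 0 \<Longrightarrow> g = 0"
    and tay: "\<And>y. y \<in> {0..1} \<Longrightarrow> \<bar>f y - f x - g * (y - x)\<bar> \<le> L * \<bar>y - x\<bar> powr \<beta>"
  shows "\<bar>(\<Sum>i=1..n. lpe_weight k K n h x i * f (real i / real n)) - f x\<bar> \<le> 6 * Kmax * L / lam * h powr \<beta>"
proof -
  let ?W = "lpe_weight k K n h x"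
  let ?x = "\<lambda>i. real i / real n"
  obtain w0 w1 where "\<bar>w0\<bar> \<le> 1 / lam" "\<bar>w1\<bar> \<le> 1 / lam"
    "\<forall>i. ?W i = (w0 + w1 * ((?x i - x) / h)) * K ((?x i - x) / h) / (real n * h)"
    and w: "(\<Sum>i=1..n. ?W i) = 1" "k = 1 \<longrightarrow> (\<Sum>i=1..n. ?W i * ((?x i - x) / h)) = 0"
    by (rule lpe_weight_form[OF k_le lam_pos ev[OF x]])
  have lin: "(\<Sum>i=1..n. ?W i * (g * (?x i - x))) = 0"
  proof (cases "k = 0")
    case False
    then have "k = 1" using k_le by simp
    have "(\<Sum>i=1..n. ?W i * (g * (?x i - x))) = g * h * (\<Sum>i=1..n. ?W i * ((?x i - x) / h))"
      unfolding sum_distrib_left using h_pos by (intro sum.cong refl) simp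
    then show ?thesis using w(2) \<open>k = 1\<close> by simp
  qed (simp add: g)
  have "(\<Sum>i=1..n. ?W i * f (?x i)) - f x
      = (\<Sum>i=1..n. ?W i * f (?x i)) - (\<Sum>i=1..n. ?W i) * f x - (\<Sum>i=1..n. ?W i * (g * (?x i - x)))"
    unfolding lin w(1) by simp
  also have "\<dots> = (\<Sum>i=1..n. ?W i * (f (?x i) - f x - g * (?x i - x)))"
    by (simp add: sum_subtractf sum_distrib_right right_diff_distrib)
  finally have "\<bar>(\<Sum>i=1..n. ?W i * f (?x i)) - f x\<bar> \<le> (\<Sum>i=1..n. \<bar>?W i * (f (?x i) - f x - g * (?x i - x))\<bar>)"
    by simp
  also have "\<dots> \<le> 3 * (real n * h) * (2 * Kmax / lam / (real n * h) * (L * h powr \<beta>))"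
  proof (rule sum_window_le[where x = x])
    fix i assume i: "i \<in> {1..n}" "\<bar>?x i - x\<bar> \<le> h"
    have "\<bar>f (?x i) - f x - g * (?x i - x)\<bar> \<le> L * \<bar>?x i - x\<bar> powr \<beta>"
      using i by (intro tay) auto
    also have "\<dots> \<le> L * h powr \<beta>"
      using i assms by (intro mult_left_mono powr_mono2) auto
    finally show "\<bar>?W i * (f (?x i) - f x - g * (?x i - x))\<bar> \<le> 2 * Kmax / lam / (real n * h) * (L * h powr \<beta>)"
      unfolding abs_mult using abs_weight_le[OF x, of i] by (intro mult_mono) (auto intro: order_trans)
  qed (use weight_outside Kmax_nonneg lam_pos h_pos assms in auto)
  also have "\<dots> = 6 * Kmax * L / lam * h powr \<beta>"
    using h_pos n_pos by (simp add: field_simps)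
  finally show ?thesis .
qed

end

section \<open>Hoelder classes for exponents at most 2\<close>

lemma kord_le_1: "0 < \<beta> \<Longrightarrow> \<beta> \<le> 1 \<Longrightarrow> kord \<beta> = 0 \<and> \<lceil>\<beta>\<rceil> = 1"
  unfolding kord_def by (auto simp: ceiling_eq_iff)

lemma kord_gt_1:
  assumes "1 < \<beta>" "\<beta> \<le> 2" shows "kord \<beta> = 1 \<and> \<lceil>\<beta>\<rceil> = 2"
proof -
  have "\<lceil>\<beta>\<rceil> = 2" using assms by (simp add: ceiling_eq_iff)
  then show ?thesis by (simp add: kord_def)
qed

lemma holder_class_le_1:
  assumes "0 < \<beta>" "\<beta> \<le> 1"
  shows "f \<in> holder_class \<beta> L \<longleftrightarrow> (\<forall>x\<in>{0..1}. \<forall>y\<in>{0..1}. \<bar>f x - f y\<bar> \<le> L * \<bar>x - y\<bar> powr \<beta>)"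
  (is "_ \<longleftrightarrow> ?R")
proof
  assume ?R
  then show "f \<in> holder_class \<beta> L"
    using kord_le_1[OF assms] unfolding holder_class_def
    by (intro CollectI exI[of _ "\<lambda>_. f"]) simp
next
  assume "f \<in> holder_class \<beta> L"
  then obtain D :: "nat \<Rightarrow> real \<Rightarrow> real" where "\<forall>x\<in>{0..1}. D 0 x = f x"
    "\<forall>x\<in>{0..1}. \<forall>y\<in>{0..1}. \<bar>D 0 x - D 0 y\<bar> \<le> L * \<bar>x - y\<bar> powr \<beta>"
    using kord_le_1[OF assms] unfolding holder_class_def by auto
  then show ?R by simp
qed

lemma holder_class_gt_1:
  assumes "1 < \<beta>" "\<beta> \<le> 2"
  shows "f \<in> holder_class \<beta> L \<longleftrightarrow> (\<exists>d. (\<forall>x\<in>{0..1}. (f has_real_derivative d x) (at x within {0..1})) \<and>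
     (\<forall>x\<in>{0..1}. \<forall>y\<in>{0..1}. \<bar>d x - d y\<bar> \<le> L * \<bar>x - y\<bar> powr (\<beta> - 1)))"
  (is "_ \<longleftrightarrow> ?R")
proof
  assume ?R
  then obtain d where "\<forall>x\<in>{0..1}. (f has_real_derivative d x) (at x within {0..1})"
     "\<forall>x\<in>{0..1}. \<forall>y\<in>{0..1}. \<bar>d x - d y\<bar> \<le> L * \<bar>x - y\<bar> powr (\<beta> - 1)" by blast
  then show "f \<in> holder_class \<beta> L"
    using kord_gt_1[OF assms] unfolding holder_class_def
    by (intro CollectI exI[of _ "\<lambda>j. if j = 0 then f else d"]) simp
next
  assume "f \<in> holder_class \<beta> L"
  then obtain D :: "nat \<Rightarrow> real \<Rightarrow> real" where D: "\<forall>x\<in>{0..1}. D 0 x = f x"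
    "\<forall>x\<in>{0..1}. (D 0 has_real_derivative D 1 x) (at x within {0..1})"
    "\<forall>x\<in>{0..1}. \<forall>y\<in>{0..1}. \<bar>D 1 x - D 1 y\<bar> \<le> L * \<bar>x - y\<bar> powr (\<beta> - 1)"
    using kord_gt_1[OF assms] unfolding holder_class_def by auto
  \<comment> \<open>\<open>D 0\<close> agrees with \<open>f\<close> on the unit interval only, so
    the derivative is transferred within that interval.\<close>
  have "(f has_real_derivative D 1 x) (at x within {0..1})" if "x \<in> {0..1}" for x
    using D(2) that has_field_derivative_transform_within[of "D 0" "D 1 x" x "{0..1}" 1 f] D(1) by auto
  then show ?R using D(3) by blast
qed

lemma mvt_within_unit:
  fixes f d :: "real \<Rightarrow> real"
  assumes "\<forall>x\<in>{0..1}. (f has_real_derivative d x) (at x within {0..1})"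
    and "0 \<le> a" "a < b" "b \<le> 1"
  obtains z where "a < z" "z < b" "f b - f a = d z * (b - a)"
proof -
  have "(f has_derivative (\<lambda>h. d x * h)) (at x within {a..b})" if "a \<le> x" "x \<le> b" for x
  proof -
    have "(f has_real_derivative d x) (at x within {a..b})"
      using assms that by (intro DERIV_subset[where s = "{0..1}" and t = "{a..b}"]) auto
    then show ?thesis by (simp add: has_field_derivative_def)
  qed
  with mvt_simple[OF \<open>a < b\<close>, of f "\<lambda>x h. d x * h"] obtain z where
    "z \<in> {a<..<b}" "f b - f a = d z * (b - a)" by auto
  then show thesis using that by auto
qed

text \<open>For beta > 1 the slope \<open>g\<close> is f'(x): the mean value theorem turns the
  increment into f'(z) (y - x) with z between x and y, and the Hoelder bound is applied to f'(z) -
  f'(x).\<close>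

lemma holder_class_taylor:
  assumes beta: "0 < \<beta>" "\<beta> \<le> 2" and "0 \<le> L" and f: "f \<in> holder_class \<beta> L" and x: "x \<in> {0..1}"
  obtains g where "kord \<beta> = 0 \<Longrightarrow> g = 0"
    "\<And>y. y \<in> {0..1} \<Longrightarrow> \<bar>f y - f x - g * (y - x)\<bar> \<le> L * \<bar>y - x\<bar> powr \<beta>"
proof (cases "\<beta> \<le> 1")
  case True
  show thesis
    using that[of 0] f x unfolding holder_class_le_1[OF beta(1) True] by auto
next
  case False
  then obtain d where d: "\<forall>x\<in>{0..1}. (f has_real_derivative d x) (at x within {0..1})"
     "\<forall>x\<in>{0..1}. \<forall>y\<in>{0..1}. \<bar>d x - d y\<bar> \<le> L * \<bar>x - y\<bar> powr (\<beta> - 1)"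
    using f holder_class_gt_1[of \<beta> f L] beta by auto
  show thesis
  proof (rule that[of "d x"])
    show "d x = 0" if "kord \<beta> = 0" using kord_gt_1[of \<beta>] False beta that by simp
    fix y :: real assume y: "y \<in> {0..1}"
    show "\<bar>f y - f x - d x * (y - x)\<bar> \<le> L * \<bar>y - x\<bar> powr \<beta>"
    proof (cases "y = x")
      case False
      obtain z where z: "z \<in> {0..1}" "\<bar>z - x\<bar> \<le> \<bar>y - x\<bar>" "f y - f x = d z * (y - x)"
      proof (cases "x < y")
        case True
        then obtain z where "x < z" "z < y" "f y - f x = d z * (y - x)"
          using mvt_within_unit[OF d(1), of x y] x y by auto
        then show ?thesis using that[of z] x y by auto
      next
        case F: False
        then obtain z where "y < z" "z < x" "f x - f y = d z * (x - y)"
          using mvt_within_unit[OF d(1), of y x] x y False by auto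
        then show ?thesis using that[of z] x y by (auto simp: algebra_simps)
      qed
      have "\<bar>f y - f x - d x * (y - x)\<bar> = \<bar>d z - d x\<bar> * \<bar>y - x\<bar>"
        unfolding z(3) by (simp add: abs_mult[symmetric] left_diff_distrib)
      also have "\<dots> \<le> L * \<bar>z - x\<bar> powr (\<beta> - 1) * \<bar>y - x\<bar>"
        using d(2) z x by (intro mult_right_mono) auto
      also have "\<dots> \<le> L * \<bar>y - x\<bar> powr (\<beta> - 1) * \<bar>y - x\<bar>"
        using z \<open>\<not> \<beta> \<le> 1\<close> \<open>0 \<le> L\<close> by (intro mult_right_mono mult_left_mono powr_mono2) auto
      also have "\<dots> = L * \<bar>y - x\<bar> powr \<beta>"
        using False by (simp add: powr_diff)
      finally show ?thesis .
    qed simp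
  qed
qed

section \<open>Lower bound\<close>

text \<open>The squared truncated parabola has a Lipschitz derivative, which is all the smoothness
  that beta <= 2 asks for, and being piecewise polynomial it allows elementary estimates.\<close>

definition bump :: "real \<Rightarrow> real" where
  "bump u = (max 0 (1 - u\<^sup>2))\<^sup>2"

definition bump_deriv :: "real \<Rightarrow> real" where
  "bump_deriv u = - 4 * u * max 0 (1 - u\<^sup>2)"

text \<open>For every sign pattern of s and t the first-order Taylor remainder is at most (s - t)^2,
  so the error of the difference quotient is at most |h|.\<close>

lemma has_real_derivative_max_0_square:
  "((\<lambda>t::real. (max 0 t)\<^sup>2) has_real_derivative 2 * max 0 t) (at t)"
proof -
  have bound: "\<bar>(max 0 s)\<^sup>2 - (max 0 t)\<^sup>2 - 2 * max 0 t * (s - t)\<bar> \<le> (s - t)\<^sup>2" for s t :: real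
  proof (cases "0 \<le> s"; cases "0 \<le> t")
    assume "0 \<le> s" "\<not> 0 \<le> t"
    then show ?thesis by (auto intro!: power_mono)
  next
    assume *: "\<not> 0 \<le> s" "0 \<le> t"
    then have "s * t \<le> 0" by (simp add: mult_nonpos_nonneg)
    then have "0 \<le> t\<^sup>2 - 2 * t * s" "t\<^sup>2 - 2 * t * s \<le> (s - t)\<^sup>2"
      by (simp_all add: power2_diff mult.commute order_trans[of _ 0])
    moreover have "(max 0 s)\<^sup>2 - (max 0 t)\<^sup>2 - 2 * max 0 t * (s - t) = t\<^sup>2 - 2 * t * s"
      using * by (simp add: power2_eq_square algebra_simps)
    ultimately show ?thesis by simp
  next
    assume "0 \<le> s" "0 \<le> t"
    then have "(max 0 s)\<^sup>2 - (max 0 t)\<^sup>2 - 2 * max 0 t * (s - t) = (s - t)\<^sup>2"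
      by (simp add: power2_eq_square algebra_simps)
    then show ?thesis by simp
  qed simp
  have "(\<lambda>h. ((max 0 (t + h))\<^sup>2 - (max 0 t)\<^sup>2) / h - 2 * max 0 t) \<midarrow>0\<rightarrow> 0"
  proof (rule Lim_null_comparison)
    have "\<bar>((max 0 (t + h))\<^sup>2 - (max 0 t)\<^sup>2) / h - 2 * max 0 t\<bar> \<le> \<bar>h\<bar>" if "h \<noteq> 0" for h
    proof -
      have "\<bar>((max 0 (t + h))\<^sup>2 - (max 0 t)\<^sup>2) / h - 2 * max 0 t\<bar>
          = \<bar>(max 0 (t + h))\<^sup>2 - (max 0 t)\<^sup>2 - 2 * max 0 t * ((t + h) - t)\<bar> / \<bar>h\<bar>"
        using that by (simp add: abs_divide[symmetric] diff_divide_distrib)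
      also have "\<dots> \<le> ((t + h) - t)\<^sup>2 / \<bar>h\<bar>"
        by (intro divide_right_mono bound) auto
      also have "\<dots> = \<bar>h\<bar>" using that by (simp add: power2_eq_square abs_if)
      finally show ?thesis .
    qed
    then show "\<forall>\<^sub>F h in at 0. norm (((max 0 (t + h))\<^sup>2 - (max 0 t)\<^sup>2) / h - 2 * max 0 t) \<le> \<bar>h\<bar>"
      by (auto simp: eventually_at_filter)
    show "((\<lambda>h::real. \<bar>h\<bar>) \<longlongrightarrow> 0) (at 0)" by (rule tendsto_rabs_zero) (rule tendsto_ident_at)
  qed
  then show ?thesis unfolding DERIV_def by (rule LIM_zero_cancel)
qed

lemma bump_has_derivative: "(bump has_real_derivative bump_deriv u) (at u)"
proof -
  have "((\<lambda>u. 1 - u\<^sup>2) has_real_derivative - (2 * u)) (at u)"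
    by (auto intro!: derivative_eq_intros)
  from DERIV_chain2[OF has_real_derivative_max_0_square this] show ?thesis
    unfolding bump_def[abs_def] bump_deriv_def by (simp add: mult_ac)
qed

text \<open>Truncation makes \<open>bump\<close> and \<open>bump_deriv\<close> polynomials in a
  1-Lipschitz variable with values in [-1,1]; their Lipschitz constants then follow from those of
  the powers.\<close>

definition clamp1 :: "real \<Rightarrow> real" where "clamp1 u = max (- 1) (min 1 u)"

lemma clamp1: "\<bar>clamp1 u\<bar> \<le> 1" "\<bar>clamp1 u - clamp1 v\<bar> \<le> \<bar>u - v\<bar>"
  unfolding clamp1_def by (auto simp: min_def max_def)

lemma bump_clamp:
  "bump u = (1 - (clamp1 u)\<^sup>2)\<^sup>2" "bump_deriv u = - 4 * (clamp1 u - clamp1 u ^ 3)"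
proof -
  consider "u < -1" | "\<bar>u\<bar> \<le> 1" | "1 < u" by linarith
  then have *: "max 0 (1 - u\<^sup>2) = 1 - (clamp1 u)\<^sup>2 \<and> u * max 0 (1 - u\<^sup>2) = clamp1 u - clamp1 u ^ 3"
  proof cases
    case 1
    then have "1 \<le> u\<^sup>2" using one_le_power[of "- u" 2] by simp
    with 1 show ?thesis by (simp add: clamp1_def)
  next
    case 2
    then have "u\<^sup>2 \<le> 1" by (simp add: abs_square_le_1)
    moreover have "clamp1 u = u" using 2 by (auto simp: clamp1_def)
    ultimately show ?thesis by (simp add: right_diff_distrib power2_eq_square power3_eq_cube)
  next
    case 3
    then have "1 \<le> u\<^sup>2" by (intro one_le_power) auto
    with 3 show ?thesis by (simp add: clamp1_def)
  qed
  then show "bump u = (1 - (clamp1 u)\<^sup>2)\<^sup>2" by (simp add: bump_def)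
  show "bump_deriv u = - 4 * (clamp1 u - clamp1 u ^ 3)"
    using *[THEN conjunct2] unfolding bump_deriv_def mult.assoc by (simp only:)
qed

lemma bump_range: "0 \<le> bump u" "bump u \<le> 1"
proof -
  have "(clamp1 u)\<^sup>2 \<le> 1" using clamp1(1) by (simp add: abs_square_le_1)
  then have "(1 - (clamp1 u)\<^sup>2)\<^sup>2 \<le> 1" by (intro power_le_one) auto
  then show "bump u \<le> 1" by (simp add: bump_clamp)
qed (simp add: bump_def)

lemma bump_eq_0: "1 \<le> \<bar>u\<bar> \<Longrightarrow> bump u = 0"
proof -
  assume "1 \<le> \<bar>u\<bar>"
  then have "1 \<le> u\<^sup>2" using one_le_power[of "\<bar>u\<bar>" 2] by simp
  then show ?thesis by (simp add: bump_def)
qed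

lemma power_lipschitz_unit:
  fixes a b :: real
  assumes "\<bar>a\<bar> \<le> 1" "\<bar>b\<bar> \<le> 1"
  shows "\<bar>a ^ p - b ^ p\<bar> \<le> real p * \<bar>a - b\<bar>"
proof -
  have "\<bar>a ^ p - b ^ p\<bar> = \<bar>a - b\<bar> * \<bar>\<Sum>i<p. a ^ i * b ^ (p - Suc i)\<bar>"
    by (subst power_diff_sumr2) (simp add: abs_mult mult.commute)
  also have "\<dots> \<le> \<bar>a - b\<bar> * (\<Sum>i<p. \<bar>a ^ i * b ^ (p - Suc i)\<bar>)"
    by (intro mult_left_mono sum_abs) auto
  also have "\<dots> \<le> \<bar>a - b\<bar> * (\<Sum>i<p. 1)"
    using assms by (intro mult_left_mono sum_mono) (auto simp: abs_mult power_abs intro!: mult_le_one power_le_one)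
  finally show ?thesis by (simp add: mult.commute)
qed

lemma bump_lipschitz: "\<bar>bump u - bump v\<bar> \<le> 16 * \<bar>u - v\<bar>"
proof -
  let ?a = "clamp1 u" and ?b = "clamp1 v"
  have p2: "\<bar>?a ^ 2 - ?b ^ 2\<bar> \<le> 2 * \<bar>?a - ?b\<bar>" and p4: "\<bar>?a ^ 4 - ?b ^ 4\<bar> \<le> 4 * \<bar>?a - ?b\<bar>"
    using power_lipschitz_unit[of ?a ?b 2] power_lipschitz_unit[of ?a ?b 4] clamp1(1) by auto
  have "bump u - bump v = - 2 * (?a ^ 2 - ?b ^ 2) + (?a ^ 4 - ?b ^ 4)"
    unfolding bump_clamp by (simp add: eval_nat_numeral algebra_simps)
  moreover have "\<bar>- 2 * s + t\<bar> \<le> 16 * \<bar>d\<bar>" if "\<bar>s\<bar> \<le> 2 * \<bar>d\<bar>" "\<bar>t\<bar> \<le> 4 * \<bar>d\<bar>" for s t d :: real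
    using that by (auto simp: abs_if split: if_splits)
  ultimately have "\<bar>bump u - bump v\<bar> \<le> 16 * \<bar>?a - ?b\<bar>" using p2 p4 by (simp only:)
  also have "\<dots> \<le> 16 * \<bar>u - v\<bar>" by (intro mult_left_mono clamp1) auto
  finally show ?thesis .
qed

lemma bump_deriv_lipschitz: "\<bar>bump_deriv u - bump_deriv v\<bar> \<le> 16 * \<bar>u - v\<bar>"
proof -
  let ?a = "clamp1 u" and ?b = "clamp1 v"
  have p3: "\<bar>?a ^ 3 - ?b ^ 3\<bar> \<le> 3 * \<bar>?a - ?b\<bar>"
    using power_lipschitz_unit[of ?a ?b 3] clamp1(1) by auto
  have "bump_deriv u - bump_deriv v = - 4 * (?a - ?b) + 4 * (?a ^ 3 - ?b ^ 3)"
    unfolding bump_clamp by (simp add: algebra_simps)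
  moreover have "\<bar>- 4 * s + 4 * t\<bar> \<le> 16 * \<bar>s\<bar>" if "\<bar>t\<bar> \<le> 3 * \<bar>s\<bar>" for s t :: real
    using that by (auto simp: abs_if split: if_splits)
  ultimately have "\<bar>bump_deriv u - bump_deriv v\<bar> \<le> 16 * \<bar>?a - ?b\<bar>" using p3 by (simp only:)
  also have "\<dots> \<le> 16 * \<bar>u - v\<bar>" by (intro mult_left_mono clamp1) auto
  finally show ?thesis .
qed

lemma bump_deriv_abs_le: "\<bar>bump_deriv u\<bar> \<le> 8"
proof -
  have "\<bar>clamp1 u ^ 3\<bar> \<le> 1" using clamp1(1)[of u] by (simp add: power_abs power_le_one)
  moreover have "\<bar>- 4 * (s - t)\<bar> \<le> 8" if "\<bar>s\<bar> \<le> 1" "\<bar>t\<bar> \<le> 1" for s t :: real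
    using that by (auto simp: abs_if split: if_splits)
  ultimately show ?thesis using clamp1(1)[of u] unfolding bump_clamp by (simp only:)
qed

text \<open>The Lipschitz bound serves for distances up to 1, boundedness beyond.\<close>

lemma lipschitz_imp_holder:
  fixes F :: "real \<Rightarrow> real"
  assumes "\<bar>F u - F v\<bar> \<le> M" "\<bar>F u - F v\<bar> \<le> M * \<bar>u - v\<bar>" "0 < \<gamma>" "\<gamma> \<le> 1"
  shows "\<bar>F u - F v\<bar> \<le> M * \<bar>u - v\<bar> powr \<gamma>"
proof -
  have M: "0 \<le> M" using assms(1) by linarith
  show ?thesis
  proof (cases "\<bar>u - v\<bar> \<le> 1")
    case True
    have "\<bar>u - v\<bar> \<le> \<bar>u - v\<bar> powr \<gamma>"
      using True assms powr_mono'[of \<gamma> 1 "\<bar>u - v\<bar>"] by auto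
    with M have "M * \<bar>u - v\<bar> \<le> M * \<bar>u - v\<bar> powr \<gamma>" by (rule mult_left_mono[rotated])
    then show ?thesis using assms by linarith
  next
    case False
    then have "1 \<le> \<bar>u - v\<bar> powr \<gamma>" using assms by (intro ge_one_powr_ge_zero) auto
    with M have "M * 1 \<le> M * \<bar>u - v\<bar> powr \<gamma>" by (rule mult_left_mono[rotated])
    then show ?thesis using assms by linarith
  qed
qed

text \<open>The factor \<open>r powr \<beta>\<close> compensates the scaling of the argument, so
  that the Hoelder bound 16 c does not depend on r.\<close>

definition scaled_bump :: "real \<Rightarrow> real \<Rightarrow> real \<Rightarrow> real \<Rightarrow> real \<Rightarrow> real" where
  "scaled_bump \<beta> c r z x = c * r powr \<beta> * bump ((x - z) / r)"

lemma scaled_bump_has_derivative: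
  assumes "0 < r"
  shows "(scaled_bump \<beta> c r z has_real_derivative c * r powr (\<beta> - 1) * bump_deriv ((x - z) / r)) (at x within S)"
proof -
  have "((\<lambda>x. (x - z) / r) has_real_derivative 1 / r) (at x)"
    using assms by (auto intro!: derivative_eq_intros)
  from DERIV_cmult[OF DERIV_chain2[OF bump_has_derivative this], of "c * r powr \<beta>"]
  have "(scaled_bump \<beta> c r z has_real_derivative c * r powr \<beta> * (bump_deriv ((x - z) / r) * (1 / r))) (at x)"
    unfolding scaled_bump_def[abs_def] .
  moreover have "c * r powr \<beta> * (bump_deriv ((x - z) / r) * (1 / r)) = c * r powr (\<beta> - 1) * bump_deriv ((x - z) / r)"
    using assms by (simp add: powr_diff)
  ultimately show ?thesis by (simp only: has_field_derivative_at_within)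
qed

lemma scaled_bump_holder:
  assumes beta: "0 < \<beta>" "\<beta> \<le> 2" and "0 < r" "0 \<le> c" "16 * c \<le> L"
  shows "scaled_bump \<beta> c r z \<in> holder_class \<beta> L"
proof -
  \<comment> \<open>Applied to \<open>bump\<close> with exponent beta, or to
    \<open>bump_deriv\<close> with exponent beta - 1.\<close>
  have key: "\<bar>c * r powr \<gamma> * F ((x - z) / r) - c * r powr \<gamma> * F ((y - z) / r)\<bar> \<le> L * \<bar>x - y\<bar> powr \<gamma>"
    if "0 < \<gamma>" "\<gamma> \<le> 1" and F: "\<And>u v. \<bar>F u - F v\<bar> \<le> 16" "\<And>u v. \<bar>F u - F v\<bar> \<le> 16 * \<bar>u - v\<bar>"
    for \<gamma> F x y
  proof -
    have "\<bar>c * r powr \<gamma> * F ((x - z) / r) - c * r powr \<gamma> * F ((y - z) / r)\<bar>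
        = c * r powr \<gamma> * \<bar>F ((x - z) / r) - F ((y - z) / r)\<bar>"
      using assms by (simp add: right_diff_distrib[symmetric] abs_mult)
    also have "\<dots> \<le> c * r powr \<gamma> * (16 * \<bar>(x - z) / r - (y - z) / r\<bar> powr \<gamma>)"
      using assms that by (intro mult_left_mono lipschitz_imp_holder) auto
    also have "\<bar>(x - z) / r - (y - z) / r\<bar> = \<bar>x - y\<bar> / r"
      using assms by (simp add: diff_divide_distrib[symmetric])
    also have "c * r powr \<gamma> * (16 * (\<bar>x - y\<bar> / r) powr \<gamma>) = (16 * c) * \<bar>x - y\<bar> powr \<gamma>"
      using assms by (simp add: powr_divide)
    also have "\<dots> \<le> L * \<bar>x - y\<bar> powr \<gamma>" using assms by (intro mult_right_mono) auto
    finally show ?thesis .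
  qed
  show ?thesis
  proof (cases "\<beta> \<le> 1")
    case True
    have "\<bar>bump u - bump v\<bar> \<le> 16" for u v
      using bump_range[of u] bump_range[of v] by linarith
    then have "\<bar>scaled_bump \<beta> c r z x - scaled_bump \<beta> c r z y\<bar> \<le> L * \<bar>x - y\<bar> powr \<beta>" for x y
      unfolding scaled_bump_def using beta True bump_lipschitz by (intro key)
    then show ?thesis unfolding holder_class_le_1[OF beta(1) True] by blast
  next
    case False
    have "\<bar>bump_deriv u - bump_deriv v\<bar> \<le> 16" for u v
      using bump_deriv_abs_le[of u] bump_deriv_abs_le[of v] by linarith
    then have "\<bar>c * r powr (\<beta> - 1) * bump_deriv ((x - z) / r) - c * r powr (\<beta> - 1) * bump_deriv ((y - z) / r)\<bar>
        \<le> L * \<bar>x - y\<bar> powr (\<beta> - 1)" for x y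
      using False beta bump_deriv_lipschitz by (intro key) simp_all
    moreover have "1 < \<beta>" using False by simp
    ultimately show ?thesis
      unfolding holder_class_gt_1[OF \<open>1 < \<beta>\<close> beta(2)]
      using scaled_bump_has_derivative[OF \<open>0 < r\<close>, of \<beta> c z]
      by (intro exI[of _ "\<lambda>x. c * r powr (\<beta> - 1) * bump_deriv ((x - z) / r)"]) simp
  qed
qed

text \<open>For beta <= 1 the drop runs from the peak z to the end z + r of the support. For beta >
  1 the slope is taken at z + r/2, where \<open>bump_deriv (1 / 2) = - 3 / 2\<close>.\<close>

lemma scaled_bump_alt:
  assumes beta: "0 < \<beta>" "\<beta> \<le> 2" and r: "0 < r" and c: "0 \<le> c" "16 * c \<le> L" and z: "0 \<le> z" "z + r \<le> 1"
  shows "scaled_bump \<beta> c r z \<in> alt_class \<beta> L (c * r powr (\<beta> - real_of_int \<lceil>\<beta>\<rceil> + 1))"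
proof (cases "\<beta> \<le> 1")
  case True
  then have "\<lceil>\<beta>\<rceil> = 1" using kord_le_1 beta by auto
  moreover have "scaled_bump \<beta> c r z z - scaled_bump \<beta> c r z (z + r) = c * r powr \<beta>"
    using r by (simp add: scaled_bump_def bump_def)
  ultimately show ?thesis
    using scaled_bump_holder[OF beta r c] True r z
    unfolding alt_class_def if_P[OF True] by (intro CollectI conjI exI[of _ z] exI[of _ "z + r"]) simp_all
next
  case False
  then have "\<lceil>\<beta>\<rceil> = 2" using kord_gt_1 beta by auto
  have "(scaled_bump \<beta> c r z has_real_derivative c * r powr (\<beta> - 1) * (- 3 / 2)) (at (z + r / 2) within {0..1})"
    using scaled_bump_has_derivative[OF r, of \<beta> c z "z + r / 2" "{0..1}"] r
    by (simp add: bump_deriv_def power2_eq_square)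
  moreover have "c * r powr (\<beta> - 1) * (- 3 / 2) \<le> - (c * r powr (\<beta> - 1))"
    using c by simp
  moreover have "z + r / 2 \<in> {0..1}" using z r by auto
  ultimately show ?thesis
    using scaled_bump_holder[OF beta r c] False \<open>\<lceil>\<beta>\<rceil> = 2\<close>
    unfolding alt_class_def if_not_P[OF False]
    by (intro CollectI conjI bexI[of _ "z + r / 2"] exI[of _ "c * r powr (\<beta> - 1) * (- 3 / 2)"])
       simp_all
qed

section \<open>Chi-square bound for a mixture of alternatives\<close>

lemma rej_prob_eq_integral:
  assumes "0 < \<sigma>" and Psi: "\<Psi> \<in> measurable (PiM {1..n} (\<lambda>_. borel)) (count_space UNIV)"
  defines "P \<equiv> data_law \<sigma> (\<lambda>_. 0) n" and "A \<equiv> {Y \<in> space (PiM {1..n} (\<lambda>_. borel)). \<Psi> Y}"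
  shows "A \<in> sets P" "rej_prob \<sigma> \<Psi> n f = (\<integral>Y. indicator A Y * lik_ratio \<sigma> f n Y \<partial>P)"
    "integrable P (\<lambda>Y. indicator A Y * lik_ratio \<sigma> f n Y)"
proof -
  have A: "A \<in> sets (PiM {1..n} (\<lambda>_. borel))"
  proof -
    have "A = \<Psi> -` {True} \<inter> space (PiM {1..n} (\<lambda>_. borel))" by (auto simp: A_def)
    then show ?thesis using measurable_sets[OF Psi, of "{True}"] by simp
  qed
  then show AP: "A \<in> sets P" by (simp add: P_def sets_data_law)
  have "rej_prob \<sigma> \<Psi> n f = measure (data_law \<sigma> f n) A"
    by (simp add: rej_prob_def A_def space_data_law)
  also have "\<dots> = (\<integral>Y. indicator A Y \<partial>data_law \<sigma> f n)"
  proof -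
    have "A \<inter> space (data_law \<sigma> f n) = A" by (auto simp: space_data_law A_def)
    then show ?thesis by (simp only: Bochner_Integration.integral_indicator)
  qed
  also have "\<dots> = (\<integral>Y. indicator A Y \<partial>density P (\<lambda>Y. ennreal (lik_ratio \<sigma> f n Y)))"
    unfolding P_def by (subst data_law_eq_density[OF assms(1)]) (rule refl)
  also have "\<dots> = (\<integral>Y. lik_ratio \<sigma> f n Y *\<^sub>R indicator A Y \<partial>P)"
  proof (rule integral_density)
    show "indicator A \<in> borel_measurable P" using AP by simp
    show "lik_ratio \<sigma> f n \<in> borel_measurable P"
      unfolding P_def measurable_data_law by (rule borel_measurable_lik_ratio)
    show "AE Y in P. 0 \<le> lik_ratio \<sigma> f n Y" by (simp add: lik_ratio_def)
  qed
  finally show "rej_prob \<sigma> \<Psi> n f = (\<integral>Y. indicator A Y * lik_ratio \<sigma> f n Y \<partial>P)"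
    by (rule trans) (intro Bochner_Integration.integral_cong refl, simp)
  show "integrable P (\<lambda>Y. indicator A Y * lik_ratio \<sigma> f n Y)"
    using integrable_real_mult_indicator[OF AP lik_ratio_integral(1)[OF assms(1), of n f, folded P_def]]
    by (rule back_subst[where P = "integrable P"]) (simp add: fun_eq_iff)
qed

text \<open>Serves as Cauchy-Schwarz: integrated with \<open>r = sqrt V\<close> it bounds the mean
  of |x| by sqrt V once the mean of x^2 is at most V.\<close>

lemma abs_le_half_sum_squares:
  fixes r x :: real
  assumes "0 < r"
  shows "\<bar>x\<bar> \<le> r / 2 + x\<^sup>2 / (2 * r)"
proof -
  have "2 * r * \<bar>x\<bar> \<le> r\<^sup>2 + x\<^sup>2" using sum_squares_bound[of r "\<bar>x\<bar>"] by simp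
  then show ?thesis using assms by (simp add: field_simps power2_eq_square)
qed

text \<open>The likelihood ratios of distinct alternatives are uncorrelated, so the chi-square distance
  of their uniform mixture from the null law is at most \<open>exp B / m\<close>.\<close>
lemma mixture_rej_prob_le:
  assumes sigma: "0 < \<sigma>" and m: "1 \<le> (m::nat)"
    and Psi: "\<Psi> \<in> measurable (PiM {1..n} (\<lambda>_. borel)) (count_space UNIV)"
    and disj: "\<And>j k i. j < m \<Longrightarrow> k < m \<Longrightarrow> j \<noteq> k \<Longrightarrow> i \<in> {1..n} \<Longrightarrow> fs j (real i / real n) * fs k (real i / real n) = 0"
    and B: "\<And>j. j < m \<Longrightarrow> (\<Sum>i=1..n. (fs j (real i / real n))\<^sup>2) \<le> \<sigma>\<^sup>2 * B"
  shows "\<exists>j<m. rej_prob \<sigma> \<Psi> n (fs j) \<le> rej_prob \<sigma> \<Psi> n (\<lambda>_. 0) + sqrt (exp B / m)"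
proof -
  define P where "P = data_law \<sigma> (\<lambda>_. 0) n"
  interpret prob_space P unfolding P_def by (rule prob_space_data_law[OF sigma])
  define A where "A = {Y \<in> space (PiM {1..n} (\<lambda>_. borel)). \<Psi> Y}"
  note rej = rej_prob_eq_integral[OF sigma Psi, folded P_def A_def]
  let ?l = "\<lambda>j. lik_ratio \<sigma> (fs j) n"
  \<comment> \<open>The likelihood ratio of the uniform mixture of the m alternatives.\<close>
  define b where "b = (\<lambda>Y. (\<Sum>j<m. ?l j Y) / m)"
  define V where "V = exp B / m"
  have V: "0 < V" using m by (simp add: V_def)
  have int_l: "integrable P (?l j)" "(\<integral>Y. ?l j Y \<partial>P) = 1" for j
    using lik_ratio_integral[OF sigma, of n "fs j"] unfolding P_def by this+
  have int_b: "integrable P b"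
    unfolding b_def by (rule integrable_divide, rule Bochner_Integration.integrable_sum, rule int_l)
  have "(\<integral>Y. b Y \<partial>P) = (\<Sum>j<m. \<integral>Y. ?l j Y \<partial>P) / m"
    unfolding b_def integral_divide_zero by (simp only: Bochner_Integration.integral_sum[OF int_l(1)])
  then have Eb: "(\<integral>Y. b Y \<partial>P) = 1" using m by (simp add: int_l(2))
  have b2: "(b Y)\<^sup>2 = (\<Sum>j<m. \<Sum>k<m. ?l j Y * ?l k Y) / (real m)\<^sup>2" for Y
    by (simp only: b_def power_divide power2_eq_square sum_product times_divide_times_eq)
  have int_ll: "integrable P (\<lambda>Y. ?l j Y * ?l k Y)" for j k
    unfolding P_def by (rule lik_ratio_mult_integral[OF sigma])
  have int_b2: "integrable P (\<lambda>Y. (b Y)\<^sup>2)"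
    unfolding b2
    by (rule integrable_divide, rule Bochner_Integration.integrable_sum, rule Bochner_Integration.integrable_sum, rule int_ll)
  \<comment> \<open>Off the diagonal the moment is exactly 1. On the diagonal exp B is enlarged to 1
    + exp B, so that the ones add up to m^2.\<close>
  have cov: "(\<integral>Y. ?l j Y * ?l k Y \<partial>P) \<le> 1 + (if j = k then exp B else 0)" if "j < m" "k < m" for j k
  proof (cases "j = k")
    case True
    have "(\<Sum>i=1..n. fs j (real i / real n) * fs j (real i / real n) / \<sigma>\<^sup>2)
        = (\<Sum>i=1..n. (fs j (real i / real n))\<^sup>2) / \<sigma>\<^sup>2"
      by (simp add: sum_divide_distrib power2_eq_square)
    also have "\<dots> \<le> B" using B[OF that(1)] sigma by (simp add: divide_le_eq mult.commute)
    finally have "(\<integral>Y. ?l j Y * ?l j Y \<partial>P) \<le> exp B"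
      unfolding P_def lik_ratio_mult_integral(2)[OF sigma] by simp
    then show ?thesis using True by simp
  next
    case False
    then have "(\<Sum>i=1..n. fs j (real i / real n) * fs k (real i / real n) / \<sigma>\<^sup>2) = 0"
      using disj[OF that] by (intro sum.neutral) auto
    then show ?thesis
      unfolding P_def lik_ratio_mult_integral(2)[OF sigma] using False by simp
  qed
  have "(\<integral>Y. (b Y)\<^sup>2 \<partial>P) = (\<Sum>j<m. \<Sum>k<m. \<integral>Y. ?l j Y * ?l k Y \<partial>P) / (real m)\<^sup>2"
    unfolding b2 integral_divide_zero
    by (subst Bochner_Integration.integral_sum, intro Bochner_Integration.integrable_sum int_ll)
       (simp only: Bochner_Integration.integral_sum[OF int_ll])
  also have "\<dots> \<le> (\<Sum>j<m. \<Sum>k<m. 1 + (if j = k then exp B else 0)) / (real m)\<^sup>2"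
    by (intro divide_right_mono sum_mono cov) auto
  also have "\<dots> = 1 + V"
  proof -
    have "(\<Sum>j<m. \<Sum>k<m. 1 + (if j = k then exp B else 0)) = real m * real m + real m * exp B"
      by (simp add: sum.distrib ring_distribs)
    then show ?thesis using m by (simp add: V_def power2_eq_square add_divide_distrib)
  qed
  finally have Eb2: "(\<integral>Y. (b Y)\<^sup>2 \<partial>P) \<le> 1 + V" .
  have sq: "(b Y - 1)\<^sup>2 = ((b Y)\<^sup>2 - 2 * b Y) + 1" for Y
    by (simp add: power2_diff)
  have int_diff: "integrable P (\<lambda>Y. (b Y)\<^sup>2 - 2 * b Y)"
    by (rule Bochner_Integration.integrable_diff[OF int_b2 integrable_mult_right[OF int_b]])
  have int_sq: "integrable P (\<lambda>Y. (b Y - 1)\<^sup>2)"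
    unfolding sq by (rule Bochner_Integration.integrable_add[OF int_diff]) simp
  have "(\<integral>Y. (b Y - 1)\<^sup>2 \<partial>P) = (\<integral>Y. (b Y)\<^sup>2 - 2 * b Y \<partial>P) + (\<integral>Y. 1 \<partial>P)"
    unfolding sq by (rule Bochner_Integration.integral_add[OF int_diff]) simp
  also have "(\<integral>Y. (b Y)\<^sup>2 - 2 * b Y \<partial>P) = (\<integral>Y. (b Y)\<^sup>2 \<partial>P) - 2 * (\<integral>Y. b Y \<partial>P)"
    by (simp only: Bochner_Integration.integral_diff[OF int_b2 integrable_mult_right[OF int_b]] integral_mult_right_zero)
  also have "(\<integral>Y. (b Y)\<^sup>2 \<partial>P) - 2 * (\<integral>Y. b Y \<partial>P) + (\<integral>Y. 1 \<partial>P) = (\<integral>Y. (b Y)\<^sup>2 \<partial>P) - 1"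
    by (simp add: Eb prob_space)
  finally have "(\<integral>Y. (b Y - 1)\<^sup>2 \<partial>P) = (\<integral>Y. (b Y)\<^sup>2 \<partial>P) - 1" .
  with Eb2 have Esq: "(\<integral>Y. (b Y - 1)\<^sup>2 \<partial>P) \<le> V" by simp
  have int_Ab: "integrable P (\<lambda>Y. indicator A Y * b Y)"
    by (subst mult.commute) (rule integrable_real_mult_indicator[OF rej(1) int_b])
  have int_A: "integrable P (\<lambda>Y. indicator A Y :: real)"
    using integrable_real_mult_indicator[OF rej(1), of "\<lambda>_. 1"] by simp
  \<comment> \<open>Pointwise form of the fact that the probabilities of A under mixture and null
    differ by at most the mean of |b - 1|.\<close>
  have amgm: "indicator A Y * b Y \<le> indicator A Y + (sqrt V / 2 + (b Y - 1)\<^sup>2 / (2 * sqrt V))" for Y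
  proof -
    have *: "\<bar>b Y - 1\<bar> \<le> sqrt V / 2 + (b Y - 1)\<^sup>2 / (2 * sqrt V)"
      using V by (intro abs_le_half_sum_squares) simp
    have le: "b Y - 1 \<le> sqrt V / 2 + (b Y - 1)\<^sup>2 / (2 * sqrt V)"
      by (rule abs_le_D1[OF *])
    have ge: "0 \<le> sqrt V / 2 + (b Y - 1)\<^sup>2 / (2 * sqrt V)"
      by (rule order_trans[OF abs_ge_zero *])
    show ?thesis
    proof (cases "Y \<in> A")
      case True
      with le show ?thesis by simp
    next
      case False
      with ge show ?thesis by simp
    qed
  qed
  have rej0: "rej_prob \<sigma> \<Psi> n (\<lambda>_. 0) = (\<integral>Y. indicator A Y \<partial>P)"
    using rej(2)[of "\<lambda>_. 0"] by (simp add: lik_ratio_def)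
  have "(\<Sum>j<m. rej_prob \<sigma> \<Psi> n (fs j)) / m = (\<integral>Y. indicator A Y * b Y \<partial>P)"
    unfolding b_def rej(2) times_divide_eq_right sum_distrib_left integral_divide_zero
    by (simp only: Bochner_Integration.integral_sum[OF rej(3)])
  also have "\<dots> \<le> (\<integral>Y. indicator A Y + (sqrt V / 2 + (b Y - 1)\<^sup>2 / (2 * sqrt V)) \<partial>P)"
    by (rule integral_mono[OF int_Ab _ amgm])
       (intro Bochner_Integration.integrable_add int_A integrable_divide int_sq, simp)
  also have "\<dots> = rej_prob \<sigma> \<Psi> n (\<lambda>_. 0) + (sqrt V / 2 + (\<integral>Y. (b Y - 1)\<^sup>2 \<partial>P) / (2 * sqrt V))"
  proof -
    have i: "integrable P (\<lambda>Y. sqrt V / 2 + (b Y - 1)\<^sup>2 / (2 * sqrt V))"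
      by (intro Bochner_Integration.integrable_add integrable_divide int_sq) simp
    have "(\<integral>Y. sqrt V / 2 + (b Y - 1)\<^sup>2 / (2 * sqrt V) \<partial>P)
        = (\<integral>Y. sqrt V / 2 \<partial>P) + (\<integral>Y. (b Y - 1)\<^sup>2 / (2 * sqrt V) \<partial>P)"
      by (rule Bochner_Integration.integral_add) (simp, rule integrable_divide[OF int_sq])
    then show ?thesis
      unfolding rej0 Bochner_Integration.integral_add[OF int_A i] by (simp add: prob_space)
  qed
  also have "\<dots> \<le> rej_prob \<sigma> \<Psi> n (\<lambda>_. 0) + (sqrt V / 2 + V / (2 * sqrt V))"
    using Esq V by (intro add_left_mono divide_right_mono) auto
  also have "\<dots> = rej_prob \<sigma> \<Psi> n (\<lambda>_. 0) + sqrt V"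
  proof -
    have "V / (2 * sqrt V) = V / sqrt V / 2" by simp
    also have "V / sqrt V = sqrt V" using V by (intro real_div_sqrt) simp
    finally have "V / (2 * sqrt V) = sqrt V / 2" .
    then show ?thesis by simp
  qed
  finally have avg: "(\<Sum>j<m. rej_prob \<sigma> \<Psi> n (fs j)) \<le> m * (rej_prob \<sigma> \<Psi> n (\<lambda>_. 0) + sqrt V)"
    using m by (simp add: divide_le_eq mult.commute)
  \<comment> \<open>Some alternative has a rejection probability no larger than the average.\<close>
  show ?thesis
  proof (rule ccontr)
    assume "\<not> ?thesis"
    then have "rej_prob \<sigma> \<Psi> n (\<lambda>_. 0) + sqrt V < rej_prob \<sigma> \<Psi> n (fs j)" if "j < m" for j
      using that unfolding V_def by (meson not_le)
    moreover have "{..<m} \<noteq> {}" using m by (simp add: lessThan_empty_iff)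
    ultimately have "(\<Sum>j<m. rej_prob \<sigma> \<Psi> n (\<lambda>_. 0) + sqrt V) < (\<Sum>j<m. rej_prob \<sigma> \<Psi> n (fs j))"
      by (intro sum_strict_mono) auto
    with avg show False by simp
  qed
qed

section \<open>The family of bumps and the calibration of its scale\<close>

lemma scaled_bump_sum_sq_le:
  assumes n: "1 \<le> n" and r: "0 < r" and nr: "1 \<le> real n * r"
  shows "(\<Sum>i=1..n. (scaled_bump \<beta> c r z (real i / real n))\<^sup>2) \<le> 3 * c\<^sup>2 * (real n * (r powr \<beta>)\<^sup>2 * r)"
proof -
  let ?g = "scaled_bump \<beta> c r z"
  let ?S = "{i \<in> {1..n}. \<bar>real i / real n - z\<bar> \<le> r}"
  have zero: "?g x = 0" if "r \<le> \<bar>x - z\<bar>" for x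
    using that r by (simp add: scaled_bump_def bump_eq_0 field_simps)
  have le: "(?g x)\<^sup>2 \<le> c\<^sup>2 * (r powr \<beta>)\<^sup>2" for x
  proof -
    have "(bump ((x - z) / r))\<^sup>2 \<le> 1" using bump_range[of "(x - z) / r"] by (simp add: power_le_one)
    then have "(c * r powr \<beta>)\<^sup>2 * (bump ((x - z) / r))\<^sup>2 \<le> (c * r powr \<beta>)\<^sup>2 * 1"
      by (intro mult_left_mono) auto
    then show ?thesis by (simp add: scaled_bump_def power_mult_distrib)
  qed
  have "(\<Sum>i=1..n. (?g (real i / real n))\<^sup>2) = (\<Sum>i\<in>?S. (?g (real i / real n))\<^sup>2)"
  proof (rule sum.mono_neutral_right)
    show "\<forall>i\<in>{1..n} - ?S. (?g (real i / real n))\<^sup>2 = 0"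
    proof
      fix i assume "i \<in> {1..n} - ?S"
      then have "\<not> \<bar>real i / real n - z\<bar> \<le> r" by blast
      then have "r \<le> \<bar>real i / real n - z\<bar>" by (simp only: not_le less_imp_le)
      then show "(?g (real i / real n))\<^sup>2 = 0" by (simp add: zero)
    qed
  qed auto
  also have "\<dots> \<le> real (card ?S) * (c\<^sup>2 * (r powr \<beta>)\<^sup>2)"
    using le by (intro sum_bounded_above)
  also have "\<dots> \<le> (3 * (real n * r)) * (c\<^sup>2 * (r powr \<beta>)\<^sup>2)"
    using card_grid_window_le[OF n, of r z] r nr by (intro mult_right_mono) auto
  finally show ?thesis by (simp add: mult_ac)
qed

text \<open>In units of r the centres are distinct odd integers, so open intervals of half-width 1
  around them do not meet.\<close>

lemma scaled_bump_disjoint: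
  assumes r: "0 < r" and "j \<noteq> k"
  shows "scaled_bump \<beta> c r ((2 * real j + 1) * r) x * scaled_bump \<beta> c r ((2 * real k + 1) * r) x = 0"
proof -
  have *: "scaled_bump \<beta> c r ((2 * real i + 1) * r) x = 0" if "\<not> \<bar>x / r - (2 * real i + 1)\<bar> < 1" for i
  proof -
    have "(x - (2 * real i + 1) * r) / r = x / r - (2 * real i + 1)"
      using r by (simp add: diff_divide_distrib)
    then show ?thesis using that by (simp add: scaled_bump_def bump_eq_0)
  qed
  have "\<not> (\<bar>x / r - (2 * real j + 1)\<bar> < 1 \<and> \<bar>x / r - (2 * real k + 1)\<bar> < 1)"
  proof
    assume "\<bar>x / r - (2 * real j + 1)\<bar> < 1 \<and> \<bar>x / r - (2 * real k + 1)\<bar> < 1"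
    then have "real j < real k + 1" "real k < real j + 1" unfolding abs_less_iff by linarith+
    then show False using \<open>j \<noteq> k\<close> by linarith
  qed
  then show ?thesis using * by auto
qed

text \<open>The scale satisfies n r^(2 beta + 1) = log n, so a bump has squared norm at most 3 c^2
  log n on the grid; the bound on c turns this into sigma^2 log n / 12, which is where n^(1/12)
  comes from.\<close>

lemma exists_alt_rej_prob_le:
  fixes n :: nat and \<beta> :: real
  defines "r \<equiv> (ln (real n) / real n) powr (1 / (2 * \<beta> + 1))"
  assumes beta: "0 < \<beta>" "\<beta> \<le> 2" and sigma: "0 < \<sigma>" and c: "0 \<le> c" "16 * c \<le> L" "36 * c\<^sup>2 \<le> \<sigma>\<^sup>2"
    and n: "2 \<le> n" and nr: "1 \<le> real n * r" and r4: "4 * r \<le> 1"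
    and Psi: "\<Psi> \<in> measurable (PiM {1..n} (\<lambda>_. borel)) (count_space UNIV)"
  shows "\<exists>f\<in>alt_class \<beta> L (c * Delta_rate \<beta> n).
    rej_prob \<sigma> \<Psi> n f \<le> rej_prob \<sigma> \<Psi> n (\<lambda>_. 0) + sqrt (4 * r * real n powr (1 / 12))"
proof -
  have ln: "0 < ln (real n)" using n by simp
  have r: "0 < r" unfolding r_def using ln n by simp
  have rpow: "(r powr \<beta>)\<^sup>2 * r = ln (real n) / real n"
  proof -
    have "(r powr \<beta>)\<^sup>2 * r = r powr \<beta> * r powr \<beta> * r powr 1" using r by (simp add: power2_eq_square)
    also have "\<dots> = r powr (2 * \<beta> + 1)" by (simp only: powr_add[symmetric]) simp
    also have "\<dots> = ln (real n) / real n" unfolding r_def powr_powr using beta ln n by simp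
    finally show ?thesis .
  qed
  have rate: "Delta_rate \<beta> n = r powr (\<beta> - real_of_int \<lceil>\<beta>\<rceil> + 1)"
    unfolding Delta_rate_def r_def powr_powr by simp
  \<comment> \<open>The number of bumps of support length 2r that fit side by side into [0,1];
    rounding down leaves at least 1 / (4r) because 4r <= 1.\<close>
  define m where "m = nat \<lfloor>1 / (2 * r)\<rfloor>"
  have m_le: "real m \<le> 1 / (2 * r)" and "1 / (2 * r) < real m + 1"
    using r unfolding m_def by simp_all
  moreover have "1 \<le> 1 / (4 * r)" "1 / (2 * r) = 2 * (1 / (4 * r))" using r r4 by simp_all
  ultimately have m_ge: "1 / (4 * r) \<le> real m" by linarith
  then have m1: "1 \<le> m" using \<open>1 \<le> 1 / (4 * r)\<close> by linarith
  define fs where "fs = (\<lambda>j::nat. scaled_bump \<beta> c r ((2 * real j + 1) * r))"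
  define B where "B = ln (real n) / 12"
  have "\<exists>j<m. rej_prob \<sigma> \<Psi> n (fs j) \<le> rej_prob \<sigma> \<Psi> n (\<lambda>_. 0) + sqrt (exp B / m)"
  proof (rule mixture_rej_prob_le[OF sigma m1 Psi])
    show "fs j (real i / real n) * fs k (real i / real n) = 0" if "j \<noteq> k" for j k i
      unfolding fs_def using that by (rule scaled_bump_disjoint[OF r])
    show "(\<Sum>i=1..n. (fs j (real i / real n))\<^sup>2) \<le> \<sigma>\<^sup>2 * B" for j
    proof -
      have "(\<Sum>i=1..n. (fs j (real i / real n))\<^sup>2) \<le> 3 * c\<^sup>2 * (real n * (r powr \<beta>)\<^sup>2 * r)"
        unfolding fs_def using n r nr by (intro scaled_bump_sum_sq_le) auto
      also have "\<dots> = 3 * c\<^sup>2 * ln (real n)" using n rpow by (simp add: mult.assoc)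
      also have "\<dots> \<le> (\<sigma>\<^sup>2 / 12) * ln (real n)" using c(3) ln by (intro mult_right_mono) auto
      finally show ?thesis by (simp add: B_def)
    qed
  qed
  then obtain j where j: "j < m" "rej_prob \<sigma> \<Psi> n (fs j) \<le> rej_prob \<sigma> \<Psi> n (\<lambda>_. 0) + sqrt (exp B / m)"
    by blast
  have "exp B = real n powr (1 / 12)" using n by (simp add: B_def powr_def)
  moreover have "real n powr (1 / 12) / real m \<le> real n powr (1 / 12) / (1 / (4 * r))"
    using m_ge m1 r by (intro divide_left_mono) auto
  ultimately have "sqrt (exp B / m) \<le> sqrt (4 * r * real n powr (1 / 12))"
    by (simp add: mult_ac)
  with j(2) have "rej_prob \<sigma> \<Psi> n (fs j) \<le> rej_prob \<sigma> \<Psi> n (\<lambda>_. 0) + sqrt (4 * r * real n powr (1 / 12))"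
    by linarith
  moreover have "fs j \<in> alt_class \<beta> L (c * Delta_rate \<beta> n)"
    unfolding rate fs_def
  proof (rule scaled_bump_alt[OF beta r c(1,2)])
    have "real j + 1 \<le> real m" using j by linarith
    then have "(2 * real j + 2) * r \<le> 2 * real m * r" using r by (intro mult_right_mono) auto
    also have "\<dots> \<le> 1" using m_le r by (simp add: field_simps)
    finally show "(2 * real j + 1) * r + r \<le> 1" by (simp add: algebra_simps)
  qed (use r in simp)
  ultimately show ?thesis by blast
qed

lemma zero_in_null_class: "0 \<le> L \<Longrightarrow> (\<lambda>_. 0) \<in> null_class \<beta> L"
  unfolding null_class_def holder_class_def
  by (auto intro!: exI[of _ "\<lambda>_ _. 0"] monotone_onI)

text \<open>The zero function lies in the null class, so its rejection probability is eventually
  below alpha + e/2; the chi-square term contributes at most another e/2.\<close>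

lemma minimax_lower_bound:
  assumes beta: "0 < \<beta>" "\<beta> \<le> 2" and L: "0 < L" and sigma: "0 < \<sigma>"
    and c: "0 \<le> c" "16 * c \<le> L" "36 * c\<^sup>2 \<le> \<sigma>\<^sup>2"
    and Psi: "\<And>n. \<Psi> n \<in> measurable (PiM {1..n} (\<lambda>_. borel)) (count_space UNIV)"
    and level: "limsup (\<lambda>n. SUP f\<in>null_class \<beta> L. ereal (rej_prob \<sigma> (\<Psi> n) n f)) \<le> ereal \<alpha>"
  shows "limsup (\<lambda>n. INF f\<in>alt_class \<beta> L (c * Delta_rate \<beta> n). ereal (rej_prob \<sigma> (\<Psi> n) n f)) \<le> ereal \<alpha>"
proof (rule ereal_le_epsilon2)
  fix e :: real assume e: "0 < e"
  define g where "g = 1 / (2 * \<beta> + 1)"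
  have g: "0 < g" "g < 1" "1 / 5 \<le> g" using beta by (auto simp: g_def field_simps)
  let ?r = "\<lambda>n. (ln (real n) / real n) powr g"
  \<comment> \<open>1/5 is the least exponent 1 / (2 beta + 1) for beta <= 2 and it exceeds 1/12, so
    this bound tends to 0.\<close>
  have "((\<lambda>n. 4 * ((ln (real n) / real n) powr (1 / 5)) * real n powr (1 / 12)) \<longlongrightarrow> 0) sequentially"
    by real_asymp
  then have "eventually (\<lambda>n. 4 * ((ln (real n) / real n) powr (1 / 5)) * real n powr (1 / 12) < (e / 2)\<^sup>2) sequentially"
    by (rule order_tendstoD) (use e in simp)
  moreover have "eventually (\<lambda>n. 4 * (ln (real n) / real n) powr (1 / 5) \<le> 1) sequentially"
    by real_asymp
  moreover have "eventually (\<lambda>n. ln (real n) / real n \<le> 1) sequentially" by real_asymp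
  moreover have "eventually (\<lambda>n. 1 \<le> ln (real n)) sequentially" by real_asymp
  moreover have "eventually (\<lambda>n. (SUP f\<in>null_class \<beta> L. ereal (rej_prob \<sigma> (\<Psi> n) n f)) < ereal (\<alpha> + e / 2)) sequentially"
    using level e by (intro Limsup_lessD) (auto intro: le_less_trans)
  ultimately have "eventually (\<lambda>n. (INF f\<in>alt_class \<beta> L (c * Delta_rate \<beta> n). ereal (rej_prob \<sigma> (\<Psi> n) n f)) \<le> ereal (\<alpha> + e)) sequentially"
    using eventually_ge_at_top[of 2]
  proof eventually_elim
    case (elim n)
    have q: "0 < ln (real n) / real n" "ln (real n) / real n \<le> 1" using elim by auto
    have le5: "?r n \<le> (ln (real n) / real n) powr (1 / 5)"
      using q g by (intro powr_mono') auto
    \<comment> \<open>The base is at most 1 and the exponent g is below 1, so r >= log n / n and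
      hence n r >= log n >= 1.\<close>
    have "(ln (real n) / real n) powr 1 \<le> ?r n"
      using q g by (intro powr_mono') auto
    moreover have "(ln (real n) / real n) powr 1 = ln (real n) / real n"
      using q(1) by (subst powr_one_gt_zero_iff) simp
    ultimately have "ln (real n) / real n \<le> ?r n" by (simp only:)
    then have "real n * (ln (real n) / real n) \<le> real n * ?r n" by (intro mult_left_mono) auto
    then have nr: "1 \<le> real n * ?r n" using elim by simp
    have r4: "4 * ?r n \<le> 1" using le5 elim by linarith
    obtain f where f: "f \<in> alt_class \<beta> L (c * Delta_rate \<beta> n)"
      "rej_prob \<sigma> (\<Psi> n) n f \<le> rej_prob \<sigma> (\<Psi> n) n (\<lambda>_. 0) + sqrt (4 * ?r n * real n powr (1 / 12))"
      using exists_alt_rej_prob_le[OF beta sigma c _ _ _ Psi[of n]] elim nr r4 unfolding g_def by blast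
    have "4 * ?r n * real n powr (1 / 12) \<le> 4 * ((ln (real n) / real n) powr (1 / 5)) * real n powr (1 / 12)"
      using le5 by (intro mult_right_mono mult_left_mono) auto
    also have "\<dots> \<le> (e / 2)\<^sup>2" using elim by simp
    finally have "sqrt (4 * ?r n * real n powr (1 / 12)) \<le> e / 2"
      using e by (intro real_le_lsqrt) auto
    moreover have "ereal (rej_prob \<sigma> (\<Psi> n) n (\<lambda>_. 0)) < ereal (\<alpha> + e / 2)"
      using L by (intro le_less_trans[OF SUP_upper elim(5)] zero_in_null_class) simp
    ultimately have "rej_prob \<sigma> (\<Psi> n) n f \<le> \<alpha> + e" using f(2) by simp
    then show ?case by (intro INF_lower2[OF f(1)]) simp
  qed
  then show "limsup (\<lambda>n. INF f\<in>alt_class \<beta> L (c * Delta_rate \<beta> n). ereal (rej_prob \<sigma> (\<Psi> n) n f)) \<le> ereal \<alpha> + ereal e"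
    by (intro Limsup_bounded) simp
qed

section \<open>Violated pairs\<close>

lemma fomt_right_ge:
  assumes "I < e" "e \<le> n" "S \<subseteq> {I+1..e}" "\<And>l. l \<in> S \<Longrightarrow> \<Phi> I l"
  shows "real (card S) / (2 * real (e - I)) \<le> pmf (fomt_right n \<Phi> I) True"
proof -
  have "card S \<le> card {J \<in> {1..e - I}. \<Phi> I (I + J)}"
  proof (rule card_inj_on_le)
    show "inj_on (\<lambda>l. l - I) S" using assms(3) by (intro inj_onI) (auto dest!: subsetD)
    show "(\<lambda>l. l - I) ` S \<subseteq> {J \<in> {1..e - I}. \<Phi> I (I + J)}" using assms(3,4) by fastforce
  qed simp
  then have "real (card S) / (2 * real (e - I)) \<le> real (card {J \<in> {1..e - I}. \<Phi> I (I + J)}) / (2 * real (e - I))"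
    by (intro divide_right_mono) auto
  also have "\<dots> \<le> pmf (fomt_right n \<Phi> I) True"
    using dyadic_scan_ge[of "e - I" "n - I" "\<lambda>J. \<Phi> I (I + J)"] assms unfolding fomt_right_def by simp
  finally show ?thesis .
qed

lemma fomt_left_ge:
  assumes "1 \<le> s" "s < I" "S \<subseteq> {s..<I}" "\<And>l. l \<in> S \<Longrightarrow> \<Phi> l I"
  shows "real (card S) / (2 * real (I - s)) \<le> pmf (fomt_left \<Phi> I) True"
proof -
  have "card S \<le> card {J \<in> {1..I - s}. \<Phi> (I - J) I}"
  proof (rule card_inj_on_le)
    show "inj_on (\<lambda>l. I - l) S"
    proof (rule inj_onI)
      fix x y assume "x \<in> S" "y \<in> S" "I - x = I - y"
      moreover have "x < I" "y < I" using \<open>x \<in> S\<close> \<open>y \<in> S\<close> assms(3) by auto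
      ultimately show "x = y" by linarith
    qed
    show "(\<lambda>l. I - l) ` S \<subseteq> {J \<in> {1..I - s}. \<Phi> (I - J) I}"
    proof safe
      fix l assume l: "l \<in> S"
      then have "s \<le> l" "l < I" using assms(3) by auto
      then show "I - l \<in> {1..I - s}" "\<Phi> (I - (I - l)) I" using assms(4)[OF l] by auto
    qed
  qed simp
  then have "real (card S) / (2 * real (I - s)) \<le> real (card {J \<in> {1..I - s}. \<Phi> (I - J) I}) / (2 * real (I - s))"
    by (intro divide_right_mono) auto
  also have "\<dots> \<le> pmf (fomt_left \<Phi> I) True"
    using dyadic_scan_ge[of "I - s" "I - 1" "\<lambda>J. \<Phi> (I - J) I"] assms unfolding fomt_left_def by simp
  finally show ?thesis .
qed

text \<open>The 1/8 is 1/4 times 1/2: a quarter of an interval of partners next to \<open>I\<close>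
  is violated, and the dyadic range drawn from may be twice as long as that interval.\<close>

definition good_index :: "nat \<Rightarrow> (nat \<Rightarrow> nat \<Rightarrow> bool) \<Rightarrow> nat \<Rightarrow> bool" where
  "good_index n \<Phi> I \<longleftrightarrow> (I \<le> n - 1 \<and> 1 / 8 \<le> pmf (fomt_right n \<Phi> I) True)
                    \<or> (2 \<le> I \<and> 1 / 8 \<le> pmf (fomt_left \<Phi> I) True)"

lemma good_index_right:
  assumes "I < e" "e \<le> n" "S \<subseteq> {I+1..e}" "\<And>l. l \<in> S \<Longrightarrow> \<Phi> I l" "e - I \<le> 4 * card S"
  shows "good_index n \<Phi> I"
proof -
  have "real (e - I) \<le> 4 * real (card S)" using assms(5) by linarith
  then have "1 / 8 \<le> real (card S) / (2 * real (e - I))" using assms(1) by (simp add: field_simps)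
  also have "\<dots> \<le> pmf (fomt_right n \<Phi> I) True" by (rule fomt_right_ge[of I e n S \<Phi>, OF assms(1-4)])
  finally show ?thesis using assms(1,2) unfolding good_index_def by force
qed

lemma good_index_left:
  assumes "1 \<le> s" "s < I" "S \<subseteq> {s..<I}" "\<And>l. l \<in> S \<Longrightarrow> \<Phi> l I" "I - s \<le> 4 * card S"
  shows "good_index n \<Phi> I"
proof -
  have "real (I - s) \<le> 4 * real (card S)" using assms(5) by linarith
  then have "1 / 8 \<le> real (card S) / (2 * real (I - s))" using assms(2) by (simp add: field_simps)
  also have "\<dots> \<le> pmf (fomt_left \<Phi> I) True" by (rule fomt_left_ge[of s I S \<Phi>, OF assms(1-4)])
  finally show ?thesis using assms(1,2) unfolding good_index_def by force
qed

text \<open>An index between the two blocks whose value is at most \<open>c\<close> is violated by the whole left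
  block, any other one by the whole right block; the majority decides which block to take.\<close>
lemma good_block_majority:
  fixes v :: "nat \<Rightarrow> real"
  assumes q: "q \<le> n" and gap: "p + 3 * m \<le> q" and m: "1 \<le> m"
    and Phi: "\<And>i j. 1 \<le> i \<Longrightarrow> i < j \<Longrightarrow> j \<le> n \<Longrightarrow> \<nu> \<le> v i - v j \<Longrightarrow> \<Phi> i j"
    and hi: "\<And>i. i \<in> {p+1..p+m} \<Longrightarrow> c + \<nu> \<le> v i"
    and lo: "\<And>j. j \<in> {q-m+1..q} \<Longrightarrow> v j \<le> c - \<nu>"
  shows "\<exists>A\<subseteq>{1..n}. card A = m \<and> (\<forall>I\<in>A. good_index n \<Phi> I)"
proof -
  let ?M = "{p+m+1..q-m}"
  let ?lo = "{l \<in> ?M. v l \<le> c}" and ?hi = "{l \<in> ?M. c < v l}"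
  have "?lo \<union> ?hi = ?M" by auto
  moreover have "card (?lo \<union> ?hi) = card ?lo + card ?hi" by (rule card_Un_disjoint) auto
  ultimately have "card ?M = card ?lo + card ?hi" by (simp only:)
  moreover have "card ?M = q - p - 2 * m" by simp
  ultimately have two: "q - p - 2 * m \<le> 2 * card ?lo \<or> q - p - 2 * m \<le> 2 * card ?hi" by linarith
  from two show ?thesis
  proof
    assume half: "q - p - 2 * m \<le> 2 * card ?lo"
    show ?thesis
    proof (intro exI[of _ "{p+1..p+m}"] conjI ballI)
      fix I assume I: "I \<in> {p+1..p+m}"
      \<comment> \<open>The partner interval \<open>{I+1..q-m}\<close> has at most q - p - m - 1
        points. The gap condition makes this at most 2 (q - p - 2m), hence at most four times the
        size of \<open>?lo\<close>.\<close>
      show "good_index n \<Phi> I"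
      proof (rule good_index_right[where e = "q - m" and S = ?lo])
        fix l assume l: "l \<in> ?lo"
        have "\<nu> \<le> v I - v l" using hi[OF I] l by auto
        then show "\<Phi> I l" using I l q by (intro Phi) auto
      qed (use I gap m q half in auto)
    qed (use gap q in auto)
  next
    assume half: "q - p - 2 * m \<le> 2 * card ?hi"
    show ?thesis
    proof (intro exI[of _ "{q-m+1..q}"] conjI ballI)
      fix I assume I: "I \<in> {q-m+1..q}"
      show "good_index n \<Phi> I"
      proof (rule good_index_left[where s = "p+m+1" and S = ?hi])
        fix l assume l: "l \<in> ?hi"
        have "\<nu> \<le> v l - v I" using lo[OF I] l by auto
        then show "\<Phi> l I" using I l q by (intro Phi) auto
      qed (use I gap m q half in auto)
    qed (use gap q in auto)
  qed
qed

text \<open>At the level midway between f(a) and f(b) either end has a margin above nu + 10 L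
  h^beta. Moving by at most 2h changes f by at most 2 L h^beta, so the blocks of about 2 n h points
  next to a and b keep the margin nu.\<close>

lemma good_block_rough:
  assumes beta: "0 < \<beta>" "\<beta> \<le> 1" and L: "0 \<le> L" and h: "0 < h" and nh: "2 \<le> real n * h"
    and f: "\<And>x y. x \<in> {0..1} \<Longrightarrow> y \<in> {0..1} \<Longrightarrow> \<bar>f x - f y\<bar> \<le> L * \<bar>x - y\<bar> powr \<beta>"
    and ab: "0 \<le> a" "a < b" "b \<le> 1"
    and drop: "2 * \<nu> + 20 * L * h powr \<beta> < f a - f b" and nu: "0 \<le> \<nu>"
    and Phi: "\<And>i j. 1 \<le> i \<Longrightarrow> i < j \<Longrightarrow> j \<le> n \<Longrightarrow> \<nu> \<le> f (real i / real n) - f (real j / real n) \<Longrightarrow> \<Phi> i j"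
  shows "\<exists>A\<subseteq>{1..n}. 3 / 2 * (real n * h) \<le> card A \<and> (\<forall>I\<in>A. good_index n \<Phi> I)"
proof -
  have n: "0 < real n" using nh by (cases n) auto
  have sc: "(t * h) powr \<beta> \<le> t * h powr \<beta>" if "1 \<le> t" for t
  proof -
    have "t powr \<beta> \<le> t powr 1" using that beta by (intro powr_mono) auto
    then show ?thesis using that h by (simp add: powr_mult mult_right_mono)
  qed
  \<comment> \<open>By the Hoelder condition b - a <= 20 h would allow a drop of at most 20 L
    h^beta; so the two blocks are well separated.\<close>
  have far: "20 * h < b - a"
  proof (rule ccontr)
    assume "\<not> 20 * h < b - a"
    then have "(b - a) powr \<beta> \<le> (20 * h) powr \<beta>" using ab beta by (intro powr_mono2) auto
    then have "(b - a) powr \<beta> \<le> 20 * h powr \<beta>" using sc[of 20] by linarith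
    then have "L * (b - a) powr \<beta> \<le> L * (20 * h powr \<beta>)" using L by (intro mult_left_mono)
    moreover have "\<bar>f a - f b\<bar> \<le> L * \<bar>a - b\<bar> powr \<beta>" using ab by (intro f) auto
    ultimately show False using drop nu ab by (simp add: abs_minus_commute)
  qed
  have close: "\<bar>f x - f y\<bar> \<le> 2 * L * h powr \<beta>" if "x \<in> {0..1}" "y \<in> {0..1}" "\<bar>x - y\<bar> \<le> 2 * h" for x y
  proof -
    have "\<bar>x - y\<bar> powr \<beta> \<le> (2 * h) powr \<beta>" using that beta by (intro powr_mono2) auto
    also have "\<dots> \<le> 2 * h powr \<beta>" by (rule sc) simp
    finally have "L * \<bar>x - y\<bar> powr \<beta> \<le> L * (2 * h powr \<beta>)" using L by (rule mult_left_mono)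
    then show ?thesis using f[OF that(1,2)] by linarith
  qed
  \<comment> \<open>Rounding down loses less than 1, which is at most half of n h since n h >= 2;
    this leaves at least 3/2 n h indices.\<close>
  define m where "m = nat \<lfloor>2 * (real n * h)\<rfloor>"
  define p where "p = nat \<lfloor>real n * a\<rfloor>"
  define q where "q = nat \<lfloor>real n * b\<rfloor>"
  have m: "real m \<le> 2 * (real n * h)" "2 * (real n * h) < real m + 1"
    using nh unfolding m_def by linarith+
  have p: "real p \<le> real n * a" "real n * a < real p + 1"
    using ab n mult_nonneg_nonneg[of "real n" a] unfolding p_def by linarith+
  have q: "real q \<le> real n * b" "real n * b < real q + 1"
    using ab n mult_nonneg_nonneg[of "real n" b] unfolding q_def by linarith+
  have "real n * b \<le> real n * 1" using ab n by (intro mult_left_mono) auto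
  then have qn: "q \<le> n" using q by linarith
  have "real n * (20 * h) < real n * (b - a)" using far n by (intro mult_strict_left_mono)
  then have "20 * (real n * h) < real n * b - real n * a" by (simp add: algebra_simps)
  then have "real (p + 3 * m) \<le> real q" using m p q nh by simp
  then have gap: "p + 3 * m \<le> q" by linarith
  have m1: "1 \<le> m" using m nh by linarith
  let ?c = "(f a + f b) / 2"
  have hi: "?c + \<nu> \<le> f (real i / real n)" if i: "i \<in> {p+1..p+m}" for i
  proof -
    have "real p + 1 \<le> real i" "real i \<le> real p + real m" using i by auto
    then have "real n * a \<le> real i" "real i \<le> real n * (a + 2 * h)"
      using p m by (auto simp: algebra_simps)
    then have "a \<le> real i / real n" "real i / real n \<le> a + 2 * h"
      using n by (simp_all add: field_simps)
    then have "\<bar>f a - f (real i / real n)\<bar> \<le> 2 * L * h powr \<beta>"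
      using ab far h by (intro close) auto
    then show ?thesis using drop L h by (simp add: abs_le_iff field_simps)
  qed
  have lo: "f (real j / real n) \<le> ?c - \<nu>" if j: "j \<in> {q-m+1..q}" for j
  proof -
    have "real q - real m + 1 \<le> real j" "real j \<le> real q" using j gap by auto
    then have "real n * (b - 2 * h) \<le> real j" "real j \<le> real n * b"
      using q m by (auto simp: algebra_simps)
    then have "b - 2 * h \<le> real j / real n" "real j / real n \<le> b"
      using n by (simp_all add: field_simps)
    then have "\<bar>f b - f (real j / real n)\<bar> \<le> 2 * L * h powr \<beta>"
      using ab far h by (intro close) auto
    then show ?thesis using drop L h by (simp add: abs_le_iff field_simps)
  qed
  have "\<exists>A\<subseteq>{1..n}. card A = m \<and> (\<forall>I\<in>A. good_index n \<Phi> I)"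
    by (rule good_block_majority[OF qn gap m1, where v = "\<lambda>i. f (real i / real n)" and c = ?c and \<nu> = \<nu>])
       (use Phi hi lo in auto)
  moreover have "3 / 2 * (real n * h) \<le> real m" using m nh by linarith
  ultimately show ?thesis by metis
qed

text \<open>Indices of the first quarter of the window are paired with those of its second half.
  Such pairs are more than h apart, and the second half contains more than half of all later
  partners in the window.\<close>

lemma good_block_steep:
  assumes h: "0 < h" and nh: "2 \<le> real n * h"
    and u: "0 \<le> u" "u + 8 * h \<le> 1"
    and f: "\<And>x y. u \<le> x \<Longrightarrow> x + h \<le> y \<Longrightarrow> y \<le> u + 8 * h \<Longrightarrow> \<nu> \<le> f x - f y"
    and Phi: "\<And>i j. 1 \<le> i \<Longrightarrow> i < j \<Longrightarrow> j \<le> n \<Longrightarrow> \<nu> \<le> f (real i / real n) - f (real j / real n) \<Longrightarrow> \<Phi> i j"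
  shows "\<exists>A\<subseteq>{1..n}. 3 / 2 * (real n * h) \<le> card A \<and> (\<forall>I\<in>A. good_index n \<Phi> I)"
proof -
  have n: "0 < real n" using nh by (cases n) auto
  define m where "m = nat \<lfloor>2 * (real n * h)\<rfloor>"
  define p where "p = nat \<lfloor>real n * u\<rfloor>"
  have m: "real m \<le> 2 * (real n * h)" "2 * (real n * h) < real m + 1"
    using nh unfolding m_def by linarith+
  have p: "real p \<le> real n * u" "real n * u < real p + 1"
    using u n mult_nonneg_nonneg[of "real n" u] unfolding p_def by linarith+
  have m1: "1 \<le> m" using m nh by linarith
  have "real n * (u + 8 * h) \<le> real n * 1" using u n by (intro mult_left_mono) auto
  then have "real (p + 4 * m) \<le> real n" using m p by (simp add: algebra_simps)
  then have pn: "p + 4 * m \<le> n" by linarith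
  show ?thesis
  proof (intro exI[of _ "{p+1..p+m}"] conjI ballI)
    fix I assume I: "I \<in> {p+1..p+m}"
    show "good_index n \<Phi> I"
    proof (rule good_index_right[where e = "p + 4 * m" and S = "{p+2*m+1..p+4*m}"])
      fix l assume l: "l \<in> {p+2*m+1..p+4*m}"
      have "real p + 1 \<le> real I" "real I \<le> real p + real m" "real p + 2 * real m + 1 \<le> real l" "real l \<le> real p + 4 * real m"
        using I l by auto
      then have "real n * u \<le> real I" "real I + real n * h \<le> real l" "real l \<le> real n * (u + 8 * h)"
        using p m nh by (auto simp: algebra_simps)
      then have "real n * u / real n \<le> real I / real n"
        "(real I + real n * h) / real n \<le> real l / real n"
        "real l / real n \<le> real n * (u + 8 * h) / real n"
        by (intro divide_right_mono; simp)+
      then have "u \<le> real I / real n" "real I / real n + h \<le> real l / real n" "real l / real n \<le> u + 8 * h"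
        using n by (simp_all add: add_divide_distrib)
      then show "\<Phi> I l" using I l pn by (intro Phi f) auto
    qed (use I m1 pn in auto)
  qed (use pn m nh in auto)
qed

section \<open>Power of the test\<close>

context lpe_setup
begin

text \<open>Subtracting the mean of the estimator isolates the noise; the bias is handled separately
  by \<open>lpe_bias\<close>.\<close>

definition noise_exceeds :: "real \<Rightarrow> (real \<Rightarrow> real) \<Rightarrow> (nat \<Rightarrow> real) \<Rightarrow> bool" where
  "noise_exceeds t f Y \<longleftrightarrow> (\<exists>i\<in>{1..n}.
     t \<le> \<bar>lpe k K n h Y (real i / real n) - (\<Sum>j=1..n. lpe_weight k K n h (real i / real n) j * f (real j / real n))\<bar>)"

lemma noise_exceeds_measurable: "Measurable.pred (PiM {1..n} (\<lambda>_. borel)) (noise_exceeds t f)"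
  unfolding noise_exceeds_def[abs_def] lpe_def by measurable

text \<open>Union over n design points and two signs, with the Chernoff bound and the variance bound
  of \<open>sum_weight_sq_le\<close>.\<close>

lemma noise_exceeds_prob_le:
  assumes sigma: "0 < \<sigma>" and "0 < Kmax" and t: "0 < t"
  shows "measure (data_law \<sigma> f n) {Y \<in> space (data_law \<sigma> f n). noise_exceeds t f Y}
    \<le> 2 * real n * exp (- t\<^sup>2 / (2 * \<sigma>\<^sup>2 * (12 * Kmax\<^sup>2 / lam\<^sup>2 / (real n * h))))"
proof -
  let ?P = "data_law \<sigma> f n"
  interpret prob_space ?P by (rule prob_space_data_law[OF sigma])
  let ?w = "\<lambda>i. lpe_weight k K n h (real i / real n)"
  let ?X = "\<lambda>w Y. \<Sum>j=1..n. w j * (Y j - f (real j / real n))"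
  define v where "v = 12 * Kmax\<^sup>2 / lam\<^sup>2 / (real n * h)"
  have v: "0 < v" using assms nh lam_pos n_pos h_pos by (simp add: v_def)
  define e where "e = exp (- t\<^sup>2 / (2 * \<sigma>\<^sup>2 * v))"
  define U where "U = (\<lambda>i. {Y \<in> space ?P. t \<le> ?X (?w i) Y})"
  define V where "V = (\<lambda>i. {Y \<in> space ?P. t \<le> ?X (\<lambda>j. - ?w i j) Y})"
  have U: "prob (U i) \<le> e" and V: "prob (V i) \<le> e" if "i \<in> {1..n}" for i
  proof -
    have sq: "(\<Sum>j=1..n. (?w i j)\<^sup>2) \<le> v"
      unfolding v_def using that by (intro sum_weight_sq_le) auto
    show "prob (U i) \<le> e" unfolding U_def e_def by (rule gaussian_noise_tail[OF sigma sq v t])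
    show "prob (V i) \<le> e" unfolding V_def e_def using sq
      by (intro gaussian_noise_tail[OF sigma _ v t]) simp
  qed
  have meas: "{Y \<in> space ?P. t \<le> ?X w Y} \<in> events" for w
  proof -
    have "(\<lambda>Y. ?X w Y) \<in> borel_measurable ?P"
      unfolding measurable_data_law by measurable
    then show ?thesis by measurable
  qed
  have mUV: "U i \<in> events" "V i \<in> events" for i
    unfolding U_def V_def by (rule meas)+
  have split: "(\<Sum>j=1..n. ?w i j * Y j) - (\<Sum>j=1..n. ?w i j * f (real j / real n)) = ?X (?w i) Y" for i Y
    by (simp only: sum_subtractf[symmetric] right_diff_distrib)
  have neg: "?X (\<lambda>j. - ?w i j) Y = - ?X (?w i) Y" for i Y
    by (simp add: sum_negf)
  have "{Y \<in> space ?P. noise_exceeds t f Y} \<subseteq> (\<Union>i\<in>{1..n}. U i \<union> V i)"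
  proof
    fix Y assume "Y \<in> {Y \<in> space ?P. noise_exceeds t f Y}"
    then obtain i where i: "i \<in> {1..n}" "t \<le> \<bar>?X (?w i) Y\<bar>" and Y: "Y \<in> space ?P"
      unfolding noise_exceeds_def lpe_def split by blast
    then have "t \<le> ?X (?w i) Y \<or> t \<le> - ?X (?w i) Y" by linarith
    then have "Y \<in> U i \<union> V i" using Y unfolding U_def V_def neg by blast
    with i(1) show "Y \<in> (\<Union>i\<in>{1..n}. U i \<union> V i)" by blast
  qed
  then have "prob {Y \<in> space ?P. noise_exceeds t f Y} \<le> prob (\<Union>i\<in>{1..n}. U i \<union> V i)"
    by (intro finite_measure_mono sets.finite_UN) (auto intro: mUV)
  also have "\<dots> \<le> (\<Sum>i\<in>{1..n}. prob (U i \<union> V i))"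
    by (intro finite_measure_subadditive_finite) (auto intro: mUV)
  also have "\<dots> \<le> (\<Sum>i\<in>{1..n}. 2 * e)"
  proof (rule sum_mono)
    fix i assume "i \<in> {1..n}"
    then show "prob (U i \<union> V i) \<le> 2 * e"
      using measure_Un_le[OF mUV(1)[of i] mUV(2)[of i]] U[of i] V[of i] by linarith
  qed
  also have "\<dots> = 2 * real n * e" by simp
  finally show ?thesis unfolding e_def v_def .
qed

end

section \<open>The setting of the theorem: constants, rates and conditions on the sample
  size\<close>

locale fomt_setting =
  fixes \<beta> L \<sigma> \<alpha> Kmin Kmax \<Delta> LK lam0 :: real and K :: "real \<Rightarrow> real"
  assumes beta: "0 < \<beta>" "\<beta> \<le> 2"
    and L: "0 < L" and sigma: "0 < \<sigma>" and alpha: "0 < \<alpha>" "\<alpha> < 1"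
    and K_nonneg: "\<forall>u. 0 \<le> K u"
    and K_int: "integrable lborel K"
    and K_supp: "\<forall>u. \<bar>u\<bar> > 1 \<longrightarrow> K u = 0"
    and K_consts: "0 < Kmin" "0 < Kmax" "0 < \<Delta>"
    and K_bounds: "\<forall>u. Kmin * indicator {v. \<bar>v\<bar> \<le> \<Delta>} u \<le> K u \<and> K u \<le> Kmax"
    and LK: "0 \<le> LK"
    and lambda0: "0 < lam0"
    and eig: "eventually (\<lambda>n. \<forall>x\<in>{0..1}. \<forall>e.
                 eigenvalue (Bmat (kord \<beta>) K n (hn \<beta> L \<sigma> K Kmax lam0 n) x) e \<longrightarrow> lam0 \<le> e)
               sequentially"
begin

abbreviation "h \<equiv> hn \<beta> L \<sigma> K Kmax lam0"
abbreviation "ch \<equiv> Ch \<beta> L \<sigma> K Kmax lam0"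
abbreviation "W \<equiv> Wc \<beta> Kmax LK lam0"
abbreviation "\<Phi> n \<equiv> local_test \<beta> L \<sigma> K Kmax LK lam0 \<alpha> n"
abbreviation "fpower n \<equiv> fomt_power \<beta> L \<sigma> K Kmax LK lam0 \<alpha> n"

text \<open>Ensures C_h > 0. K is at least \<open>Kmin\<close> on an interval of length 2 Delta, and
  K^2 <= Kmax K supplies the integrability without which the integral in \<open>mu2\<close> would be
  0 by default.\<close>

lemma mu2_pos: "0 < mu2 K"
proof -
  have [measurable]: "K \<in> borel_measurable borel" using K_int by simp
  have sq: "(K u)\<^sup>2 \<le> Kmax * K u" for u
    using K_nonneg K_bounds by (simp add: power2_eq_square mult_right_mono)
  have int_sq: "integrable lborel (\<lambda>u. (K u)\<^sup>2)"
    by (rule Bochner_Integration.integrable_bound[OF integrable_mult_right[OF K_int, of Kmax]])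
       (use sq K_nonneg K_consts in \<open>auto simp: abs_mult\<close>)
  have "Kmin\<^sup>2 * indicator {-\<Delta>..\<Delta>} u \<le> (K u)\<^sup>2" for u
  proof (cases "u \<in> {-\<Delta>..\<Delta>}")
    case True
    then have "Kmin \<le> K u" using K_bounds[rule_format, of u] by (simp add: abs_le_iff)
    then show ?thesis using True K_consts by (simp add: power_mono)
  qed simp
  then have "(\<integral>u. Kmin\<^sup>2 * indicator {-\<Delta>..\<Delta>} u \<partial>lborel) \<le> mu2 K"
    unfolding mu2_def
    using K_consts by (intro integral_mono[OF integrable_mult_right int_sq] integrable_real_indicator) auto
  moreover have "(\<integral>u. Kmin\<^sup>2 * indicator {-\<Delta>..\<Delta>} u \<partial>lborel) = Kmin\<^sup>2 * (2 * \<Delta>)"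
    using K_consts by simp
  moreover have "0 < Kmin\<^sup>2 * (2 * \<Delta>)" using K_consts by simp
  ultimately show ?thesis by linarith
qed

lemma ch_pos: "0 < ch"
proof -
  have "0 < q2 \<beta> \<sigma> K lam0"
    using beta sigma mu2_pos lambda0 by (simp add: q2_def)
  moreover have "0 < q1 \<beta> L Kmax lam0"
    using L K_consts lambda0 by (simp add: q1_def Cstar_def)
  ultimately have "0 < q2 \<beta> \<sigma> K lam0 / (4 * (q1 \<beta> L Kmax lam0)\<^sup>2 * \<beta>)" using beta by simp
  then show ?thesis unfolding Ch_def powr_gt_zero by (rule less_imp_neq[THEN not_sym])
qed

lemma W_nonneg: "0 \<le> W"
  unfolding Wc_def by (simp add: le_max_iff_disj)

lemma h_pos: "2 \<le> n \<Longrightarrow> 0 < h n"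
  using ch_pos by (simp add: hn_def)

text \<open>Balance of variance and squared bias: h^(2 beta + 1) is a multiple of log n / n. Through
  this identity every stochastic term is converted into the unit h^beta.\<close>

lemma h_rate:
  assumes "2 \<le> n"
  shows "ln (real n) / (real n * h n) = (h n powr \<beta>)\<^sup>2 / ch powr (2 * \<beta> + 1)"
proof -
  have q: "0 < ln (real n) / real n" using assms by simp
  have "(h n powr \<beta>)\<^sup>2 * h n = h n powr \<beta> * h n powr \<beta> * h n powr 1"
    using h_pos[OF assms] by (simp add: power2_eq_square)
  also have "\<dots> = h n powr (2 * \<beta> + 1)" by (simp only: powr_add[symmetric]) simp
  also have "\<dots> = ch powr (2 * \<beta> + 1) * (ln (real n) / real n)"
  proof -
    have "(ln (real n) / real n) powr (1 / (2 * \<beta> + 1) * (2 * \<beta> + 1)) = ln (real n) / real n"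
      using q beta assms by simp
    then show ?thesis unfolding hn_def using ch_pos q by (simp only: powr_mult powr_powr)
  qed
  finally show ?thesis using h_pos[OF assms] ch_pos assms by (simp add: field_simps)
qed

text \<open>Up to a constant the separation rate is h^beta for beta <= 1 and h^(beta - 1) for beta >
  1.\<close>

lemma Delta_rate_eq:
  assumes "2 \<le> n"
  shows "Delta_rate \<beta> n = h n powr (\<beta> - real_of_int \<lceil>\<beta>\<rceil> + 1) / ch powr (\<beta> - real_of_int \<lceil>\<beta>\<rceil> + 1)"
proof -
  let ?q = "ln (real n) / real n"
  have "0 < ?q" using assms by simp
  then have "h n powr (\<beta> - real_of_int \<lceil>\<beta>\<rceil> + 1)
      = ch powr (\<beta> - real_of_int \<lceil>\<beta>\<rceil> + 1) * (?q powr (1 / (2 * \<beta> + 1))) powr (\<beta> - real_of_int \<lceil>\<beta>\<rceil> + 1)"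
    unfolding hn_def using ch_pos by (simp add: powr_mult)
  also have "(?q powr (1 / (2 * \<beta> + 1))) powr (\<beta> - real_of_int \<lceil>\<beta>\<rceil> + 1) = Delta_rate \<beta> n"
    unfolding Delta_rate_def powr_powr by simp
  finally show ?thesis using ch_pos by simp
qed

text \<open>\<open>16 * h n \<le> 1\<close> leaves room for a window of length 8h on one side of any
  point, the bound on \<open>Nmax\<close> reduces the logarithm in the threshold to log n, the power
  of 7/8 gives a success chance of 2/3 per good index, and \<open>4 / real n \<le> \<alpha>\<close>
  turns the noise probability 2/n into alpha/2.\<close>

definition large :: "nat \<Rightarrow> bool" where
  "large n \<longleftrightarrow> 2 \<le> n \<and> 2 \<le> real n * h n \<and> 16 * h n \<le> 1
     \<and> Nmax \<beta> L \<sigma> K Kmax lam0 \<alpha> n \<le> \<alpha> * real n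
     \<and> (7 / 8) ^ nat \<lceil>20 * ln (real n)\<rceil> \<le> (1 / 3 :: real) \<and> 4 / real n \<le> \<alpha>
     \<and> (\<forall>x\<in>{0..1}. \<forall>e. eigenvalue (Bmat (kord \<beta>) K n (h n) x) e \<longrightarrow> lam0 \<le> e)"

lemma eventually_large: "eventually large sequentially"
proof -
  define g where "g = 1 / (2 * \<beta> + 1)"
  have g: "0 < g" "g < 1" using beta by (auto simp: g_def)
  obtain c where c: "c = ch" "0 < c" using ch_pos by blast
  define d where "d = - 2 * ln (\<alpha> / 2)"
  have d: "0 < d" using alpha by (simp add: d_def)
  have h_eq: "h n = c * (ln (real n) / real n) powr g" for n by (simp add: hn_def g_def c(1))
  have "((\<lambda>n. c * (ln (real n) / real n) powr g) \<longlongrightarrow> 0) sequentially"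
    using g c(2) by real_asymp
  then have 1: "eventually (\<lambda>n. h n < 1 / 16) sequentially"
    unfolding h_eq by (rule order_tendstoD) simp
  have "filterlim (\<lambda>n. real n * (c * (ln (real n) / real n) powr g)) at_top sequentially"
    using g c(2) by real_asymp
  then have 2: "eventually (\<lambda>n. 2 \<le> real n * h n) sequentially"
    unfolding h_eq by (simp add: filterlim_at_top)
  \<comment> \<open>\<open>Nmax\<close> is a power of log n times n^g with g < 1, hence of smaller
    order than n.\<close>
  have "((\<lambda>n. 40 / ln 2 * (d / (c * (ln (real n) / real n) powr g)) * (ln (real n))\<^sup>2 / real n) \<longlongrightarrow> 0) sequentially"
    using g c(2) d by real_asymp
  then have 3: "eventually (\<lambda>n. Nmax \<beta> L \<sigma> K Kmax lam0 \<alpha> n / real n < \<alpha>) sequentially"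
    unfolding Nmax_def Cn_def h_eq d_def[symmetric] using alpha by (intro order_tendstoD) auto
  have "((\<lambda>n. (7 / 8) ^ nat \<lceil>20 * ln (real n)\<rceil>) \<longlongrightarrow> (0::real)) sequentially"
    by real_asymp
  then have 4: "eventually (\<lambda>n. (7 / 8) ^ nat \<lceil>20 * ln (real n)\<rceil> < (1 / 3 :: real)) sequentially"
    by (rule order_tendstoD) simp
  have "((\<lambda>n. 4 / real n) \<longlongrightarrow> 0) sequentially" by real_asymp
  then have 5: "eventually (\<lambda>n. 4 / real n < \<alpha>) sequentially"
    using alpha by (intro order_tendstoD) auto
  from 1 2 3 4 5 eig eventually_ge_at_top[of 2] show ?thesis
    by eventually_elim (simp add: large_def divide_less_eq less_imp_le)
qed

definition thr_const :: real where
  "thr_const = \<sigma> * sqrt (2 * W / ch powr (2 * \<beta> + 1))"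

text \<open>The logarithm is at most log n because \<open>Nmax\<close> is at most alpha n, and the
  minimum is at most its second entry h, whatever the distance of the two points;
  \<open>h_rate\<close> then gives the order h^beta.\<close>

lemma threshold_le:
  assumes "large n"
  shows "\<sigma> * sqrt (- 2 * ln (\<alpha> / Nmax \<beta> L \<sigma> K Kmax lam0 \<alpha> n) * W)
     * real n powr (- 1 / 2) * h n powr (- 3 / 2) * min (8 * L2c \<beta> Kmax LK / lam0 * \<bar>d\<bar>) (h n)
    \<le> thr_const * h n powr \<beta>"
proof -
  let ?N = "Nmax \<beta> L \<sigma> K Kmax lam0 \<alpha> n"
  have n: "2 \<le> n" and Nle: "?N \<le> \<alpha> * real n" using assms by (auto simp: large_def)
  have h: "0 < h n" by (rule h_pos[OF n])
  have "0 < Cn \<beta> L \<sigma> K Kmax lam0 \<alpha> n" using h alpha by (simp add: Cn_def divide_neg_pos)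
  then have N: "0 < ?N" using n by (simp add: Nmax_def)
  have "1 / real n \<le> \<alpha> / ?N" using Nle N n alpha by (simp add: field_simps)
  then have "ln (1 / real n) \<le> ln (\<alpha> / ?N)" using n N alpha by (subst ln_le_cancel_iff) auto
  then have "- 2 * ln (\<alpha> / ?N) \<le> 2 * ln (real n)" using n by (simp add: ln_div)
  then have "- 2 * ln (\<alpha> / ?N) * W \<le> 2 * ln (real n) * W" using W_nonneg by (rule mult_right_mono)
  then have s: "sqrt (- 2 * ln (\<alpha> / ?N) * W) \<le> sqrt (2 * ln (real n) * W)" by simp
  have L2: "0 \<le> L2c \<beta> Kmax LK" using K_consts LK beta by (simp add: L2c_def)
  have m: "0 \<le> min (8 * L2c \<beta> Kmax LK / lam0 * \<bar>d\<bar>) (h n)" using L2 lambda0 h by simp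
  have "\<sigma> * sqrt (- 2 * ln (\<alpha> / ?N) * W) * real n powr (- 1 / 2) * h n powr (- 3 / 2)
      * min (8 * L2c \<beta> Kmax LK / lam0 * \<bar>d\<bar>) (h n)
    \<le> \<sigma> * sqrt (2 * ln (real n) * W) * real n powr (- 1 / 2) * h n powr (- 3 / 2) * h n"
    using s m sigma W_nonneg n by (intro mult_mono mult_right_mono mult_left_mono mult_nonneg_nonneg) auto
  also have "\<dots> = \<sigma> * (sqrt (2 * ln (real n) * W) * (real n powr (- 1 / 2) * (h n powr (- 3 / 2) * h n powr 1)))"
    using h by simp
  also have "h n powr (- 3 / 2) * h n powr 1 = h n powr (- 1 / 2)" by (simp only: powr_add[symmetric]) simp
  also have "real n powr (- 1 / 2) * h n powr (- 1 / 2) = 1 / sqrt (real n * h n)"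
    using h n by (simp add: powr_minus_divide powr_half_sqrt real_sqrt_mult)
  also have "\<sigma> * (sqrt (2 * ln (real n) * W) * (1 / sqrt (real n * h n)))
      = \<sigma> * sqrt (2 * W * (ln (real n) / (real n * h n)))"
    by (simp add: real_sqrt_divide[symmetric] mult_ac)
  also have "\<dots> = \<sigma> * sqrt ((2 * W / ch powr (2 * \<beta> + 1)) * (h n powr \<beta>)\<^sup>2)"
    unfolding h_rate[OF n] by (simp add: mult_ac)
  also have "\<dots> = thr_const * h n powr \<beta>"
    unfolding thr_const_def real_sqrt_mult[of _ "(h n powr \<beta>)\<^sup>2"] by simp
  finally show ?thesis .
qed

lemma lpe_setup_large:
  assumes "large n"
  shows "lpe_setup K Kmax lam0 (kord \<beta>) n (h n)"
proof
  show "kord \<beta> \<le> 1" using kord_le_1[of \<beta>] kord_gt_1[of \<beta>] beta by (cases "\<beta> \<le> 1") auto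
  show "0 < h n" "1 \<le> real n * h n" using assms h_pos by (auto simp: large_def)
  show "lam0 \<le> e" if "x \<in> {0..1}" "eigenvalue (Bmat (kord \<beta>) K n (h n) x) e" for x e
    using assms that by (auto simp: large_def)
qed (use K_nonneg K_bounds K_supp lambda0 in auto)

text \<open>Calibrated so that the exponent of the Gaussian tail is exactly -2 log n, which leaves
  2/n after the union over n points and two signs.\<close>

definition noise_const :: real where
  "noise_const = sqrt (4 * \<sigma>\<^sup>2 * (12 * Kmax\<^sup>2 / lam0\<^sup>2) / ch powr (2 * \<beta> + 1))"

text \<open>Threshold and boundary correction, plus the bias (constant 6) and the noise bound
  counted twice, once for each point of the pair.\<close>

definition viol_const :: real where
  "viol_const = thr_const + max (16 * Kmax / lam0) 2 * L + 12 * Kmax * L / lam0 + 2 * noise_const"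

lemma noise_const_pos: "0 < noise_const"
  using sigma K_consts lambda0 ch_pos by (simp add: noise_const_def)

lemma viol_const_pos: "0 < viol_const"
proof -
  have "0 \<le> thr_const" using sigma W_nonneg ch_pos by (simp add: thr_const_def)
  moreover have "0 < max (16 * Kmax / lam0) 2 * L" using L by (simp add: max_def)
  moreover have "0 < 12 * Kmax * L / lam0" using L K_consts lambda0 by simp
  ultimately show ?thesis using noise_const_pos by (simp add: viol_const_def)
qed

lemma local_test_rejects:
  assumes n: "large n" and f: "f \<in> holder_class \<beta> L"
    and noise: "\<not> lpe_setup.noise_exceeds K (kord \<beta>) n (h n) (noise_const * h n powr \<beta>) f Y"
    and i: "i \<in> {1..n}" and j: "j \<in> {1..n}"
    and drop: "viol_const * h n powr \<beta> \<le> f (real i / real n) - f (real j / real n)"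
  shows "\<Phi> n Y i j"
proof -
  interpret lpe_setup K Kmax lam0 "kord \<beta>" n "h n" by (rule lpe_setup_large[OF n])
  let ?H = "h n powr \<beta>"
  let ?E = "\<lambda>i. lpe (kord \<beta>) K n (h n) Y (real i / real n)"
  have est: "\<bar>?E i - f (real i / real n)\<bar> \<le> (6 * Kmax * L / lam0 + noise_const) * ?H" if i: "i \<in> {1..n}" for i
  proof -
    let ?m = "\<Sum>j=1..n. lpe_weight (kord \<beta>) K n (h n) (real i / real n) j * f (real j / real n)"
    have x: "real i / real n \<in> {0..1}" using i by auto
    have L0: "0 \<le> L" using L by simp
    obtain g where g: "kord \<beta> = 0 \<Longrightarrow> g = 0"
      "\<And>y. y \<in> {0..1} \<Longrightarrow> \<bar>f y - f (real i / real n) - g * (y - real i / real n)\<bar> \<le> L * \<bar>y - real i / real n\<bar> powr \<beta>"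
      using holder_class_taylor[OF beta L0 f x] by blast
    have "\<bar>?m - f (real i / real n)\<bar> \<le> 6 * Kmax * L / lam0 * ?H"
      by (rule lpe_bias[OF x L0 beta(1) g])
    moreover have "\<bar>?E i - ?m\<bar> \<le> noise_const * ?H"
      using noise i unfolding noise_exceeds_def by (meson linear)
    ultimately show ?thesis unfolding ring_distribs by linarith
  qed
  define T where "T = ?E i - ?E j"
  have "f (real i / real n) - f (real j / real n) - 2 * ((6 * Kmax * L / lam0 + noise_const) * ?H) \<le> T"
    using est[OF i] est[OF j] unfolding T_def abs_le_iff by linarith
  then have T: "(thr_const + max (16 * Kmax / lam0) 2 * L) * ?H \<le> T"
    using drop unfolding viol_const_def ring_distribs by simp
  have thr: "\<sigma> * sqrt (- 2 * ln (\<alpha> / Nmax \<beta> L \<sigma> K Kmax lam0 \<alpha> n) * W)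
     * real n powr (- 1 / 2) * h n powr (- 3 / 2)
     * min (8 * L2c \<beta> Kmax LK / lam0 * \<bar>real i / real n - real j / real n\<bar>) (h n)
    \<le> thr_const * ?H" by (rule threshold_le[OF n])
  \<comment> \<open>The boundary correction is charged to every pair, interior ones included, so one
    constant covers both cases.\<close>
  have D: "(if b then 0 else max (16 * Kmax / lam0) 2 * L * ?H) \<le> max (16 * Kmax / lam0) 2 * L * ?H" for b
    using L by (simp add: le_max_iff_disj)
  show ?thesis
    unfolding local_test_def Let_def T_def[symmetric]
    by (rule order_trans[OF add_mono[OF thr D]]) (use T in \<open>simp add: ring_distribs\<close>)
qed

lemma noise_prob_le:
  assumes n: "large n"
  shows "measure (data_law \<sigma> f n) {Y \<in> space (data_law \<sigma> f n).
      lpe_setup.noise_exceeds K (kord \<beta>) n (h n) (noise_const * h n powr \<beta>) f Y} \<le> \<alpha> / 2"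
proof -
  interpret lpe_setup K Kmax lam0 "kord \<beta>" n "h n" by (rule lpe_setup_large[OF n])
  have n2: "2 \<le> n" and n4: "4 / real n \<le> \<alpha>" using n by (auto simp: large_def)
  let ?t = "noise_const * h n powr \<beta>" and ?v = "12 * Kmax\<^sup>2 / lam0\<^sup>2"
  have v: "0 < ?v" using K_consts lambda0 by simp
  have nn: "0 \<le> 4 * \<sigma>\<^sup>2 * ?v / ch powr (2 * \<beta> + 1)" by simp
  have "?t\<^sup>2 = 4 * \<sigma>\<^sup>2 * ?v * ((h n powr \<beta>)\<^sup>2 / ch powr (2 * \<beta> + 1))"
    unfolding power_mult_distrib noise_const_def real_sqrt_pow2[OF nn] by (simp add: mult_ac)
  also have "\<dots> = 4 * \<sigma>\<^sup>2 * ?v * (ln (real n) / (real n * h n))"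
    unfolding h_rate[OF n2] ..
  finally have t2: "?t\<^sup>2 = 4 * \<sigma>\<^sup>2 * ?v * (ln (real n) / (real n * h n))" .
  have nhp: "0 < real n * h n" using n2 h_pos by simp
  have expo: "- ?t\<^sup>2 / (2 * \<sigma>\<^sup>2 * (?v / (real n * h n))) = - (2 * ln (real n))"
  proof -
    have "- (4 * s * v * (l / m)) / (2 * s * (v / m)) = - (2 * l)"
      if "0 < s" "0 < v" "0 < m" for s v l m :: real
      using that by (simp add: field_simps)
    from this[of "\<sigma>\<^sup>2" ?v "real n * h n" "ln (real n)"] show ?thesis
      unfolding t2 using sigma v nhp by simp
  qed
  have "0 < ?t" using noise_const_pos h_pos by simp
  from noise_exceeds_prob_le[OF sigma K_consts(2) this, of f]
  have "measure (data_law \<sigma> f n) {Y \<in> space (data_law \<sigma> f n). noise_exceeds ?t f Y}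
      \<le> 2 * real n * exp (- (2 * ln (real n)))"
    unfolding expo .
  also have "exp (- (2 * ln (real n))) = 1 / (real n * real n)"
  proof -
    have "exp (- (2 * ln (real n))) = inverse (exp (ln (real n)) * exp (ln (real n)))"
      by (simp only: mult_2 exp_minus exp_add)
    then show ?thesis using n2 by (simp add: inverse_eq_divide)
  qed
  also have "2 * real n * (1 / (real n * real n)) = 2 / real n" by simp
  also have "\<dots> \<le> \<alpha> / 2" using n4 by simp
  finally show ?thesis .
qed

section \<open>From rejecting local tests to the power of the randomized test\<close>

lemma local_test_measurable:
  "Measurable.pred (PiM {1..n} (\<lambda>_. borel)) (\<lambda>Y. \<Phi> n Y i j)"
  unfolding local_test_def Let_def lpe_def by measurable

text \<open>A round draws an index of \<open>A\<close> with probability at least 3/2 h and then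
  succeeds with probability at least 2/3, which makes h. Rounding the number of rounds up only
  helps, and h C_n = -2 log(alpha/2), so all rounds fail with probability at most
  (alpha/2)^2.\<close>

lemma pmf_fomt_ge:
  assumes n: "large n" and A: "A \<subseteq> {1..n}" "3 / 2 * (real n * h n) \<le> card A"
    and good: "\<And>I. I \<in> A \<Longrightarrow> good_index n (\<Phi> n Y) I"
  shows "1 - \<alpha> / 2 \<le> pmf (fomt \<beta> L \<sigma> K Kmax LK lam0 \<alpha> n Y) True"
proof -
  let ?R = "nat \<lceil>20 * ln (real n)\<rceil>" and ?N = "nat \<lceil>Cn \<beta> L \<sigma> K Kmax lam0 \<alpha> n\<rceil>"
  define p where "p = pmf (bind_pmf (pmf_of_set {1..n}) (fomt_inner n ?R (\<Phi> n Y))) True"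
  have n2: "2 \<le> n" and R: "(7 / 8) ^ ?R \<le> (1 / 3 :: real)" using n by (auto simp: large_def)
  have h: "0 < h n" by (rule h_pos[OF n2])
  have p1: "p \<le> 1" by (simp add: p_def pmf_le_1)
  have "h n = 3 / 2 * h n * (2 / 3)" by simp
  also have "\<dots> \<le> real (card A) / real n * (1 - (1 - 1 / 8) ^ ?R)"
  proof (rule mult_mono)
    show "3 / 2 * h n \<le> real (card A) / real n" using A(2) n2 by (simp add: field_simps)
  qed (use R in auto)
  also have "\<dots> \<le> p"
    unfolding p_def using n2 A(1) good by (intro pmf_fomt_outer_ge) (auto simp: good_index_def)
  finally have hp: "h n \<le> p" .
  have "1 - p \<le> exp (- h n)" using hp exp_ge_add_one_self[of "- h n"] by linarith
  then have "(1 - p) ^ ?N \<le> exp (- h n) ^ ?N" using p1 by (intro power_mono) auto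
  also have "\<dots> = exp (- (h n * real ?N))" by (simp add: exp_of_nat_mult[symmetric] mult.commute)
  also have "\<dots> \<le> exp (2 * ln (\<alpha> / 2))"
  proof -
    have "Cn \<beta> L \<sigma> K Kmax lam0 \<alpha> n \<le> real ?N" by linarith
    then have "h n * Cn \<beta> L \<sigma> K Kmax lam0 \<alpha> n \<le> h n * real ?N" using h by (intro mult_left_mono) auto
    moreover have "h n * Cn \<beta> L \<sigma> K Kmax lam0 \<alpha> n = - 2 * ln (\<alpha> / 2)" using h by (simp add: Cn_def)
    ultimately show ?thesis by simp
  qed
  also have "\<dots> = (\<alpha> / 2) * (\<alpha> / 2)" using alpha by (simp only: mult_2 exp_add) simp
  also have "\<dots> \<le> (\<alpha> / 2) * 1" using alpha by (intro mult_left_mono) auto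
  finally have "(1 - p) ^ ?N \<le> \<alpha> / 2" by simp
  then show ?thesis unfolding fomt_eq pmf_repeat_True p_def by simp
qed

text \<open>\<open>block\<close> is stated for an arbitrary relation that contains all violated
  pairs. The combinatorial part thus depends on f alone and is applied to the random relation of the
  local tests, for each data vector off the noise event.\<close>

lemma power_ge:
  assumes n: "large n" and f: "f \<in> holder_class \<beta> L"
    and block: "\<And>\<Psi>. (\<And>i j. 1 \<le> i \<Longrightarrow> i < j \<Longrightarrow> j \<le> n \<Longrightarrow>
         viol_const * h n powr \<beta> \<le> f (real i / real n) - f (real j / real n) \<Longrightarrow> \<Psi> i j) \<Longrightarrow>
       \<exists>A\<subseteq>{1..n}. 3 / 2 * (real n * h n) \<le> card A \<and> (\<forall>I\<in>A. good_index n \<Psi> I)"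
  shows "1 - \<alpha> \<le> fpower n f"
proof -
  let ?P = "data_law \<sigma> f n"
  interpret prob_space ?P by (rule prob_space_data_law[OF sigma])
  interpret lpe_setup K Kmax lam0 "kord \<beta>" n "h n" by (rule lpe_setup_large[OF n])
  let ?bad = "\<lambda>Y. noise_exceeds (noise_const * h n powr \<beta>) f Y"
  let ?G = "{Y \<in> space ?P. \<not> ?bad Y}"
  let ?F = "\<lambda>Y. pmf (fomt \<beta> L \<sigma> K Kmax LK lam0 \<alpha> n Y) True"
  have bad: "{Y \<in> space ?P. ?bad Y} \<in> events"
    using noise_exceeds_measurable by (simp add: pred_def sets_data_law space_data_law)
  have G_eq: "?G = space ?P - {Y \<in> space ?P. ?bad Y}" by blast
  have G: "?G \<in> events" unfolding G_eq using bad by blast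
  have probG: "1 - \<alpha> / 2 \<le> prob ?G"
    unfolding G_eq prob_compl[OF bad] using noise_prob_le[OF n, of f] by linarith
  have ge: "(1 - \<alpha> / 2) * indicator ?G Y \<le> ?F Y" for Y
  proof (cases "Y \<in> ?G")
    case True
    have "\<exists>A\<subseteq>{1..n}. 3 / 2 * (real n * h n) \<le> card A \<and> (\<forall>I\<in>A. good_index n (\<Phi> n Y) I)"
      using True by (intro block local_test_rejects[OF n f]) auto
    then show ?thesis using True pmf_fomt_ge[OF n] by auto
  qed simp
  have "?F \<in> borel_measurable ?P"
    unfolding measurable_data_law fomt_eq
    using n by (intro pmf_fomt_measurable local_test_measurable) (auto simp: large_def)
  then have intF: "integrable ?P ?F"
    by (intro integrable_const_bound[where B = 1]) (auto simp: pmf_le_1)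
  \<comment> \<open>Noise and auxiliary draws each cost at most alpha/2.\<close>
  have "1 - \<alpha> \<le> (1 - \<alpha> / 2) * (1 - \<alpha> / 2)" by (simp add: algebra_simps)
  also have "\<dots> \<le> (1 - \<alpha> / 2) * prob ?G" using probG alpha by (intro mult_left_mono) auto
  also have "\<dots> = (\<integral>Y. (1 - \<alpha> / 2) * indicator ?G Y \<partial>?P)"
    using G by simp
  also have "\<dots> \<le> (\<integral>Y. ?F Y \<partial>?P)"
    using G intF ge by (intro integral_mono) (auto simp: emeasure_eq_measure)
  finally show ?thesis by (simp add: fomt_power_def)
qed

text \<open>\<open>2 * viol_const + 20 * L\<close> is the demand of \<open>good_block_rough\<close>,
  and the added 1 makes its inequality strict; the steep case asks only for
  \<open>viol_const + 8 * L\<close>. The power of \<open>ch\<close> converts h into the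
  rate.\<close>

definition sep_const :: real where
  "sep_const = ch powr (\<beta> - real_of_int \<lceil>\<beta>\<rceil> + 1) * (2 * viol_const + 20 * L + 1)"

lemma sep_const_pos: "0 < sep_const"
  using ch_pos viol_const_pos L by (simp add: sep_const_def)

lemma sep_rate:
  assumes "2 \<le> n" "sep_const \<le> C"
  shows "(2 * viol_const + 20 * L + 1) * h n powr (\<beta> - real_of_int \<lceil>\<beta>\<rceil> + 1) \<le> C * Delta_rate \<beta> n"
proof -
  have "0 \<le> Delta_rate \<beta> n" by (simp add: Delta_rate_def)
  then have "sep_const * Delta_rate \<beta> n \<le> C * Delta_rate \<beta> n" using assms by (intro mult_right_mono)
  moreover have "sep_const * Delta_rate \<beta> n = (2 * viol_const + 20 * L + 1) * h n powr (\<beta> - real_of_int \<lceil>\<beta>\<rceil> + 1)"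
    unfolding Delta_rate_eq[OF assms(1)] sep_const_def using ch_pos by simp
  ultimately show ?thesis by simp
qed

lemma power_alt_ge:
  assumes n: "large n" and C: "sep_const \<le> C" and f: "f \<in> alt_class \<beta> L (C * Delta_rate \<beta> n)"
  shows "1 - \<alpha> \<le> fpower n f"
proof -
  have n2: "2 \<le> n" and nh: "2 \<le> real n * h n" and h16: "16 * h n \<le> 1" using n by (auto simp: large_def)
  have h: "0 < h n" by (rule h_pos[OF n2])
  have rate: "(2 * viol_const + 20 * L + 1) * h n powr (\<beta> - real_of_int \<lceil>\<beta>\<rceil> + 1) \<le> C * Delta_rate \<beta> n"
    by (rule sep_rate[OF n2 C])
  have L0: "0 \<le> L" using L by simp
  have fH: "f \<in> holder_class \<beta> L" using f by (auto simp: alt_class_def split: if_splits)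
  show ?thesis
  proof (cases "\<beta> \<le> 1")
    case True
    have c1: "\<lceil>\<beta>\<rceil> = 1" using kord_le_1 beta True by auto
    have "\<exists>a b. 0 \<le> a \<and> a < b \<and> b \<le> 1 \<and> f a - f b \<ge> C * Delta_rate \<beta> n"
      using f unfolding alt_class_def if_P[OF True] by blast
    then obtain a b where ab: "0 \<le> a" "a < b" "b \<le> 1" and drop: "C * Delta_rate \<beta> n \<le> f a - f b" by blast
    have "(2 * viol_const + 20 * L + 1) * h n powr \<beta> \<le> f a - f b"
      using rate drop unfolding c1 by simp
    moreover have "0 < h n powr \<beta>" using h by simp
    ultimately have drop': "2 * (viol_const * h n powr \<beta>) + 20 * L * h n powr \<beta> < f a - f b"
      unfolding ring_distribs by linarith
    have hol: "\<bar>f x - f y\<bar> \<le> L * \<bar>x - y\<bar> powr \<beta>" if "x \<in> {0..1}" "y \<in> {0..1}" for x y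
      using fH that unfolding holder_class_le_1[OF beta(1) True] by blast
    have nu: "0 \<le> viol_const * h n powr \<beta>" using viol_const_pos by simp
    show ?thesis
      by (rule power_ge[OF n fH], rule good_block_rough[OF beta(1) True L0 h nh hol ab drop' nu]) blast+
  next
    case False
    then have b1: "1 < \<beta>" by simp
    have c2: "\<lceil>\<beta>\<rceil> = 2" using kord_gt_1 beta False by auto
    obtain x0 d0 where x0: "x0 \<in> {0..1}" "(f has_real_derivative d0) (at x0 within {0..1})" "d0 \<le> - (C * Delta_rate \<beta> n)"
      using f unfolding alt_class_def if_not_P[OF False] by blast
    obtain d where d: "\<forall>x\<in>{0..1}. (f has_real_derivative d x) (at x within {0..1})"
       "\<forall>x\<in>{0..1}. \<forall>y\<in>{0..1}. \<bar>d x - d y\<bar> \<le> L * \<bar>x - y\<bar> powr (\<beta> - 1)"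
      using fH unfolding holder_class_gt_1[OF b1 beta(2)] by blast
    \<comment> \<open>The derivative that witnesses membership in the alternatives and the one of
      the Hoelder class coincide, also at the endpoints, where both are one-sided.\<close>
    have "d x0 = d0"
    proof (rule vector_derivative_unique_within_closed_interval[of 0 "1::real"])
      show "(f has_vector_derivative d x0) (at x0 within cbox 0 1)"
        "(f has_vector_derivative d0) (at x0 within cbox 0 1)"
        using d(1) x0 by (simp_all add: has_real_derivative_iff_has_vector_derivative)
    qed (use x0 in auto)
    let ?G = "h n powr (\<beta> - 1)"
    have dx0: "d x0 \<le> - ((2 * viol_const + 20 * L + 1) * ?G)"
      using rate x0(3) \<open>d x0 = d0\<close> unfolding c2 by simp
    \<comment> \<open>The window extends from \<open>x0\<close> towards the farther end of [0,1],
      where 8h <= 1/2 leaves room for it.\<close>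
    define u where "u = (if x0 \<le> 1 / 2 then x0 else x0 - 8 * h n)"
    have u: "0 \<le> u" "u + 8 * h n \<le> 1" "u \<le> x0" "x0 \<le> u + 8 * h n"
      using x0(1) h h16 by (auto simp: u_def)
    \<comment> \<open>Within the window f' varies by at most L (8h)^(beta - 1) <= 8 L h^(beta - 1),
      which \<open>sep_const\<close> absorbs.\<close>
    have steep: "d z \<le> - (viol_const * ?G)" if z: "u \<le> z" "z \<le> u + 8 * h n" for z
    proof -
      have "\<bar>z - x0\<bar> powr (\<beta> - 1) \<le> (8 * h n) powr (\<beta> - 1)"
        using z u b1 by (intro powr_mono2) auto
      also have "\<dots> = 8 powr (\<beta> - 1) * ?G" using h by (simp add: powr_mult)
      also have "\<dots> \<le> 8 * ?G"
        using powr_mono[of "\<beta> - 1" 1 8] beta by (intro mult_right_mono) auto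
      finally have "L * \<bar>z - x0\<bar> powr (\<beta> - 1) \<le> L * (8 * ?G)" using L0 by (rule mult_left_mono)
      moreover have "\<bar>d z - d x0\<bar> \<le> L * \<bar>z - x0\<bar> powr (\<beta> - 1)" using d(2) z u x0(1) by auto
      ultimately have "d z \<le> d x0 + L * (8 * ?G)" unfolding abs_le_iff by linarith
      moreover have "0 \<le> viol_const * ?G" "0 \<le> L * ?G" "0 \<le> ?G" using viol_const_pos L0 by auto
      ultimately show ?thesis using dx0 unfolding ring_distribs by linarith
    qed
    have drop: "viol_const * h n powr \<beta> \<le> f x - f y" if xy: "u \<le> x" "x + h n \<le> y" "y \<le> u + 8 * h n" for x y
    proof -
      have "0 \<le> x" "x < y" "y \<le> 1" using xy u h by auto
      from mvt_within_unit[OF d(1) this] obtain z where z: "x < z" "z < y" "f y - f x = d z * (y - x)" by blast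
      have G0: "0 \<le> viol_const * ?G" using viol_const_pos by simp
      have "viol_const * h n powr \<beta> = viol_const * ?G * h n" using h by (simp add: powr_diff)
      also have "\<dots> \<le> - d z * (y - x)"
        using steep[of z] z xy h G0 by (intro mult_mono) auto
      finally show ?thesis using z(3) by simp
    qed
    show ?thesis
    proof (rule power_ge[OF n fH])
      fix \<Psi> assume Psi: "\<And>i j. 1 \<le> i \<Longrightarrow> i < j \<Longrightarrow> j \<le> n \<Longrightarrow>
         viol_const * h n powr \<beta> \<le> f (real i / real n) - f (real j / real n) \<Longrightarrow> \<Psi> i j"
      show "\<exists>A\<subseteq>{1..n}. 3 / 2 * (real n * h n) \<le> card A \<and> (\<forall>I\<in>A. good_index n \<Psi> I)"
        by (rule good_block_steep[OF h nh u(1,2), where f = f and \<nu> = "viol_const * h n powr \<beta>"])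
           (fact drop, fact Psi)
    qed
  qed
qed

lemma fomt_power_liminf:
  assumes "sep_const \<le> C"
  shows "liminf (\<lambda>n. INF f\<in>alt_class \<beta> L (C * Delta_rate \<beta> n). ereal (fpower n f)) \<ge> ereal (1 - \<alpha>)"
proof (rule Liminf_bounded)
  show "eventually (\<lambda>n. ereal (1 - \<alpha>) \<le> (INF f\<in>alt_class \<beta> L (C * Delta_rate \<beta> n). ereal (fpower n f))) sequentially"
    using eventually_large
  proof eventually_elim
    case (elim n)
    then show ?case using power_alt_ge[OF elim assms] by (intro INF_greatest) simp
  qed
qed

end

theorem mainTheorem2:
  fixes \<beta> L \<sigma> \<alpha> Kmin Kmax \<Delta> LK lam0 :: real and K :: "real \<Rightarrow> real"
  assumes beta: "0 < \<beta>" "\<beta> \<le> 2"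
    and L: "0 < L" and sigma: "0 < \<sigma>" and alpha: "0 < \<alpha>" "\<alpha> < 1"
    and K_nonneg: "\<forall>u. 0 \<le> K u"
    and K_int: "integrable lborel K" "(LINT u|lborel. K u) = 1"
    and K_supp: "\<forall>u. \<bar>u\<bar> > 1 \<longrightarrow> K u = 0"
    and K_consts: "0 < Kmin" "0 < Kmax" "0 < \<Delta>"
    and K_bounds: "\<forall>u. Kmin * indicator {v. \<bar>v\<bar> \<le> \<Delta>} u \<le> K u \<and> K u \<le> Kmax"
    and K_lip: "\<forall>u v. \<bar>K u - K v\<bar> \<le> LK * \<bar>u - v\<bar>"
    and K_sym: "\<forall>u. K (- u) = K u"
    and lambda0: "0 < lam0"
    and eig: "eventually (\<lambda>n. \<forall>x\<in>{0..1}. \<forall>e.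
                 eigenvalue (Bmat (kord \<beta>) K n (hn \<beta> L \<sigma> K Kmax lam0 n) x) e \<longrightarrow> lam0 \<le> e)
               sequentially"
  shows "\<exists>c C. 0 < c \<and> c < C \<and>
    liminf (\<lambda>n. INF f\<in>alt_class \<beta> L (C * Delta_rate \<beta> n).
               ereal (fomt_power \<beta> L \<sigma> K Kmax LK lam0 \<alpha> n f)) \<ge> ereal (1 - \<alpha>) \<and>
    (\<forall>\<Psi> :: nat \<Rightarrow> (nat \<Rightarrow> real) \<Rightarrow> bool.
       (\<forall>n. \<Psi> n \<in> measurable (PiM {1..n} (\<lambda>_. borel)) (count_space UNIV)) \<longrightarrow>
       limsup (\<lambda>n. SUP f\<in>null_class \<beta> L. ereal (rej_prob \<sigma> (\<Psi> n) n f)) \<le> ereal \<alpha> \<longrightarrow>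
       limsup (\<lambda>n. INF f\<in>alt_class \<beta> L (c * Delta_rate \<beta> n).
               ereal (rej_prob \<sigma> (\<Psi> n) n f)) \<le> ereal \<alpha>)"
proof -
  \<comment> \<open>A Lipschitz constant is nonnegative, as the points 0 and 1 show.\<close>
  have "0 \<le> \<bar>K 0 - K 1\<bar>" by simp
  also have "\<dots> \<le> LK" using K_lip[rule_format, of 0 1] by simp
  finally interpret fomt_setting \<beta> L \<sigma> \<alpha> Kmin Kmax \<Delta> LK lam0 K
    using assms by unfold_locales
  \<comment> \<open>L / 16 keeps the bumps in the Hoelder class; sigma / 6 keeps the chi-square
    exponent at log n / 12.\<close>
  define c where "c = min (L / 16) (\<sigma> / 6)"
  have c: "0 < c" "16 * c \<le> L" and "c \<le> \<sigma> / 6" using L sigma by (auto simp: c_def)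
  then have "c\<^sup>2 \<le> (\<sigma> / 6)\<^sup>2" by (intro power_mono) auto
  then have c2: "36 * c\<^sup>2 \<le> \<sigma>\<^sup>2" by (simp add: power_divide)
  show ?thesis
  \<comment> \<open>Adding c yields c < C; every constant from \<open>sep_const\<close> upwards
    serves for the power bound.\<close>
  proof (rule exI[of _ c], rule exI[of _ "sep_const + c"], intro conjI allI impI)
    show "0 < c" "c < sep_const + c" using c sep_const_pos by auto
    show "liminf (\<lambda>n. INF f\<in>alt_class \<beta> L ((sep_const + c) * Delta_rate \<beta> n).
               ereal (fomt_power \<beta> L \<sigma> K Kmax LK lam0 \<alpha> n f)) \<ge> ereal (1 - \<alpha>)"
      using c by (intro fomt_power_liminf) simp
    fix \<Psi> :: "nat \<Rightarrow> (nat \<Rightarrow> real) \<Rightarrow> bool"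
    assume "\<forall>n. \<Psi> n \<in> measurable (PiM {1..n} (\<lambda>_. borel)) (count_space UNIV)"
      and "limsup (\<lambda>n. SUP f\<in>null_class \<beta> L. ereal (rej_prob \<sigma> (\<Psi> n) n f)) \<le> ereal \<alpha>"
    then show "limsup (\<lambda>n. INF f\<in>alt_class \<beta> L (c * Delta_rate \<beta> n). ereal (rej_prob \<sigma> (\<Psi> n) n f)) \<le> ereal \<alpha>"
      using c c2 by (intro minimax_lower_bound[OF beta L sigma]) auto
  qed
qed

end
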